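(* Let $N\ge2$. Then $$\Bigl(\int_{\mathbf B}|u|^{2_1^*}\,dx\Bigr)^{\frac{2}{2_1^*}}\le\frac{1}{\mathscr C_{1,0,2_1^*}(\mathbf B)}\int_{\mathbf B}\bigl(|\nabla u|^2-|\partial_\theta u|^2\bigr)\,dx\qquad\text{for all }u\in H_0^1(\mathbf B).$$ Moreover, the exponent $2_1^*$ is optimal in the sense that no such inequality holds for $p>2_1^*$: for every $p>2_1^*$ there is no constant $C<\infty$ such that $\bigl(\int_{\mathbf B}|u|^{p}dx\bigr)^{2/p}\le C\int_{\mathbf B}(|\nabla u|^2-|\partial_\theta u|^2)\,dx$ for all $u\in H^1_0(\mathbf B)$.
   Context: $\mathbf B$ is the open unit ball in $\mathbb R^N$, $\partial_\theta=x_1\partial_{x_2}-x_2\partial_{x_1}$, $2_1^*=\frac{4N+2}{2N-3}$, functions are real-valued, and $$\mathscr C_{1,0,2_1^*}(\mathbf B)=\inf_{u\in H_0^1(\mathbf B)\setminus\{0\}}\frac{\int_{\mathbf B}(|\nabla u|^2-|\partial_\theta u|^2)\,dx}{\left(\int_{\mathbf B}|u|^{2_1^*}dx\right)^{2/2_1^*}}$$ (part of the assertion is that this number is positive, so that the right-hand side is meaningful). *)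

theory Defs
  imports "HOL-Analysis.Analysis"
begin

definition grad :: "(real ^ 'n \<Rightarrow> real) \<Rightarrow> real ^ 'n \<Rightarrow> real ^ 'n" where
  "grad f x = (\<chi> i. frechet_derivative f (at x) (axis i 1))"

primrec Ck :: "nat \<Rightarrow> (real ^ 'n \<Rightarrow> real) \<Rightarrow> bool" where
  "Ck 0 f \<longleftrightarrow> continuous_on UNIV f"
| "Ck (Suc k) f \<longleftrightarrow> (\<forall>x. f differentiable (at x)) \<and> (\<forall>i. Ck k (\<lambda>x. grad f x $ i))"

definition test_functions :: "(real ^ 'n) set \<Rightarrow> (real ^ 'n \<Rightarrow> real) set" where
  "test_functions \<Omega> =
     {\<phi>. (\<forall>k. Ck k \<phi>) \<and> compact (closure {x. \<phi> x \<noteq> 0}) \<and> closure {x. \<phi> x \<noteq> 0} \<subseteq> \<Omega>}"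

definition locally_integrable ::
    "(real ^ 'n) set \<Rightarrow> (real ^ 'n \<Rightarrow> 'b :: euclidean_space) \<Rightarrow> bool" where
  "locally_integrable \<Omega> f \<longleftrightarrow> (\<forall>K. compact K \<and> K \<subseteq> \<Omega> \<longrightarrow> f absolutely_integrable_on K)"

definition has_weak_grad ::
    "(real ^ 'n) set \<Rightarrow> (real ^ 'n \<Rightarrow> real) \<Rightarrow> (real ^ 'n \<Rightarrow> real ^ 'n) \<Rightarrow> bool" where
  "has_weak_grad \<Omega> u g \<longleftrightarrow>
     locally_integrable \<Omega> u \<and> locally_integrable \<Omega> g \<and>
     (\<forall>\<phi> \<in> test_functions \<Omega>.
        (LINT x|lebesgue_on \<Omega>. u x *\<^sub>R grad \<phi> x) = - (LINT x|lebesgue_on \<Omega>. \<phi> x *\<^sub>R g x))"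

(* A representative; weak gradients are unique up to null sets. *)
definition weak_grad :: "(real ^ 'n) set \<Rightarrow> (real ^ 'n \<Rightarrow> real) \<Rightarrow> real ^ 'n \<Rightarrow> real ^ 'n" where
  "weak_grad \<Omega> u = (SOME g. has_weak_grad \<Omega> u g)"

(* Elements are representatives, defined on all of space; values outside \<Omega> play no role. *)
definition H1 :: "(real ^ 'n) set \<Rightarrow> (real ^ 'n \<Rightarrow> real) set" where
  "H1 \<Omega> = {u. (\<exists>g. has_weak_grad \<Omega> u g) \<and>
              integrable (lebesgue_on \<Omega>) (\<lambda>x. (u x)\<^sup>2) \<and>
              integrable (lebesgue_on \<Omega>) (\<lambda>x. (norm (weak_grad \<Omega> u x))\<^sup>2)}"

definition H1_norm :: "(real ^ 'n) set \<Rightarrow> (real ^ 'n \<Rightarrow> real) \<Rightarrow> real" where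
  "H1_norm \<Omega> u = sqrt ((LINT x|lebesgue_on \<Omega>. (u x)\<^sup>2) +
                        (LINT x|lebesgue_on \<Omega>. (norm (weak_grad \<Omega> u x))\<^sup>2))"

definition H10 :: "(real ^ 'n) set \<Rightarrow> (real ^ 'n \<Rightarrow> real) set" where
  "H10 \<Omega> = {u \<in> H1 \<Omega>. \<exists>\<phi> :: nat \<Rightarrow> real ^ 'n \<Rightarrow> real. (\<forall>k. \<phi> k \<in> test_functions \<Omega>) \<and>
               (\<lambda>k. H1_norm \<Omega> (\<lambda>x. u x - \<phi> k x)) \<longlonglongrightarrow> 0}"

abbreviation unit_ball :: "(real ^ 'n) set" where
  "unit_ball \<equiv> ball 0 1"

(* i and j label the first two coordinate axes. *)
definition weak_angular_deriv ::
    "'n :: finite \<Rightarrow> 'n \<Rightarrow> (real ^ 'n \<Rightarrow> real) \<Rightarrow> real ^ 'n \<Rightarrow> real" where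
  "weak_angular_deriv i j u x =
     x $ i * weak_grad unit_ball u x $ j - x $ j * weak_grad unit_ball u x $ i"

definition energy :: "'n :: finite \<Rightarrow> 'n \<Rightarrow> (real ^ 'n \<Rightarrow> real) \<Rightarrow> real" where
  "energy i j u = (LINT x|lebesgue_on unit_ball.
     (norm (weak_grad unit_ball u x))\<^sup>2 - (weak_angular_deriv i j u x)\<^sup>2)"

(* The squared p-norm with values in [0,\<infinity>]; the case distinction is needed because the
   Bochner integral of a non-integrable function is 0. *)
definition Lp_norm_sq :: "real \<Rightarrow> (real ^ 'n \<Rightarrow> real) \<Rightarrow> ereal" where
  "Lp_norm_sq p u =
     (if integrable (lebesgue_on unit_ball) (\<lambda>x. \<bar>u x\<bar> powr p)
      then ereal ((LINT x|lebesgue_on unit_ball. \<bar>u x\<bar> powr p) powr (2 / p)) else \<infinity>)"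

(* The indices 1, 0 of the constant are the coefficient of the angular term and the mass. *)
definition C_1_0 :: "'n :: finite \<Rightarrow> 'n \<Rightarrow> real \<Rightarrow> ereal" where
  "C_1_0 i j p =
     (INF u \<in> {u \<in> H10 (unit_ball :: (real ^ 'n) set). \<not> (AE x in lebesgue_on unit_ball. u x = 0)}.
        ereal (energy i j u) / Lp_norm_sq p u)"

definition crit_exp :: "nat \<Rightarrow> real" where
  "crit_exp N = (4 * real N + 2) / (2 * real N - 3)"

end

theory Submission
  imports Defs
begin

text \<open>
Write r^2 = x_i^2 + x_j^2 and t = 1 - r^2. The integrand of the energy is a quadratic form in the
gradient with eigenvalue t in the direction of rotation and eigenvalue 1 in all orthogonal
directions. It degenerates only at the part r = 1 of the boundary. Near such a point
the energy behaves like the integral of (d_t u)^2 + t (d_theta u)^2 + |d_y u|^2, which scales under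
t ~ s^2, theta ~ s^3, y ~ s^2, so that the homogeneous dimension in units of s^2 is Q = N + 1/2 and
the critical exponent is 2 Q / (Q - 2) = (4 N + 2) / (2 N - 3).

For a test function u with energy E put p = (4 N + 2) / (2 N - 3), gamma = 1 + p / 2,
v = |u|^gamma and A = integral of |u|^p. The inequality A^(2/p) <= const E combines three estimates.

\<^item> Hardy: the integral of u^2 / t^2 is at most E. The field (x_i, x_j) / (1 - r^2) in the
  (i, j)-plane has divergence 2 / (1 - r^2)^2, so this is an integration by parts (\<open>hardy\<close>).

\<^item> Gagliardo: in polar coordinates the weight sqrt t does not depend on the angle, so each of the
  N functions v, ..., sqrt t v, ..., v is controlled by an integral along one coordinate line, and the
  Loomis-Whitney inequality bounds W = integral of t^(1/(2(N-1))) v^(N/(N-1)) by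
  const M^(N/(N-1)), where M is the integral of v plus the square root of the form of the gradient
  of v (\<open>polar_Gagliardo\<close>). Near the axis r = 0 the same is done in Cartesian coordinates for
  the function t v (\<open>cartesian_Gagliardo\<close>).

\<^item> Hoelder: 2 (gamma - 1) = p gives M <= const (A E)^(1/2), and
  |u|^p = (t^(1/(2(N-1))) v^(N/(N-1)))^alpha (u^2/t^2)^beta with alpha = 4(N-1)/(4N-3) and
  beta = 1/(4N-3) gives A <= W^alpha E^beta.

Together A <= const (A E)^(2N/(4N-3)) E^(1/(4N-3)). As 2 N < 4 N - 3 and A is finite, this can be
solved for A (\<open>critical_Sobolev\<close>). The inequality passes to the Sobolev space by Fatou's lemma
along test functions that converge almost everywhere; here the uniqueness of weak gradients is needed
to compare the gradient of a difference with the difference of the gradients (\<open>H10_Sobolev\<close>).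

For optimality, a bump of widths s^3 in direction j and s^2 in the others, placed at a distance of order
s^2 from the boundary point e_i, has energy of order s^(2N-3), whereas the square of its p-norm is at least of
order s^((4N+2)/p). For p above the critical exponent the second exponent is smaller
(\<open>concentrating_test_function\<close>, \<open>supercritical_fails\<close>).
\<close>

section \<open>Hoelder's and Finner's inequalities\<close>

text \<open>Powers on the extended half-line, in the sense needed for positive exponents.\<close>
definition epowr :: "ennreal \<Rightarrow> real \<Rightarrow> ennreal" where
  "epowr x c = (if x = top then top else ennreal (enn2real x powr c))"

lemma epowr_ennreal [simp]: "0 \<le> x \<Longrightarrow> epowr (ennreal x) c = ennreal (x powr c)"
  by (simp add: epowr_def)

lemma epowr_top [simp]: "epowr top c = top" by (simp add: epowr_def)

lemma epowr_measurable [measurable]: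
  assumes [measurable]: "f \<in> borel_measurable M"
  shows "(\<lambda>x. epowr (f x) c) \<in> borel_measurable M"
  unfolding epowr_def by measurable

lemma epowr_eq_0_iff [simp]: "epowr x c = 0 \<longleftrightarrow> x = 0"
  by (cases x) (auto simp: ennreal_eq_0_iff)

lemma epowr_eq_top_iff [simp]: "epowr x c = top \<longleftrightarrow> x = top"
  by (cases x) auto

lemma epowr_mono: "x \<le> y \<Longrightarrow> 0 \<le> c \<Longrightarrow> epowr x c \<le> epowr y c"
  by (cases x; cases y) (auto simp: ennreal_leI powr_mono2 top_unique)

text \<open>Convexity of the exponential function at the points ln x_k.\<close>
lemma weighted_AM_GM:
  fixes x c :: "'k \<Rightarrow> real"
  assumes K: "finite K" and c: "\<And>k. k \<in> K \<Longrightarrow> 0 < c k" "(\<Sum>k\<in>K. c k) = 1"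
    and x: "\<And>k. k \<in> K \<Longrightarrow> 0 \<le> x k"
  shows "(\<Prod>k\<in>K. x k powr c k) \<le> (\<Sum>k\<in>K. c k * x k)"
proof (cases "\<exists>k\<in>K. x k = 0")
  case True
  then have "(\<Prod>k\<in>K. x k powr c k) = 0" using K by (auto simp: prod_zero_iff)
  also have "0 \<le> (\<Sum>k\<in>K. c k * x k)" by (intro sum_nonneg mult_nonneg_nonneg x less_imp_le[OF c(1)])
  finally show ?thesis .
next
  case False
  then have pos: "0 < x k" if "k \<in> K" for k using x that False by (metis less_eq_real_def)
  have "(\<Prod>k\<in>K. x k powr c k) = exp (\<Sum>k\<in>K. c k * ln (x k))"
    by (subst exp_sum[OF K], intro prod.cong refl) (metis pos powr_def less_irrefl)
  also have "\<dots> \<le> (\<Sum>k\<in>K. c k * exp (ln (x k)))"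
    using convex_on_sum[OF K _ exp_convex, of c "\<lambda>k. ln (x k)"] c K
    by (force simp: less_imp_le)
  also have "\<dots> = (\<Sum>k\<in>K. c k * x k)" using pos by (intro sum.cong) auto
  finally show ?thesis .
qed

text \<open>After normalising every f_k to integral 1 this is the integrated inequality between the weighted
means.\<close>
lemma nn_integral_Hoelder:
  fixes f :: "'k \<Rightarrow> 'a \<Rightarrow> ennreal"
  assumes K: "finite K" and c: "\<And>k. k \<in> K \<Longrightarrow> 0 < c k" "(\<Sum>k\<in>K. c k) = 1"
    and f[measurable]: "\<And>k. k \<in> K \<Longrightarrow> f k \<in> borel_measurable M"
  shows "(\<integral>\<^sup>+x. (\<Prod>k\<in>K. epowr (f k x) (c k)) \<partial>M) \<le> (\<Prod>k\<in>K. epowr (\<integral>\<^sup>+x. f k x \<partial>M) (c k))"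
proof -
  define I where "I k = (\<integral>\<^sup>+x. f k x \<partial>M)" for k
  \<comment> \<open>The three cases avoid 0 times infinity on the right-hand side.\<close>
  consider "\<exists>k\<in>K. I k = 0" | "\<forall>k\<in>K. I k \<noteq> 0" "\<exists>k\<in>K. I k = top" | "\<forall>k\<in>K. I k \<noteq> 0 \<and> I k \<noteq> top" by blast
  then show ?thesis
  proof cases
    case 1
    then obtain k where k: "k \<in> K" "I k = 0" by blast
    then have "AE x in M. f k x = 0" unfolding I_def by (subst (asm) nn_integral_0_iff_AE) auto
    then have "AE x in M. (\<Prod>k\<in>K. epowr (f k x) (c k)) = 0"
      by eventually_elim (use K k in \<open>auto simp: prod_zero_iff\<close>)
    then have "(\<integral>\<^sup>+x. (\<Prod>k\<in>K. epowr (f k x) (c k)) \<partial>M) = 0"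
      by (subst nn_integral_0_iff_AE) auto
    then show ?thesis by simp
  next
    case 2
    then have "(\<Prod>k\<in>K. epowr (I k) (c k)) = top"
      using K by (simp add: ennreal_prod_eq_top)
    then show ?thesis by (simp add: I_def)
  next
    case 3
    define r where "r k = enn2real (I k)" for k
    have r: "0 < r k" "I k = ennreal (r k)" if "k \<in> K" for k
      using 3 that by (auto simp: r_def enn2real_positive_iff less_top zero_less_iff_neq_zero)
    have key: "(\<Prod>k\<in>K. epowr (f k x) (c k)) \<le> (\<Prod>k\<in>K. ennreal (r k powr c k)) * (\<Sum>k\<in>K. ennreal (c k / r k) * f k x)" for x
    proof (cases "\<exists>k\<in>K. f k x = top")
      case True
      then obtain k where k: "k \<in> K" "f k x = top" by blast
      have "(\<Sum>k\<in>K. ennreal (c k / r k) * f k x) = top"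
        using k K c(1)[of k] r(1)[of k] by (auto simp: ennreal_mult_eq_top_iff intro!: bexI[of _ k])
      moreover have "(\<Prod>k\<in>K. ennreal (r k powr c k)) \<noteq> 0"
        using K r(1) by (simp add: prod_zero_iff) (metis less_irrefl)
      ultimately show ?thesis by (simp add: ennreal_mult_eq_top_iff)
    next
      case False
      define y where "y k = enn2real (f k x)" for k
      have y: "f k x = ennreal (y k)" "0 \<le> y k" if "k \<in> K" for k
        using False that by (auto simp: y_def less_top)
      have "(\<Prod>k\<in>K. epowr (f k x) (c k)) = (\<Prod>k\<in>K. ennreal (y k powr c k))"
        using y by (intro prod.cong) auto
      also have "\<dots> = ennreal (\<Prod>k\<in>K. y k powr c k)" by (rule prod_ennreal) simp
      also have "(\<Prod>k\<in>K. y k powr c k) = (\<Prod>k\<in>K. r k powr c k) * (\<Prod>k\<in>K. (y k / r k) powr c k)"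
        unfolding prod.distrib[symmetric]
        proof (intro prod.cong refl)
          fix k assume k: "k \<in> K"
          have "y k = r k * (y k / r k)" using r(1)[OF k] by simp
          then show "y k powr c k = r k powr c k * (y k / r k) powr c k"
            using r(1)[OF k] y(2)[OF k] by (metis powr_mult)
        qed
      also have "\<dots> \<le> (\<Prod>k\<in>K. r k powr c k) * (\<Sum>k\<in>K. c k * (y k / r k))"
        using r y by (intro mult_left_mono weighted_AM_GM K c prod_nonneg) (auto simp: less_imp_le)
      also have "ennreal \<dots> = ennreal (\<Prod>k\<in>K. r k powr c k) * ennreal (\<Sum>k\<in>K. c k * (y k / r k))"
        by (rule ennreal_mult'') (use r y c in \<open>auto intro!: sum_nonneg simp: less_imp_le\<close>)
      also have "ennreal (\<Prod>k\<in>K. r k powr c k) = (\<Prod>k\<in>K. ennreal (r k powr c k))"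
        by (rule prod_ennreal[symmetric]) simp
      also have "ennreal (\<Sum>k\<in>K. c k * (y k / r k)) = (\<Sum>k\<in>K. ennreal (c k * (y k / r k)))"
        by (rule sum_ennreal[symmetric]) (use r y c in \<open>auto simp: less_imp_le\<close>)
      also have "\<dots> = (\<Sum>k\<in>K. ennreal (c k / r k) * f k x)"
        using r y c by (intro sum.cong refl) (simp add: ennreal_mult'[symmetric] less_imp_le)
      finally show ?thesis by (simp add: ennreal_leI)
    qed
    have "(\<integral>\<^sup>+x. (\<Prod>k\<in>K. epowr (f k x) (c k)) \<partial>M)
       \<le> (\<integral>\<^sup>+x. (\<Prod>k\<in>K. ennreal (r k powr c k)) * (\<Sum>k\<in>K. ennreal (c k / r k) * f k x) \<partial>M)"
      by (rule nn_integral_mono) (rule key)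
    also have "\<dots> = (\<Prod>k\<in>K. ennreal (r k powr c k)) * (\<Sum>k\<in>K. ennreal (c k / r k) * I k)"
      by (simp add: nn_integral_cmult nn_integral_sum I_def)
    also have "(\<Sum>k\<in>K. ennreal (c k / r k) * I k) = (\<Sum>k\<in>K. ennreal (c k))"
      using r c by (intro sum.cong refl) (simp add: ennreal_mult'[symmetric] less_imp_le less_imp_neq[symmetric])
    also have "\<dots> = 1" using c by (subst sum_ennreal) (auto simp: less_imp_le)
    also have "(\<Prod>k\<in>K. ennreal (r k powr c k)) = (\<Prod>k\<in>K. epowr (I k) (c k))"
      using r by (intro prod.cong) (auto simp: less_imp_le)
    finally show ?thesis by (simp add: I_def)
  qed
qed

text \<open>Each f_k depends only on the coordinates in S_k, and the weights c_k of the functions that see a given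
coordinate add up to 1. Integrating out one coordinate a is then Hoelder's inequality for
the functions with a \<in> S_k, and it leaves an instance of the same statement with one coordinate
fewer. This formulation has no exceptional low-dimensional base case.\<close>
lemma (in product_sigma_finite) Finner:
  fixes f :: "'k \<Rightarrow> ('i \<Rightarrow> 'a) \<Rightarrow> ennreal"
  assumes "finite I" and K: "finite K" and c: "\<And>k. k \<in> K \<Longrightarrow> 0 < c k"
    and "\<And>k. k \<in> K \<Longrightarrow> S k \<subseteq> I"
    and "\<And>a. a \<in> I \<Longrightarrow> (\<Sum>k | k \<in> K \<and> a \<in> S k. c k) = 1"
    and "\<And>k. k \<in> K \<Longrightarrow> f k \<in> borel_measurable (Pi\<^sub>M (S k) M)"
  shows "(\<integral>\<^sup>+x. (\<Prod>k\<in>K. epowr (f k (restrict x (S k))) (c k)) \<partial>Pi\<^sub>M I M)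
     \<le> (\<Prod>k\<in>K. epowr (\<integral>\<^sup>+x. f k x \<partial>Pi\<^sub>M (S k) M) (c k))"
  using assms(1,4-)
proof (induction I arbitrary: S f rule: finite_induct)
  case empty
  then show ?case
    by (simp add: PiM_empty nn_integral_count_space_finite restrict_def)
next
  case (insert a I)
  note fm[measurable] = insert.prems(3)
  have fin: "finite (S k)" if "k \<in> K" for k
    using insert.prems(1)[OF that] insert.hyps(1) by (meson finite.insertI finite_subset)
  define T where "T k = S k - {a}" for k
  define g where "g k = (if a \<in> S k then \<lambda>x. \<integral>\<^sup>+t. f k (x(a := t)) \<partial>M a else f k)" for k
  have ST: "S k = insert a (T k)" if "a \<in> S k" for k using that by (auto simp: T_def)
  have TI: "T k \<subseteq> I" if "k \<in> K" for k using insert.prems(1)[OF that] by (auto simp: T_def)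
  interpret a: sigma_finite_measure "M a" by (rule sigma_finite_measures)
  have gm[measurable]: "g k \<in> borel_measurable (Pi\<^sub>M (T k) M)" if k: "k \<in> K" for k
  proof (cases "a \<in> S k")
    case True
    have [measurable]: "f k \<in> borel_measurable (Pi\<^sub>M (insert a (T k)) M)" using fm[OF k] ST[OF True] by simp
    show ?thesis using True unfolding g_def by simp
  next
    case False
    then show ?thesis using fm[OF k] by (simp add: g_def T_def)
  qed
  have gI: "(\<integral>\<^sup>+x. g k x \<partial>Pi\<^sub>M (T k) M) = (\<integral>\<^sup>+x. f k x \<partial>Pi\<^sub>M (S k) M)" if k: "k \<in> K" for k
  proof (cases "a \<in> S k")
    case True
    have "f k \<in> borel_measurable (Pi\<^sub>M (insert a (T k)) M)" using fm[OF k] ST[OF True] by simp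
    then show ?thesis using True fin[OF k] unfolding g_def ST[OF True]
      by (subst product_nn_integral_insert) (simp_all add: T_def)
  qed (simp add: g_def T_def)
  have rm[measurable]: "(\<lambda>x. f k (restrict x (S k))) \<in> borel_measurable (Pi\<^sub>M (insert a I) M)" if "k \<in> K" for k
    using measurable_compose[OF measurable_restrict_subset[OF insert.prems(1)[OF that]] fm[OF that]] .
  have r1: "restrict (x(a := t)) (S k) = (restrict x (T k))(a := t)" if "a \<in> S k" for k x t
    using that by (auto simp: restrict_def T_def fun_eq_iff)
  have r2: "restrict (x(a := t)) (S k) = restrict x (T k)" if "a \<notin> S k" for k x t
    using that by (auto simp: restrict_def T_def fun_eq_iff)
  have step: "(\<integral>\<^sup>+t. (\<Prod>k\<in>K. epowr (f k (restrict (x(a := t)) (S k))) (c k)) \<partial>M a)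
      \<le> (\<Prod>k\<in>K. epowr (g k (restrict x (T k))) (c k))" if x: "x \<in> space (Pi\<^sub>M I M)" for x
  proof -
    let ?A = "{k \<in> K. a \<in> S k}" and ?B = "{k \<in> K. a \<notin> S k}"
    have KAB: "K = ?A \<union> ?B" "?A \<inter> ?B = {}" by auto
    have sp: "(\<Prod>k\<in>K. h k) = (\<Prod>k\<in>?A. h k) * (\<Prod>k\<in>?B. h k)" for h :: "'k \<Rightarrow> ennreal"
      using K by (subst KAB(1), subst prod.union_disjoint) auto
    have m: "(\<lambda>t. f k ((restrict x (T k))(a := t))) \<in> borel_measurable (M a)" if "k \<in> ?A" for k
    proof -
      have "restrict x (T k) \<in> space (Pi\<^sub>M (T k) M)"
        using x TI that by (auto simp: space_PiM PiE_def Pi_def)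
      then have "(\<lambda>t. (restrict x (T k))(a := t)) \<in> measurable (M a) (Pi\<^sub>M (insert a (T k)) M)"
        by (rule measurable_component_update) (simp add: T_def)
      moreover have "f k \<in> borel_measurable (Pi\<^sub>M (insert a (T k)) M)" using fm[of k] that by (subst ST[symmetric]) auto
      ultimately show ?thesis by (rule measurable_compose)
    qed
    have "(\<integral>\<^sup>+t. (\<Prod>k\<in>K. epowr (f k (restrict (x(a := t)) (S k))) (c k)) \<partial>M a)
      = (\<integral>\<^sup>+t. (\<Prod>k\<in>?A. epowr (f k ((restrict x (T k))(a := t))) (c k)) * (\<Prod>k\<in>?B. epowr (g k (restrict x (T k))) (c k)) \<partial>M a)"
      by (intro nn_integral_cong, subst sp, intro arg_cong2[of _ _ _ _ "(*)"] prod.cong)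
         (auto simp: r1 r2 g_def T_def)
    also have "\<dots> = (\<integral>\<^sup>+t. (\<Prod>k\<in>?A. epowr (f k ((restrict x (T k))(a := t))) (c k)) \<partial>M a) * (\<Prod>k\<in>?B. epowr (g k (restrict x (T k))) (c k))"
      by (intro nn_integral_multc borel_measurable_prod_ennreal epowr_measurable m)
    also have "\<dots> \<le> (\<Prod>k\<in>?A. epowr (g k (restrict x (T k))) (c k)) * (\<Prod>k\<in>?B. epowr (g k (restrict x (T k))) (c k))"
    proof (rule mult_right_mono)
      have "(\<integral>\<^sup>+t. (\<Prod>k\<in>?A. epowr (f k ((restrict x (T k))(a := t))) (c k)) \<partial>M a)
         \<le> (\<Prod>k\<in>?A. epowr (\<integral>\<^sup>+t. f k ((restrict x (T k))(a := t)) \<partial>M a) (c k))"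
        using K c insert.prems(2)[of a] m by (intro nn_integral_Hoelder) auto
      also have "\<dots> = (\<Prod>k\<in>?A. epowr (g k (restrict x (T k))) (c k))"
        by (intro prod.cong) (auto simp: g_def)
      finally show "(\<integral>\<^sup>+t. (\<Prod>k\<in>?A. epowr (f k ((restrict x (T k))(a := t))) (c k)) \<partial>M a)
         \<le> (\<Prod>k\<in>?A. epowr (g k (restrict x (T k))) (c k))" .
    qed simp
    also have "\<dots> = (\<Prod>k\<in>K. epowr (g k (restrict x (T k))) (c k))" by (rule sp[symmetric])
    finally show ?thesis .
  qed
  have "(\<integral>\<^sup>+x. (\<Prod>k\<in>K. epowr (f k (restrict x (S k))) (c k)) \<partial>Pi\<^sub>M (insert a I) M)
     = (\<integral>\<^sup>+x. (\<integral>\<^sup>+t. (\<Prod>k\<in>K. epowr (f k (restrict (x(a := t)) (S k))) (c k)) \<partial>M a) \<partial>Pi\<^sub>M I M)"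
    using insert.hyps by (intro product_nn_integral_insert borel_measurable_prod_ennreal epowr_measurable rm)
  also have "\<dots> \<le> (\<integral>\<^sup>+x. (\<Prod>k\<in>K. epowr (g k (restrict x (T k))) (c k)) \<partial>Pi\<^sub>M I M)"
    by (intro nn_integral_mono step)
  also have "\<dots> \<le> (\<Prod>k\<in>K. epowr (\<integral>\<^sup>+x. g k x \<partial>Pi\<^sub>M (T k) M) (c k))"
  proof (rule insert.IH)
    show "T k \<subseteq> I" if "k \<in> K" for k by (rule TI[OF that])
    show "(\<Sum>k | k \<in> K \<and> b \<in> T k. c k) = 1" if "b \<in> I" for b
    proof -
      have "{k. k \<in> K \<and> b \<in> T k} = {k. k \<in> K \<and> b \<in> S k}" using that insert.hyps(2) by (auto simp: T_def)
      then show ?thesis using insert.prems(2)[of b] that by simp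
    qed
  qed (rule gm)
  also have "\<dots> = (\<Prod>k\<in>K. epowr (\<integral>\<^sup>+x. f k x \<partial>Pi\<^sub>M (S k) M) (c k))"
    by (intro prod.cong refl) (simp add: gI)
  finally show ?case .
qed

section \<open>Polar coordinates in the plane\<close>

lemma measurable_vec_lambda_PiM [measurable]:
  "(\<lambda>z::'n::finite \<Rightarrow> real. \<chi> k. z k) \<in> borel_measurable (\<Pi>\<^sub>M k\<in>UNIV. lborel)"
proof -
  have eq: "(\<lambda>z::'n \<Rightarrow> real. \<chi> k. z k) = (\<lambda>z. \<Sum>k\<in>UNIV. z k *\<^sub>R axis k 1)"
    by (auto simp: fun_eq_iff vec_eq_iff axis_def if_distrib sum.delta cong: if_cong)
  show ?thesis unfolding eq by measurable
qed

text \<open>Both measures agree on boxes. The product form allows a single coordinate to be integrated out.\<close>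
lemma nn_integral_vec_PiM:
  fixes f :: "real ^ 'n \<Rightarrow> ennreal"
  assumes [measurable]: "f \<in> borel_measurable borel"
  shows "(\<integral>\<^sup>+x. f x \<partial>lborel) = (\<integral>\<^sup>+z. f (\<chi> k. z k) \<partial>(\<Pi>\<^sub>M k\<in>UNIV. lborel))"
proof -
  interpret product_sigma_finite "\<lambda>_::'n. lborel :: real measure" ..
  have "(lborel :: (real ^ 'n) measure) = distr (\<Pi>\<^sub>M k\<in>(UNIV::'n set). lborel) borel (\<lambda>z. \<chi> k. z k)"
  proof (rule lborel_eqI)
    fix l u :: "real ^ 'n"
    assume lu: "\<And>b. b \<in> Basis \<Longrightarrow> l \<bullet> b \<le> u \<bullet> b"
    have lu': "l $ k \<le> u $ k" for k using lu[of "axis k 1"] by (simp add: inner_axis axis_in_Basis_iff)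
    have "emeasure (distr (\<Pi>\<^sub>M k\<in>(UNIV::'n set). lborel) borel (\<lambda>z. \<chi> k. z k)) (box l u)
       = emeasure (\<Pi>\<^sub>M k\<in>(UNIV::'n set). lborel) ((\<lambda>z. \<chi> k. z k) -` box l u \<inter> space (\<Pi>\<^sub>M k\<in>(UNIV::'n set). lborel))"
      by (simp add: emeasure_distr)
    also have "((\<lambda>z. \<chi> k. z k) -` box l u \<inter> space (\<Pi>\<^sub>M k\<in>(UNIV::'n set). lborel)) = (\<Pi>\<^sub>E k\<in>UNIV. {l $ k <..< u $ k})"
      by (auto simp: mem_box_cart space_PiM PiE_def Pi_iff)
    also have "emeasure (\<Pi>\<^sub>M k\<in>(UNIV::'n set). lborel) \<dots> = (\<Prod>k\<in>UNIV. ennreal (u $ k - l $ k))"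
      by (subst emeasure_PiM) (auto simp: lu')
    also have "\<dots> = ennreal (\<Prod>k\<in>UNIV. (u $ k - l $ k))"
      by (rule prod_ennreal) (simp add: lu')
    also have "(\<Prod>k\<in>UNIV. (u $ k - l $ k)) = (\<Prod>b\<in>Basis. (u - l) \<bullet> b)"
    proof -
      have B: "(Basis :: (real^'n) set) = (\<lambda>k. axis k 1) ` UNIV" by (auto simp: Basis_vec_def)
      have inj: "inj (\<lambda>k::'n. axis k (1::real))" by (auto simp: inj_on_def axis_eq_axis)
      show ?thesis unfolding B by (subst prod.reindex[OF inj]) (simp add: inner_axis)
    qed
    finally show "emeasure (distr (\<Pi>\<^sub>M k\<in>(UNIV::'n set). lborel) borel (\<lambda>z. \<chi> k. z k)) (box l u) = (\<Prod>b\<in>Basis. (u - l) \<bullet> b)" .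
  qed simp
  then have "(\<integral>\<^sup>+x. f x \<partial>lborel) = (\<integral>\<^sup>+x. f x \<partial>distr (\<Pi>\<^sub>M k\<in>(UNIV::'n set). lborel) borel (\<lambda>z. \<chi> k. z k))"
    by simp
  also have "\<dots> = (\<integral>\<^sup>+z. f (\<chi> k. z k) \<partial>(\<Pi>\<^sub>M k\<in>UNIV. lborel))"
    by (rule nn_integral_distr) auto
  finally show ?thesis .
qed

text \<open>The plane is treated by itself; polar coordinates around an axis follow from it by slicing.\<close>
definition polar2 :: "real ^ 2 \<Rightarrow> real ^ 2" where
  "polar2 p = vector [p $ 1 * cos (p $ 2), p $ 1 * sin (p $ 2)]"

lemma polar2_nth [simp]: "polar2 p $ 1 = p $ 1 * cos (p $ 2)" "polar2 p $ 2 = p $ 1 * sin (p $ 2)"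
  by (simp_all add: polar2_def)

lemma has_derivative_vec2:
  fixes f :: "'a::real_normed_vector \<Rightarrow> real ^ 2"
  assumes "((\<lambda>x. f x $ 1) has_derivative (\<lambda>h. f' h $ 1)) (at a within S)" "((\<lambda>x. f x $ 2) has_derivative (\<lambda>h. f' h $ 2)) (at a within S)"
  shows "(f has_derivative f') (at a within S)"
proof -
  have "((\<lambda>x. f x \<bullet> b) has_derivative (\<lambda>h. f' h \<bullet> b)) (at a within S)" if "b \<in> Basis" for b
  proof -
    from that obtain k where b: "b = axis k 1" by (auto simp: Basis_vec_def)
    show ?thesis using assms exhaust_2[of k] by (auto simp: b inner_axis)
  qed
  then show ?thesis by (subst has_derivative_componentwise_within) auto
qed

lemma polar2_has_derivative:
  "(polar2 has_derivative (\<lambda>h. vector [h $ 1 * cos (p $ 2) - p $ 1 * sin (p $ 2) * h $ 2,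
       h $ 1 * sin (p $ 2) + p $ 1 * cos (p $ 2) * h $ 2])) (at p within S)"
proof -
  have 1: "((\<lambda>p::real^2. p $ k) has_derivative (\<lambda>h. h $ k)) (at p within S)" for k
    by (rule bounded_linear_imp_has_derivative) (rule bounded_linear_vec_nth)
  show ?thesis
    by (rule has_derivative_vec2) (auto intro!: derivative_eq_intros 1 simp: algebra_simps)
qed

lemma inj_on_polar2: "inj_on polar2 {p. 0 < p $ 1 \<and> 0 \<le> p $ 2 \<and> p $ 2 < 2 * pi}"
proof (rule inj_onI, clarify)
  fix p q :: "real ^ 2"
  assume p: "0 < p $ 1" "0 \<le> p $ 2" "p $ 2 < 2 * pi" and q: "0 < q $ 1" "0 \<le> q $ 2" "q $ 2 < 2 * pi"
    and eq: "polar2 p = polar2 q"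
  have e1: "p $ 1 * cos (p $ 2) = q $ 1 * cos (q $ 2)" and e2: "p $ 1 * sin (p $ 2) = q $ 1 * sin (q $ 2)"
    using arg_cong[OF eq, of "\<lambda>v. v $ 1"] arg_cong[OF eq, of "\<lambda>v. v $ 2"] by simp_all
  have "(p $ 1)\<^sup>2 = (p $ 1 * cos (p $ 2))\<^sup>2 + (p $ 1 * sin (p $ 2))\<^sup>2"
    by (simp add: power_mult_distrib flip: distrib_left)
  also have "\<dots> = (q $ 1)\<^sup>2"
    unfolding e1 e2 by (simp add: power_mult_distrib flip: distrib_left)
  finally have r: "p $ 1 = q $ 1" using p(1) q(1) by (simp add: power2_eq_iff_nonneg)
  have "sin (p $ 2) = sin (q $ 2) \<and> cos (p $ 2) = cos (q $ 2)" using e1 e2 r p(1) by simp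
  then obtain n :: int where n: "p $ 2 = q $ 2 + 2 * pi * n" using sin_cos_eq_iff by blast
  have "2 * pi * \<bar>real_of_int n\<bar> = \<bar>p $ 2 - q $ 2\<bar>" by (simp add: n abs_mult)
  also have "\<dots> < 2 * pi * 1" using p q by auto
  finally have "\<bar>real_of_int n\<bar> < 1" by (simp add: mult_less_cancel_left)
  then have "n = 0" by linarith
  then show "p = q" using r n by (simp add: vec_eq_iff forall_2)
qed

definition polar_strip :: "real \<Rightarrow> (real ^ 2) set" where
  "polar_strip R = {p. 0 < p $ 1 \<and> p $ 1 \<le> R \<and> 0 \<le> p $ 2 \<and> p $ 2 < 2 * pi}"

lemma polar_strip_borel [measurable]: "polar_strip R \<in> sets borel"
proof -
  have "polar_strip R = {p \<in> space borel. 0 < p $ 1 \<and> p $ 1 \<le> R \<and> 0 \<le> p $ 2 \<and> p $ 2 < 2 * pi}"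
    by (auto simp: polar_strip_def)
  also have "\<dots> \<in> sets borel" by measurable
  finally show ?thesis .
qed

lemma polar2_measurable [measurable]: "polar2 \<in> borel_measurable borel"
proof -
  have "continuous_on UNIV polar2"
    by (intro continuous_at_imp_continuous_on ballI has_derivative_continuous[OF polar2_has_derivative])
  then show ?thesis by (rule borel_measurable_continuous_onI)
qed

lemma polar2_image: "polar2 ` polar_strip R = {x. 0 < (x $ 1)\<^sup>2 + (x $ 2)\<^sup>2 \<and> (x $ 1)\<^sup>2 + (x $ 2)\<^sup>2 \<le> R\<^sup>2}"
  if "0 \<le> R"
proof safe
  fix p assume p: "p \<in> polar_strip R"
  have e: "(polar2 p $ 1)\<^sup>2 + (polar2 p $ 2)\<^sup>2 = (p $ 1)\<^sup>2"
    by (simp add: power_mult_distrib flip: distrib_left)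
  show "0 < (polar2 p $ 1)\<^sup>2 + (polar2 p $ 2)\<^sup>2" "(polar2 p $ 1)\<^sup>2 + (polar2 p $ 2)\<^sup>2 \<le> R\<^sup>2"
    using p unfolding e polar_strip_def by auto
next
  fix x :: "real ^ 2" assume x: "0 < (x $ 1)\<^sup>2 + (x $ 2)\<^sup>2" "(x $ 1)\<^sup>2 + (x $ 2)\<^sup>2 \<le> R\<^sup>2"
  define r where "r = sqrt ((x $ 1)\<^sup>2 + (x $ 2)\<^sup>2)"
  have r: "0 < r" "r \<le> R" using x that by (auto simp: r_def real_le_lsqrt)
  have r2: "(x $ 1)\<^sup>2 + (x $ 2)\<^sup>2 = r\<^sup>2" using x by (simp add: r_def)
  have "(x $ 1 / r)\<^sup>2 + (x $ 2 / r)\<^sup>2 = ((x $ 1)\<^sup>2 + (x $ 2)\<^sup>2) / r\<^sup>2"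
    by (simp add: power_divide add_divide_distrib)
  also have "\<dots> = 1" using x using r(1) unfolding r2 by simp
  finally obtain t where t: "0 \<le> t" "t < 2 * pi" "x $ 1 / r = cos t" "x $ 2 / r = sin t"
    using sincos_total_2pi by metis
  have "x = polar2 (vector [r, t])" using t r by (simp add: vec_eq_iff forall_2 field_simps)
  moreover have "vector [r, t] \<in> polar_strip R" using r t by (simp add: polar_strip_def)
  ultimately show "x \<in> polar2 ` polar_strip R" by blast
qed

text \<open>The two measures agree on every Borel set A, since the area of a set is the integral of the
Jacobian p_1 over its preimage. The half-open strip makes the parametrisation bijective onto the
punctured disc.\<close>
lemma nn_integral_polar2:
  fixes f :: "real ^ 2 \<Rightarrow> ennreal"
  assumes [measurable]: "f \<in> borel_measurable borel" and R: "0 \<le> R"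
  shows "(\<integral>\<^sup>+x. indicator (polar2 ` polar_strip R) x * f x \<partial>lborel)
       = (\<integral>\<^sup>+p. indicator (polar_strip R) p * ennreal (p $ 1) * f (polar2 p) \<partial>lborel)"
proof -
  have I[measurable]: "polar2 ` polar_strip R \<in> sets borel"
  proof -
    have "polar2 ` polar_strip R = {x \<in> space borel. 0 < (x $ 1)\<^sup>2 + (x $ 2)\<^sup>2 \<and> (x $ 1)\<^sup>2 + (x $ 2)\<^sup>2 \<le> R\<^sup>2}"
      by (simp add: polar2_image[OF R])
    also have "\<dots> \<in> sets borel" by measurable
    finally show ?thesis .
  qed
  have "density lborel (indicator (polar2 ` polar_strip R))
      = distr (density lborel (\<lambda>p. indicator (polar_strip R) p * ennreal (p $ 1))) borel polar2"
  proof (rule measure_eqI)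
    fix A assume "A \<in> sets (density lborel (indicator (polar2 ` polar_strip R)))"
    then have A[measurable]: "A \<in> sets borel" by simp
    define S where "S = polar_strip R \<inter> polar2 -` A"
    have S[measurable]: "S \<in> sets borel"
      using measurable_sets[OF polar2_measurable A] by (auto simp: S_def)
    let ?f' = "\<lambda>(p :: real ^ 2) (h :: real ^ 2). vector [h $ 1 * cos (p $ 2) - p $ 1 * sin (p $ 2) * h $ 2,
       h $ 1 * sin (p $ 2) + p $ 1 * cos (p $ 2) * h $ 2] :: real ^ 2"
    have inj: "inj_on polar2 S"
      by (rule inj_on_subset[OF inj_on_polar2]) (auto simp: S_def polar_strip_def)
    have im: "polar2 ` S = polar2 ` polar_strip R \<inter> A" by (auto simp: S_def)
    have imb: "polar2 ` S \<in> sets borel" unfolding im by measurable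
    have "polar2 ` S \<subseteq> cball 0 R"
    proof
      fix x assume "x \<in> polar2 ` S"
      then have "(norm x)\<^sup>2 \<le> R\<^sup>2"
        unfolding im polar2_image[OF R] by (simp add: norm_vec_def L2_set_def sum_2 sum_nonneg)
      then have "norm x \<le> R" using R by (rule power2_le_imp_le)
      then show "x \<in> cball 0 R" by simp
    qed
    then have bdd: "bounded (polar2 ` S)" by (rule bounded_subset[rotated]) simp
    have lm: "polar2 ` S \<in> lmeasurable"
      by (rule bounded_set_imp_lmeasurable[OF bdd]) (use imb in simp)
    have det: "\<bar>det (matrix (?f' p))\<bar> = \<bar>p $ 1\<bar>" for p
    proof -
      have "det (matrix (?f' p)) = p $ 1 * ((cos (p $ 2))\<^sup>2 + (sin (p $ 2))\<^sup>2)"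
        by (simp add: det_2 matrix_def axis_def power2_eq_square algebra_simps del: sin_cos_squared_add3)
      then show ?thesis by simp
    qed
    have "((\<lambda>p. \<bar>p $ 1\<bar>) has_integral measure lebesgue (polar2 ` S)) S"
      using has_measure_differentiable_image[of S polar2 ?f' "measure lebesgue (polar2 ` S)"]
        polar2_has_derivative inj S lm det by auto
    then have "((\<lambda>p. indicator S p * \<bar>p $ 1\<bar>) has_integral measure lebesgue (polar2 ` S)) UNIV"
      by (subst (asm) has_integral_restrict_UNIV[symmetric]) (simp add: indicator_def of_bool_def if_distrib[of "\<lambda>x. x * _"] cong: if_cong)
    then have "(\<integral>\<^sup>+p. ennreal (indicator S p * \<bar>p $ 1\<bar>) \<partial>lborel) = ennreal (measure lebesgue (polar2 ` S))"
    proof (rule nn_integral_has_integral_lborel[rotated 2])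
      have "(\<lambda>p::real^2. \<bar>p $ 1\<bar>) \<in> borel_measurable borel"
        by (intro borel_measurable_continuous_onI continuous_intros)
      then show "(\<lambda>p. indicator S p * \<bar>p $ 1\<bar>) \<in> borel_measurable borel"
        by (intro borel_measurable_times borel_measurable_indicator S)
    qed simp
    also have "\<dots> = emeasure lborel (polar2 ` S)"
    proof -
      have "ennreal (measure lebesgue (polar2 ` S)) = emeasure lebesgue (polar2 ` S)"
        by (rule emeasure_eq_measure2[OF lm, symmetric])
      also have "\<dots> = emeasure lborel (polar2 ` S)" using imb by simp
      finally show ?thesis .
    qed
    finally have *: "(\<integral>\<^sup>+p. ennreal (indicator S p * \<bar>p $ 1\<bar>) \<partial>lborel) = emeasure lborel (polar2 ` S)" .
    have "emeasure (density lborel (indicator (polar2 ` polar_strip R))) A = emeasure lborel (polar2 ` S)"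
    proof -
      have "emeasure (density lborel (indicator (polar2 ` polar_strip R))) A
          = (\<integral>\<^sup>+x. indicator (polar2 ` S) x \<partial>lborel)"
        by (subst emeasure_density, simp, simp, intro nn_integral_cong)
             (simp add: im flip: indicator_inter_arith)
      then show ?thesis using imb by simp
    qed
    also have "\<dots> = (\<integral>\<^sup>+p. (indicator (polar_strip R) p * ennreal (p $ 1)) * indicator (polar2 -` A) p \<partial>lborel)"
      unfolding *[symmetric]
      by (rule nn_integral_cong) (auto simp: S_def polar_strip_def indicator_def)
    also have "\<dots> = emeasure (distr (density lborel (\<lambda>p. indicator (polar_strip R) p * ennreal (p $ 1))) borel polar2) A"
      using measurable_sets[OF polar2_measurable A]
      by (subst emeasure_distr) (auto simp: emeasure_density)
    finally show "emeasure (density lborel (indicator (polar2 ` polar_strip R))) A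
      = emeasure (distr (density lborel (\<lambda>p. indicator (polar_strip R) p * ennreal (p $ 1))) borel polar2) A" .
  qed simp
  then have "(\<integral>\<^sup>+x. f x \<partial>density lborel (indicator (polar2 ` polar_strip R)))
    = (\<integral>\<^sup>+x. f x \<partial>distr (density lborel (\<lambda>p. indicator (polar_strip R) p * ennreal (p $ 1))) borel polar2)"
    by simp
  then show ?thesis
    by (simp add: nn_integral_density nn_integral_distr)
qed

lemma nn_integral_vec2:
  fixes f :: "real ^ 2 \<Rightarrow> ennreal"
  assumes [measurable]: "f \<in> borel_measurable borel"
  shows "(\<integral>\<^sup>+x. f x \<partial>lborel) = (\<integral>\<^sup>+a. (\<integral>\<^sup>+b. f (vector [a, b]) \<partial>lborel) \<partial>lborel)"
proof -
  interpret product_sigma_finite "\<lambda>_::2. lborel :: real measure" ..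
  have U: "insert (2::2) {1} = UNIV" using exhaust_2 by auto
  have m: "(\<lambda>z::2\<Rightarrow>real. f (\<chi> k. z k)) \<in> borel_measurable (\<Pi>\<^sub>M k\<in>insert 2 {1}. lborel)"
    unfolding U by measurable
  have v: "(\<chi> k. (x(2 := y)) k) = (vector [x 1, y] :: real ^ 2)" for x :: "2 \<Rightarrow> real" and y
    by (simp add: vec_eq_iff forall_2)
  have "(\<integral>\<^sup>+x. f x \<partial>lborel) = (\<integral>\<^sup>+z. f (\<chi> k. z k) \<partial>(\<Pi>\<^sub>M k\<in>insert 2 {1}. lborel))"
    unfolding U by (rule nn_integral_vec_PiM) simp
  also have "\<dots> = (\<integral>\<^sup>+x. (\<integral>\<^sup>+y. f (\<chi> k. (x(2 := y)) k) \<partial>lborel) \<partial>(\<Pi>\<^sub>M k\<in>{1}. lborel))"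
    using product_nn_integral_insert[OF _ _ m] by simp
  also have "\<dots> = (\<integral>\<^sup>+a. (\<integral>\<^sup>+b. f (vector [a, b]) \<partial>lborel) \<partial>lborel)"
    unfolding v
  proof (rule product_nn_integral_singleton[where f = "\<lambda>a. \<integral>\<^sup>+b. f (vector [a, b]) \<partial>lborel"])
    have c: "(\<lambda>(a, b). vector [a, b] :: real ^ 2) \<in> borel_measurable (lborel \<Otimes>\<^sub>M lborel)"
    proof -
      have "(\<lambda>(a, b). vector [a, b] :: real ^ 2) = (\<lambda>z. fst z *\<^sub>R axis 1 1 + snd z *\<^sub>R axis 2 1)"
        by (auto simp: fun_eq_iff vec_eq_iff forall_2 axis_def)
      then show ?thesis by simp
    qed
    have [measurable]: "case_prod (\<lambda>a b. f (vector [a, b])) \<in> borel_measurable (lborel \<Otimes>\<^sub>M lborel)"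
      using measurable_compose[OF c assms] by (simp add: case_prod_unfold)
    show "(\<lambda>a. \<integral>\<^sup>+b. f (vector [a, b]) \<partial>lborel) \<in> borel_measurable lborel"
      by measurable
  qed
  finally show ?thesis .
qed

section \<open>The Loomis-Whitney inequality and Gagliardo's inequality on a box\<close>

definition vec_upd :: "real ^ 'n \<Rightarrow> 'n \<Rightarrow> real \<Rightarrow> real ^ 'n" where
  "vec_upd x k t = (\<chi> l. if l = k then t else x $ l)"

lemma vec_upd_nth [simp]: "vec_upd x k t $ l = (if l = k then t else x $ l)"
  by (simp add: vec_upd_def)

lemma vec_upd_same [simp]: "vec_upd x k (x $ k) = x"
  by (simp add: vec_eq_iff)

lemma continuous_on_vec_upd [continuous_intros]:
  assumes "continuous_on S f" "continuous_on S g"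
  shows "continuous_on S (\<lambda>z. vec_upd (f z) k (g z))"
  unfolding vec_upd_def
proof (rule continuous_on_vec_lambda)
  fix l show "continuous_on S (\<lambda>z. if l = k then g z else f z $ l)"
    using assms by (cases "l = k") (auto intro!: continuous_intros)
qed

lemma vec_upd_measurable [measurable]:
  "(\<lambda>(x, t). vec_upd x k t) \<in> borel_measurable (borel \<Otimes>\<^sub>M borel)"
  by (subst borel_prod, rule borel_measurable_continuous_onI)
     (auto simp: case_prod_unfold intro!: continuous_intros)

text \<open>Finner's inequality for the N functions obtained by integrating G_k in the k-th coordinate: each of them
misses exactly one coordinate, so equal weights 1/(N-1) are admissible.\<close>
lemma nn_integral_Loomis_Whitney:
  fixes G :: "'n::finite \<Rightarrow> real ^ 'n \<Rightarrow> ennreal"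
  assumes N: "2 \<le> CARD('n)" and G[measurable]: "\<And>k. G k \<in> borel_measurable borel"
  defines "c \<equiv> 1 / (real CARD('n) - 1)"
  shows "(\<integral>\<^sup>+x. (\<Prod>k\<in>UNIV. epowr (\<integral>\<^sup>+t. G k (vec_upd x k t) \<partial>lborel) c) \<partial>lborel)
     \<le> (\<Prod>k\<in>UNIV. epowr (\<integral>\<^sup>+x. G k x \<partial>lborel) c)"
proof -
  interpret product_sigma_finite "\<lambda>_::'n. lborel :: real measure" ..
  define f where "f k z = (\<integral>\<^sup>+t. G k (\<chi> l. (z(k := t)) l) \<partial>lborel)" for k and z :: "'n \<Rightarrow> real"
  have Gm: "(\<lambda>z. G k (\<chi> l. z l)) \<in> borel_measurable (\<Pi>\<^sub>M l\<in>insert k (UNIV - {k}). lborel)" for k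
    by (simp add: insert_absorb)
  have fm: "f k \<in> borel_measurable (\<Pi>\<^sub>M l\<in>UNIV - {k}. lborel)" for k
  proof -
    have "(\<lambda>p. G k (\<chi> l. ((fst p)(k := snd p)) l)) \<in> borel_measurable ((\<Pi>\<^sub>M l\<in>UNIV - {k}. lborel) \<Otimes>\<^sub>M lborel)"
      by (rule measurable_compose[OF _ Gm]) measurable
    then show ?thesis
      unfolding f_def fun_upd_def
      by (intro sigma_finite_measure.borel_measurable_nn_integral) (auto simp: case_prod_unfold lborel.sigma_finite_measure_axioms)
  qed
  have feq: "f k (restrict z (UNIV - {k})) = (\<integral>\<^sup>+t. G k (vec_upd (\<chi> l. z l) k t) \<partial>lborel)" for k z
    unfolding f_def by (intro nn_integral_cong arg_cong[of _ _ "G k"]) (auto simp: vec_eq_iff)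
  have [measurable]: "(\<lambda>x. \<integral>\<^sup>+t. G k (vec_upd x k t) \<partial>lborel) \<in> borel_measurable borel" for k
  proof -
    have "(\<lambda>p. G k (vec_upd (fst p) k (snd p))) \<in> borel_measurable (borel \<Otimes>\<^sub>M lborel)"
      using measurable_compose[OF vec_upd_measurable G] by (simp add: case_prod_unfold)
    then show ?thesis
      by (intro sigma_finite_measure.borel_measurable_nn_integral) (auto simp: case_prod_unfold lborel.sigma_finite_measure_axioms)
  qed
  have "(\<integral>\<^sup>+x. (\<Prod>k\<in>UNIV. epowr (\<integral>\<^sup>+t. G k (vec_upd x k t) \<partial>lborel) c) \<partial>lborel)
     = (\<integral>\<^sup>+z. (\<Prod>k\<in>UNIV. epowr (\<integral>\<^sup>+t. G k (vec_upd (\<chi> l. z l) k t) \<partial>lborel) c) \<partial>(\<Pi>\<^sub>M l\<in>UNIV. lborel))"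
    by (rule nn_integral_vec_PiM) measurable
  also have "\<dots> = (\<integral>\<^sup>+z. (\<Prod>k\<in>UNIV. epowr (f k (restrict z (UNIV - {k}))) c) \<partial>(\<Pi>\<^sub>M l\<in>UNIV. lborel))"
    unfolding feq ..
  also have "\<dots> \<le> (\<Prod>k\<in>UNIV. epowr (\<integral>\<^sup>+z. f k z \<partial>(\<Pi>\<^sub>M l\<in>UNIV - {k}. lborel)) c)"
  proof (rule Finner)
    show "(\<Sum>k | k \<in> UNIV \<and> a \<in> UNIV - {k}. c) = 1" for a :: 'n
    proof -
      have "{k. k \<in> UNIV \<and> a \<in> UNIV - {k}} = UNIV - {a}" by auto
      then show ?thesis using N by (simp add: c_def of_nat_diff)
    qed
  qed (use N fm in \<open>auto simp: c_def\<close>)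
  also have "\<dots> = (\<Prod>k\<in>UNIV. epowr (\<integral>\<^sup>+x. G k x \<partial>lborel) c)"
  proof (intro prod.cong refl arg_cong2[of _ _ _ _ epowr])
    fix k
    have "(\<integral>\<^sup>+x. G k x \<partial>lborel) = (\<integral>\<^sup>+z. G k (\<chi> l. z l) \<partial>(\<Pi>\<^sub>M l\<in>insert k (UNIV - {k}). lborel))"
      by (subst nn_integral_vec_PiM) (simp_all add: insert_absorb)
    also have "\<dots> = (\<integral>\<^sup>+z. f k z \<partial>(\<Pi>\<^sub>M l\<in>UNIV - {k}. lborel))"
      unfolding f_def by (rule product_nn_integral_insert[OF _ _ Gm]) auto
    finally show "(\<integral>\<^sup>+z. f k z \<partial>(\<Pi>\<^sub>M l\<in>UNIV - {k}. lborel)) = (\<integral>\<^sup>+x. G k x \<partial>lborel)" ..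
  qed
  finally show ?thesis .
qed

text \<open>The value at x differs from the mean value by at most the integral of the derivative. The estimate is local, hence
it serves for periodic angles as well as for functions vanishing at one end.\<close>
lemma abs_le_nn_integral_Icc:
  fixes f f' :: "real \<Rightarrow> real"
  assumes der: "\<And>t. (f has_real_derivative f' t) (at t)" and cont: "continuous_on UNIV f'"
    and ab: "1 / 2 \<le> b - a" and x: "x \<in> {a..b}"
  shows "ennreal \<bar>f x\<bar> \<le> (\<integral>\<^sup>+t. indicator {a..b} t * ennreal (2 * \<bar>f t\<bar> + \<bar>f' t\<bar>) \<partial>lborel)"
proof -
  have contf: "continuous_on S f" for S
    using der by (meson DERIV_isCont continuous_at_imp_continuous_on)
  have contf': "continuous_on S f'" for S using cont by (rule continuous_on_subset) simp
  define I where "I = integral {a..b} (\<lambda>t. \<bar>f' t\<bar>)"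
  define J where "J = integral {a..b} (\<lambda>t. \<bar>f t\<bar>)"
  have i1: "(\<lambda>t. \<bar>f' t\<bar>) integrable_on {c..d}" for c d
    by (intro integrable_continuous_real continuous_intros contf')
  have i2: "(\<lambda>t. \<bar>f t\<bar>) integrable_on {c..d}" for c d
    by (intro integrable_continuous_real continuous_intros contf)
  have le: "\<bar>f d - f c\<bar> \<le> I" if "a \<le> c" "c \<le> d" "d \<le> b" for c d
  proof -
    have "(f' has_integral (f d - f c)) {c..d}"
      by (rule fundamental_theorem_of_calculus[OF that(2)])
         (use der in \<open>auto simp: has_real_derivative_iff_has_vector_derivative intro: has_vector_derivative_at_within\<close>)
    then have "f d - f c = integral {c..d} f'" by (simp add: integral_unique)
    also have "\<bar>\<dots>\<bar> \<le> integral {c..d} (\<lambda>t. \<bar>f' t\<bar>)"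
      using integral_norm_bound_integral[of f' "{c..d}" "\<lambda>t. \<bar>f' t\<bar>"] i1
      by (simp add: integrable_continuous_real contf')
    also have "\<dots> \<le> I" unfolding I_def using that by (intro integral_subset_le i1) auto
    finally show ?thesis .
  qed
  have pt: "\<bar>f x\<bar> - I \<le> \<bar>f y\<bar>" if "y \<in> {a..b}" for y
    using le[of x y] le[of y x] that x by (cases "x \<le> y") auto
  have "(b - a) * (\<bar>f x\<bar> - I) = integral {a..b} (\<lambda>y. \<bar>f x\<bar> - I)"
    using ab by simp
  also have "\<dots> \<le> J" unfolding J_def by (intro integral_le i2 integrable_const_ivl pt)
  finally have m: "(b - a) * (\<bar>f x\<bar> - I) \<le> J" .
  have J0: "0 \<le> J" unfolding J_def by (intro integral_nonneg i2) auto
  have "\<bar>f x\<bar> \<le> 2 * J + I"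
  proof (cases "\<bar>f x\<bar> \<le> I")
    case False
    then have "1 / 2 * (\<bar>f x\<bar> - I) \<le> (b - a) * (\<bar>f x\<bar> - I)" using ab by (intro mult_right_mono) auto
    with m show ?thesis by simp
  qed (use J0 in simp)
  also have "2 * J + I = integral {a..b} (\<lambda>t. 2 * \<bar>f t\<bar> + \<bar>f' t\<bar>)"
    unfolding I_def J_def using i1 i2 by (subst integral_add) (auto intro!: integrable_cmul[of _ _ 2, simplified])
  finally have "ennreal \<bar>f x\<bar> \<le> ennreal (integral {a..b} (\<lambda>t. 2 * \<bar>f t\<bar> + \<bar>f' t\<bar>))" by (rule ennreal_leI)
  also have "\<dots> = (\<integral>\<^sup>+t. indicator {a..b} t * (2 * \<bar>f t\<bar> + \<bar>f' t\<bar>) \<partial>lborel)"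
  proof (rule sym, rule nn_integral_has_integral_lebesgue)
    show "((\<lambda>t. 2 * \<bar>f t\<bar> + \<bar>f' t\<bar>) has_integral integral {a..b} (\<lambda>t. 2 * \<bar>f t\<bar> + \<bar>f' t\<bar>)) {a..b}"
      by (intro integrable_integral integrable_continuous_real continuous_intros contf contf')
  qed auto
  finally show ?thesis by (simp add: ennreal_mult' ennreal_indicator)
qed

text \<open>A weight that is constant along the k-th coordinate lines can be moved into the one-dimensional estimate on
these lines; the Loomis-Whitney inequality then multiplies the N estimates.\<close>
lemma box_Gagliardo:
  fixes V :: "real ^ 'n \<Rightarrow> real" and D \<rho> :: "'n \<Rightarrow> real ^ 'n \<Rightarrow> real" and a b :: "real ^ 'n"
  assumes N: "2 \<le> CARD('n)"
    and V[measurable]: "V \<in> borel_measurable borel"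
    and D: "\<And>k. continuous_on UNIV (D k)"
    and der: "\<And>k x t. ((\<lambda>t. V (vec_upd x k t)) has_real_derivative D k (vec_upd x k t)) (at t)"
    and \<rho>[measurable]: "\<And>k. \<rho> k \<in> borel_measurable borel"
    and \<rho>_pos: "\<And>k x. 0 \<le> \<rho> k x" and \<rho>_indep: "\<And>k x t. \<rho> k (vec_upd x k t) = \<rho> k x"
    and ab: "\<And>k. 1 / 2 \<le> b $ k - a $ k"
  defines "c \<equiv> 1 / (real CARD('n) - 1)"
  shows "(\<integral>\<^sup>+x. indicator (cbox a b) x * (\<Prod>k\<in>UNIV. ennreal ((\<rho> k x * \<bar>V x\<bar>) powr c)) \<partial>lborel)
    \<le> (\<Prod>k\<in>UNIV. epowr (\<integral>\<^sup>+x. indicator (cbox a b) x * ennreal (\<rho> k x * (2 * \<bar>V x\<bar> + \<bar>D k x\<bar>)) \<partial>lborel) c)"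
proof -
  define G where "G k x = indicator (cbox a b) x * ennreal (\<rho> k x * (2 * \<bar>V x\<bar> + \<bar>D k x\<bar>))" for k x
  have Dm[measurable]: "D k \<in> borel_measurable borel" for k by (rule borel_measurable_continuous_onI[OF D])
  have [measurable]: "G k \<in> borel_measurable borel" for k unfolding G_def by measurable
  have c: "0 < c" using N by (simp add: c_def)
  \<comment> \<open>The estimate along the k-th coordinate line through x.\<close>
  have pt: "ennreal (\<rho> k x * \<bar>V x\<bar>) \<le> (\<integral>\<^sup>+t. G k (vec_upd x k t) \<partial>lborel)" if x: "x \<in> cbox a b" for k x
  proof -
    have box: "indicator (cbox a b) (vec_upd x k t) = (indicator {a $ k..b $ k} t :: ennreal)" for t
      using x by (auto simp: indicator_def mem_box_cart)
    have "ennreal \<bar>V x\<bar> \<le> (\<integral>\<^sup>+t. indicator {a $ k..b $ k} t *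
        ennreal (2 * \<bar>V (vec_upd x k t)\<bar> + \<bar>D k (vec_upd x k t)\<bar>) \<partial>lborel)"
    proof -
      have "ennreal \<bar>V (vec_upd x k (x $ k))\<bar> \<le> (\<integral>\<^sup>+t. indicator {a $ k..b $ k} t *
          ennreal (2 * \<bar>V (vec_upd x k t)\<bar> + \<bar>D k (vec_upd x k t)\<bar>) \<partial>lborel)"
      proof (rule abs_le_nn_integral_Icc[OF der _ ab])
        show "continuous_on UNIV (\<lambda>t. D k (vec_upd x k t))"
          by (rule continuous_on_compose2[OF D]) (auto intro!: continuous_intros)
        show "x $ k \<in> {a $ k..b $ k}" using x by (auto simp: mem_box_cart)
      qed
      then show ?thesis by simp
    qed
    then have "ennreal (\<rho> k x) * ennreal \<bar>V x\<bar> \<le> ennreal (\<rho> k x) * (\<integral>\<^sup>+t. indicator {a $ k..b $ k} t *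
        ennreal (2 * \<bar>V (vec_upd x k t)\<bar> + \<bar>D k (vec_upd x k t)\<bar>) \<partial>lborel)"
      by (intro mult_left_mono) auto
    also have "\<dots> = (\<integral>\<^sup>+t. ennreal (\<rho> k x) * (indicator {a $ k..b $ k} t *
        ennreal (2 * \<bar>V (vec_upd x k t)\<bar> + \<bar>D k (vec_upd x k t)\<bar>)) \<partial>lborel)"
    proof (rule nn_integral_cmult[symmetric])
      have [measurable]: "(\<lambda>t. vec_upd x k t) \<in> borel_measurable borel"
        by (intro borel_measurable_continuous_onI continuous_intros)
      show "(\<lambda>t. indicator {a $ k..b $ k} t *
        ennreal (2 * \<bar>V (vec_upd x k t)\<bar> + \<bar>D k (vec_upd x k t)\<bar>)) \<in> borel_measurable lborel" by measurable
    qed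
    also have "\<dots> = (\<integral>\<^sup>+t. G k (vec_upd x k t) \<partial>lborel)"
      unfolding G_def box \<rho>_indep
      by (intro nn_integral_cong) (simp add: ennreal_mult' \<rho>_pos mult_ac)
    finally show ?thesis by (simp add: ennreal_mult' \<rho>_pos)
  qed
  have "(\<integral>\<^sup>+x. indicator (cbox a b) x * (\<Prod>k\<in>UNIV. ennreal ((\<rho> k x * \<bar>V x\<bar>) powr c)) \<partial>lborel)
     \<le> (\<integral>\<^sup>+x. (\<Prod>k\<in>UNIV. epowr (\<integral>\<^sup>+t. G k (vec_upd x k t) \<partial>lborel) c) \<partial>lborel)"
  proof (rule nn_integral_mono)
    fix x
    show "indicator (cbox a b) x * (\<Prod>k\<in>UNIV. ennreal ((\<rho> k x * \<bar>V x\<bar>) powr c))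
      \<le> (\<Prod>k\<in>UNIV. epowr (\<integral>\<^sup>+t. G k (vec_upd x k t) \<partial>lborel) c)"
    proof (cases "x \<in> cbox a b")
      case True
      have "ennreal ((\<rho> k x * \<bar>V x\<bar>) powr c) \<le> epowr (\<integral>\<^sup>+t. G k (vec_upd x k t) \<partial>lborel) c" for k
        using epowr_mono[OF pt[OF True, of k], of c] c \<rho>_pos by simp
      then show ?thesis using True by (simp add: prod_mono_ennreal)
    qed simp
  qed
  also have "\<dots> \<le> (\<Prod>k\<in>UNIV. epowr (\<integral>\<^sup>+x. G k x \<partial>lborel) c)"
    unfolding c_def by (rule nn_integral_Loomis_Whitney[OF N]) simp
  finally show ?thesis unfolding G_def .
qed

section \<open>Polar coordinates around an axis\<close>

text \<open>Coordinates i and j of the argument are the radius and the angle; the others are kept.\<close>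
definition polar :: "'a::finite \<Rightarrow> 'a \<Rightarrow> real ^ 'a \<Rightarrow> real ^ 'a" where
  "polar i j p = (\<chi> l. if l = i then p $ i * cos (p $ j) else if l = j then p $ i * sin (p $ j) else p $ l)"

lemma continuous_polar:
  fixes i j :: "'n::finite"
  shows "continuous_on UNIV (polar i j)"
  unfolding polar_def
proof (rule continuous_on_vec_lambda)
  fix l :: 'n
  have nth: "continuous_on UNIV (\<lambda>p::real^'n. p $ k)" for k
    by (intro continuous_intros)
  have "continuous_on UNIV (\<lambda>p::real^'n. cos (p $ j))"
    by (rule continuous_on_compose2[of UNIV cos, OF _ nth]) (auto intro!: continuous_at_imp_continuous_on)
  moreover have "continuous_on UNIV (\<lambda>p::real^'n. sin (p $ j))"
    by (rule continuous_on_compose2[of UNIV sin, OF _ nth]) (auto intro!: continuous_at_imp_continuous_on)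
  ultimately have "continuous_on UNIV (\<lambda>p::real^'n. p $ i * cos (p $ j))"
    "continuous_on UNIV (\<lambda>p::real^'n. p $ i * sin (p $ j))"
    by (simp_all add: continuous_on_mult nth)
  then show "continuous_on UNIV (\<lambda>p::real^'n. if l = i then p $ i * cos (p $ j) else if l = j then p $ i * sin (p $ j) else p $ l)"
    by (cases "l = i"; cases "l = j") (auto simp: nth)
qed

text \<open>Fubini, with the (i, j)-plane as a vector space of type \<open>real ^ 2\<close>.\<close>
lemma nn_integral_plane_slices:
  fixes f :: "real ^ 'n \<Rightarrow> ennreal"
  assumes f[measurable]: "f \<in> borel_measurable borel" and ij: "i \<noteq> j"
  shows "(\<integral>\<^sup>+x. f x \<partial>lborel) = (\<integral>\<^sup>+z. (\<integral>\<^sup>+q. f (\<chi> l. if l = i then q $ (1::2) else if l = j then q $ 2 else z l) \<partial>lborel)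
      \<partial>(\<Pi>\<^sub>M l\<in>UNIV - {i, j}. lborel))"
proof -
  interpret product_sigma_finite "\<lambda>_::'n. lborel :: real measure" ..
  have U: "insert j (insert i (UNIV - {i, j})) = UNIV" by auto
  have m: "(\<lambda>z. f (\<chi> l. z l)) \<in> borel_measurable (\<Pi>\<^sub>M l\<in>insert j (insert i (UNIV - {i, j})). lborel)"
    unfolding U by measurable
  have m2: "(\<lambda>x. \<integral>\<^sup>+b. f (\<chi> l. (x(j := b)) l) \<partial>lborel) \<in> borel_measurable (\<Pi>\<^sub>M l\<in>insert i (UNIV - {i, j}). lborel)"
  proof -
    have "(\<lambda>p. f (\<chi> l. ((fst p)(j := snd p)) l)) \<in> borel_measurable ((\<Pi>\<^sub>M l\<in>insert i (UNIV - {i, j}). lborel) \<Otimes>\<^sub>M lborel)"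
      by (rule measurable_compose[OF _ m]) measurable
    then show ?thesis
      by (intro sigma_finite_measure.borel_measurable_nn_integral) (auto simp: case_prod_unfold lborel.sigma_finite_measure_axioms)
  qed
  have "(\<integral>\<^sup>+x. f x \<partial>lborel) = (\<integral>\<^sup>+z. f (\<chi> l. z l) \<partial>(\<Pi>\<^sub>M l\<in>insert j (insert i (UNIV - {i, j})). lborel))"
    unfolding U by (rule nn_integral_vec_PiM) simp
  also have "\<dots> = (\<integral>\<^sup>+x. (\<integral>\<^sup>+b. f (\<chi> l. (x(j := b)) l) \<partial>lborel) \<partial>(\<Pi>\<^sub>M l\<in>insert i (UNIV - {i, j}). lborel))"
    using product_nn_integral_insert[OF _ _ m] ij by simp
  also have "\<dots> = (\<integral>\<^sup>+z. (\<integral>\<^sup>+a. (\<integral>\<^sup>+b. f (\<chi> l. ((z(i := a))(j := b)) l) \<partial>lborel) \<partial>lborel) \<partial>(\<Pi>\<^sub>M l\<in>UNIV - {i, j}. lborel))"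
    using product_nn_integral_insert[OF _ _ m2] ij by simp
  also have "\<dots> = (\<integral>\<^sup>+z. (\<integral>\<^sup>+q. f (\<chi> l. if l = i then q $ (1::2) else if l = j then q $ 2 else z l) \<partial>lborel)
      \<partial>(\<Pi>\<^sub>M l\<in>UNIV - {i, j}. lborel))"
  proof (rule nn_integral_cong)
    fix z :: "'n \<Rightarrow> real"
    have "continuous_on UNIV (\<lambda>q::real^2. (\<chi> l. if l = i then q $ (1::2) else if l = j then q $ 2 else z l) :: real ^ 'n)"
    proof (rule continuous_on_vec_lambda)
      fix l show "continuous_on UNIV (\<lambda>q::real^2. if l = i then q $ (1::2) else if l = j then q $ 2 else z l)"
        by (cases "l = i"; cases "l = j") (auto intro!: continuous_intros)
    qed
    note [measurable] = borel_measurable_continuous_onI[OF this]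
    show "(\<integral>\<^sup>+a. (\<integral>\<^sup>+b. f (\<chi> l. ((z(i := a))(j := b)) l) \<partial>lborel) \<partial>lborel)
       = (\<integral>\<^sup>+q. f (\<chi> l. if l = i then q $ (1::2) else if l = j then q $ 2 else z l) \<partial>lborel)"
      by (subst nn_integral_vec2, measurable)
         (auto intro!: nn_integral_cong arg_cong[of _ _ f] simp: vec_eq_iff ij)
  qed
  finally show ?thesis .
qed

lemma nn_integral_polar:
  fixes f :: "real ^ 'n \<Rightarrow> ennreal"
  assumes f[measurable]: "f \<in> borel_measurable borel" and ij: "i \<noteq> j" and R: "0 \<le> R"
  shows "(\<integral>\<^sup>+x. indicator {x. 0 < (x $ i)\<^sup>2 + (x $ j)\<^sup>2 \<and> (x $ i)\<^sup>2 + (x $ j)\<^sup>2 \<le> R\<^sup>2} x * f x \<partial>lborel)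
    = (\<integral>\<^sup>+p. indicator {p. 0 < p $ i \<and> p $ i \<le> R \<and> 0 \<le> p $ j \<and> p $ j < 2 * pi} p * ennreal (p $ i) * f (polar i j p) \<partial>lborel)"
proof -
  let ?A = "{x::real^'n. 0 < (x $ i)\<^sup>2 + (x $ j)\<^sup>2 \<and> (x $ i)\<^sup>2 + (x $ j)\<^sup>2 \<le> R\<^sup>2}"
  let ?B = "{p::real^'n. 0 < p $ i \<and> p $ i \<le> R \<and> 0 \<le> p $ j \<and> p $ j < 2 * pi}"
  let ?e = "\<lambda>z (q::real^2). (\<chi> l. if l = i then q $ 1 else if l = j then q $ 2 else z l) :: real ^ 'n"
  have nth[measurable]: "(\<lambda>p::real^'n. p $ k) \<in> borel_measurable borel" for k
    by (intro borel_measurable_continuous_onI continuous_intros)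
  have "{x \<in> space borel. 0 < (x $ i)\<^sup>2 + (x $ j)\<^sup>2 \<and> (x $ i)\<^sup>2 + (x $ j)\<^sup>2 \<le> R\<^sup>2} \<in> sets (borel :: (real^'n) measure)"
    by measurable
  then have A[measurable]: "?A \<in> sets borel" by simp
  have "{p \<in> space borel. 0 < p $ i \<and> p $ i \<le> R \<and> 0 \<le> p $ j \<and> p $ j < 2 * pi} \<in> sets (borel :: (real^'n) measure)"
    by measurable
  then have B[measurable]: "?B \<in> sets borel" by simp
  have [measurable]: "polar i j \<in> borel_measurable borel"
    by (rule borel_measurable_continuous_onI[OF continuous_polar])
  have e: "continuous_on UNIV (?e z)" for z
  proof (rule continuous_on_vec_lambda)
    fix l show "continuous_on UNIV (\<lambda>q::real^2. if l = i then q $ (1::2) else if l = j then q $ 2 else z l)"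
      by (cases "l = i"; cases "l = j") (auto intro!: continuous_intros)
  qed
  have [measurable]: "(\<lambda>q. f (?e z q)) \<in> borel_measurable borel" for z
    by (rule measurable_compose[OF borel_measurable_continuous_onI[OF e] f])
  have "(\<integral>\<^sup>+x. indicator ?A x * f x \<partial>lborel)
     = (\<integral>\<^sup>+z. (\<integral>\<^sup>+q. indicator ?A (?e z q) * f (?e z q) \<partial>lborel) \<partial>(\<Pi>\<^sub>M l\<in>UNIV - {i, j}. lborel))"
    by (rule nn_integral_plane_slices[OF _ ij]) measurable
  also have "\<dots> = (\<integral>\<^sup>+z. (\<integral>\<^sup>+q. indicator (polar2 ` polar_strip R) q * f (?e z q) \<partial>lborel) \<partial>(\<Pi>\<^sub>M l\<in>UNIV - {i, j}. lborel))"
    using ij by (intro nn_integral_cong) (simp add: polar2_image[OF R] indicator_def)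
  also have "\<dots> = (\<integral>\<^sup>+z. (\<integral>\<^sup>+q. indicator (polar_strip R) q * ennreal (q $ 1) * f (?e z (polar2 q)) \<partial>lborel) \<partial>(\<Pi>\<^sub>M l\<in>UNIV - {i, j}. lborel))"
    by (intro nn_integral_cong nn_integral_polar2 R) measurable
  also have "\<dots> = (\<integral>\<^sup>+z. (\<integral>\<^sup>+q. indicator ?B (?e z q) * ennreal (?e z q $ i) * f (polar i j (?e z q)) \<partial>lborel) \<partial>(\<Pi>\<^sub>M l\<in>UNIV - {i, j}. lborel))"
  proof (intro nn_integral_cong)
    fix z q
    have "?e z (polar2 q) = polar i j (?e z q)" using ij by (auto simp: vec_eq_iff polar_def)
    moreover have "indicator (polar_strip R) q = (indicator ?B (?e z q) :: ennreal)"
      using ij by (simp add: polar_strip_def indicator_def)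
    ultimately show "indicator (polar_strip R) q * ennreal (q $ 1) * f (?e z (polar2 q))
      = indicator ?B (?e z q) * ennreal (?e z q $ i) * f (polar i j (?e z q))" by simp
  qed
  also have "\<dots> = (\<integral>\<^sup>+p. indicator ?B p * ennreal (p $ i) * f (polar i j p) \<partial>lborel)"
    by (rule nn_integral_plane_slices[OF _ ij, symmetric]) measurable
  finally show ?thesis .
qed

section \<open>Functions with compact support\<close>

lemma continuous_on_UNIV_of_compact_support:
  fixes f :: "'a::euclidean_space \<Rightarrow> 'b::real_normed_vector"
  assumes K: "compact K" and U: "open U" "K \<subseteq> U" and f: "continuous_on U f" and z: "\<And>x. x \<notin> K \<Longrightarrow> f x = 0"
  shows "continuous_on UNIV f"
proof -
  have "open (- K)" using compact_imp_closed[OF K] by auto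
  moreover have "continuous_on (- K) f"
    by (rule continuous_on_eq[of _ "\<lambda>_. 0"]) (auto simp: z)
  ultimately have "continuous_on (U \<union> - K) f" using U f by (intro continuous_on_open_Un)
  moreover have "U \<union> - K = UNIV" using U by auto
  ultimately show ?thesis by simp
qed

lemma integrable_lborel_of_compact_support:
  fixes f :: "'a::euclidean_space \<Rightarrow> 'b::euclidean_space"
  assumes K: "compact K" and f: "continuous_on UNIV f" and z: "\<And>x. x \<notin> K \<Longrightarrow> f x = 0"
  shows "integrable lborel f"
proof -
  have "integrable lborel (\<lambda>x. indicator K x *\<^sub>R f x)"
    using borel_integrable_compact[OF K continuous_on_subset[OF f]] by simp
  moreover have "(\<lambda>x. indicator K x *\<^sub>R f x) = f" using z by (auto simp: fun_eq_iff indicator_def)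
  ultimately show ?thesis by simp
qed

lemma integral_lborel_translate:
  fixes f :: "'a::euclidean_space \<Rightarrow> real"
  assumes [measurable]: "f \<in> borel_measurable borel"
  shows "(LINT x|lborel. f (x + c)) = (LINT x|lborel. f x)"
proof -
  have "(LINT x|lborel. f x) = (LINT x|distr lborel borel ((+) c). f x)"
    by (simp add: lborel_distr_plus)
  also have "\<dots> = (LINT x|lborel. f (c + x))" by (rule integral_distr) auto
  finally show ?thesis by (simp add: add.commute)
qed

lemma bounded_of_compact_support:
  fixes f :: "'a::euclidean_space \<Rightarrow> real"
  assumes K: "compact K" and f: "continuous_on UNIV f" and z: "\<And>x. x \<notin> K \<Longrightarrow> f x = 0"
  obtains B where "0 \<le> B" "\<And>x. \<bar>f x\<bar> \<le> B"
proof -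
  have "bounded (f ` K)" using K f by (intro compact_imp_bounded compact_continuous_image continuous_on_subset[OF f]) auto
  then obtain B where "\<And>x. x \<in> K \<Longrightarrow> \<bar>f x\<bar> \<le> B" by (auto simp: bounded_iff)
  then have "\<bar>f x\<bar> \<le> max B 0" for x using z[of x] by (cases "x \<in> K") (auto simp: max.coboundedI1)
  then show ?thesis using that[of "max B 0"] by auto
qed

text \<open>The integrals of the difference quotients vanish by translation invariance, and the quotients are uniformly
bounded and vanish outside a fixed compact set.\<close>
lemma integral_directional_derivative_eq_0:
  fixes f f' :: "'a::euclidean_space \<Rightarrow> real"
  assumes K: "compact K" and z: "\<And>x. x \<notin> K \<Longrightarrow> f x = 0" "\<And>x. x \<notin> K \<Longrightarrow> f' x = 0"
    and f: "continuous_on UNIV f" and f': "continuous_on UNIV f'"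
    and der: "\<And>x s. ((\<lambda>s. f (x + s *\<^sub>R e)) has_real_derivative f' (x + s *\<^sub>R e)) (at s)"
  shows "(LINT x|lborel. f' x) = 0"
proof -
  have [measurable]: "f \<in> borel_measurable borel" "f' \<in> borel_measurable borel"
    by (simp_all add: borel_measurable_continuous_onI f f')
  obtain B where B: "0 \<le> B" "\<And>x. \<bar>f' x\<bar> \<le> B" using bounded_of_compact_support[OF K f' z(2)] by blast
  \<comment> \<open>All points from which a step s e with 0 <= s <= 1 can lead into K.\<close>
  define K' where "K' = (\<lambda>(x, s). x - s *\<^sub>R e) ` (K \<times> {0..1::real})"
  have K': "compact K'" unfolding K'_def
    by (intro compact_continuous_image compact_Times K) (auto simp: case_prod_unfold intro!: continuous_intros)
  have [measurable]: "K' \<in> sets borel" using K' by (simp add: borel_compact)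
  define d where "d n x = (f (x + (1 / real (Suc n)) *\<^sub>R e) - f x) / (1 / real (Suc n))" for n x
  have if1: "integrable lborel f" by (rule integrable_lborel_of_compact_support[OF K f z(1)])
  have int0: "(LINT x|lborel. d n x) = 0" for n
  proof -
    have "integrable lborel (\<lambda>x. f (c + x))" for c
    proof -
      have "integrable (distr lborel borel ((+) c)) f" using if1 by (simp add: lborel_distr_plus)
      then show ?thesis by (subst (asm) integrable_distr_eq) (auto simp: comp_def)
    qed
    then have "integrable lborel (\<lambda>x. f (x + c))" for c by (subst add.commute)
    then show ?thesis
      unfolding d_def using if1 by (simp add: integral_lborel_translate)
  qed
  have "(\<lambda>n. LINT x|lborel. d n x) \<longlonglongrightarrow> (LINT x|lborel. f' x)"
  proof (rule integral_dominated_convergence[where w = "\<lambda>x. indicator K' x * B"])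
    show "integrable lborel (\<lambda>x. indicator K' x * B)"
      using emeasure_compact_finite[OF K'] by (simp add: integrable_real_indicator)
    show "AE x in lborel. (\<lambda>n. d n x) \<longlonglongrightarrow> f' x"
    proof (rule AE_I2)
      fix x
      have "((\<lambda>h. (f (x + h *\<^sub>R e) - f x) / h) \<longlongrightarrow> f' x) (at 0)"
        using der[of x 0] by (simp add: DERIV_def)
      moreover have "filterlim (\<lambda>n. 1 / real (Suc n)) (at 0) sequentially"
        using LIMSEQ_inverse_real_of_nat unfolding inverse_eq_divide
        by (intro filterlim_atI) auto
      ultimately show "(\<lambda>n. d n x) \<longlonglongrightarrow> f' x"
        unfolding d_def by (rule filterlim_compose)
    qed
    show "AE x in lborel. norm (d n x) \<le> indicator K' x * B" for n
    proof (rule AE_I2)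
      fix x
      define h where "h = 1 / real (Suc n)"
      have h: "0 < h" "h \<le> 1" by (simp_all add: h_def)
      obtain s where s: "0 < s" "s < h" "f (x + h *\<^sub>R e) - f (x + 0 *\<^sub>R e) = (h - 0) * f' (x + s *\<^sub>R e)"
        using MVT2[of 0 h "\<lambda>s. f (x + s *\<^sub>R e)" "\<lambda>s. f' (x + s *\<^sub>R e)"] h der by blast
      have "d n x = (f (x + h *\<^sub>R e) - f x) / h" by (simp only: d_def h_def)
      then have d: "d n x = f' (x + s *\<^sub>R e)" using h s by simp
      show "norm (d n x) \<le> indicator K' x * B"
      proof (cases "x \<in> K'")
        case False
        then have "x + s *\<^sub>R e \<notin> K"
          using s h unfolding K'_def by (force simp: image_iff)
        then show ?thesis using False d z by simp
      qed (use d B in simp)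
    qed
  qed (auto simp: d_def)
  then show ?thesis by (simp add: int0 LIMSEQ_const_iff)
qed

section \<open>The quadratic form of the energy\<close>

lemma two_le_CARD:
  fixes i j :: "'n::finite"
  assumes "i \<noteq> j"
  shows "2 \<le> CARD('n)"
proof -
  have "card {i, j} \<le> CARD('n)" by (rule card_mono) auto
  then show ?thesis using assms by simp
qed

text \<open>For the gradient \<xi> of u at x this is the integrand of the energy.\<close>
definition ang_form :: "'n::finite \<Rightarrow> 'n \<Rightarrow> real ^ 'n \<Rightarrow> real ^ 'n \<Rightarrow> real" where
  "ang_form i j x \<xi> = (norm \<xi>)\<^sup>2 - (x $ i * \<xi> $ j - x $ j * \<xi> $ i)\<^sup>2"

lemma norm_sq_split:
  fixes \<xi> :: "real ^ 'n"
  assumes "i \<noteq> j"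
  shows "(norm \<xi>)\<^sup>2 = (\<xi> $ i)\<^sup>2 + (\<xi> $ j)\<^sup>2 + (\<Sum>k\<in>UNIV - {i, j}. (\<xi> $ k)\<^sup>2)"
proof -
  have "(norm \<xi>)\<^sup>2 = (\<Sum>k\<in>UNIV. (\<xi> $ k)\<^sup>2)" by (simp add: norm_vec_def L2_set_def sum_nonneg)
  also have "UNIV = insert i (insert j (UNIV - {i, j}))" by auto
  finally show ?thesis using assms by simp
qed

lemma ang_form_eq:
  assumes "i \<noteq> j"
  shows "ang_form i j x \<xi> = (\<xi> $ i)\<^sup>2 + (\<xi> $ j)\<^sup>2 - (x $ i * \<xi> $ j - x $ j * \<xi> $ i)\<^sup>2 + (\<Sum>k\<in>UNIV - {i, j}. (\<xi> $ k)\<^sup>2)"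
  by (simp add: ang_form_def norm_sq_split[OF assms])

lemma ang_sq_le: "(x $ i * \<xi> $ j - x $ j * \<xi> $ i)\<^sup>2 \<le> ((x $ i)\<^sup>2 + (x $ j)\<^sup>2) * ((\<xi> $ i)\<^sup>2 + (\<xi> $ j)\<^sup>2)"
  for x \<xi> :: "real ^ 'n"
proof -
  have "(x $ i * \<xi> $ j - x $ j * \<xi> $ i)\<^sup>2 + (x $ i * \<xi> $ i + x $ j * \<xi> $ j)\<^sup>2
    = ((x $ i)\<^sup>2 + (x $ j)\<^sup>2) * ((\<xi> $ i)\<^sup>2 + (\<xi> $ j)\<^sup>2)" by algebra
  then show ?thesis by (smt (verit) zero_le_power2)
qed

text \<open>1 - r^2 is the smallest eigenvalue of the form when r <= 1.\<close>
lemma ang_form_ge: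
  assumes ij: "i \<noteq> j"
  shows "(1 - ((x $ i)\<^sup>2 + (x $ j)\<^sup>2)) * (norm \<xi>)\<^sup>2 \<le> ang_form i j x \<xi>"
proof -
  have "((x $ i)\<^sup>2 + (x $ j)\<^sup>2) * ((\<xi> $ i)\<^sup>2 + (\<xi> $ j)\<^sup>2) \<le> ((x $ i)\<^sup>2 + (x $ j)\<^sup>2) * (norm \<xi>)\<^sup>2"
    using norm_sq_split[OF ij, of \<xi>] by (intro mult_left_mono) (auto intro: sum_nonneg)
  with ang_sq_le[of x i \<xi> j] show ?thesis by (simp add: ang_form_def algebra_simps)
qed

lemma ang_form_le: "ang_form i j x \<xi> \<le> (norm \<xi>)\<^sup>2"
  by (simp add: ang_form_def)

lemma ang_form_nonneg:
  assumes "i \<noteq> j" "(x $ i)\<^sup>2 + (x $ j)\<^sup>2 \<le> 1"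
  shows "0 \<le> ang_form i j x \<xi>"
  using ang_form_ge[OF assms(1), of x \<xi>] assms(2)
  by (smt (verit) mult_nonneg_nonneg zero_le_power2)

text \<open>By Lagrange's identity the form bounds r^2 times the square of the radial derivative.\<close>
lemma ang_form_ge_radial:
  assumes ij: "i \<noteq> j" and x: "(x $ i)\<^sup>2 + (x $ j)\<^sup>2 \<le> 1"
  shows "(x $ i * \<xi> $ i + x $ j * \<xi> $ j)\<^sup>2 \<le> ang_form i j x \<xi>"
proof -
  have "(x $ i * \<xi> $ j - x $ j * \<xi> $ i)\<^sup>2 + (x $ i * \<xi> $ i + x $ j * \<xi> $ j)\<^sup>2
    = ((x $ i)\<^sup>2 + (x $ j)\<^sup>2) * ((\<xi> $ i)\<^sup>2 + (\<xi> $ j)\<^sup>2)" by algebra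
  also have "\<dots> \<le> 1 * ((\<xi> $ i)\<^sup>2 + (\<xi> $ j)\<^sup>2)"
    using x by (intro mult_right_mono) auto
  finally show ?thesis
    using sum_nonneg[of "UNIV - {i, j}" "\<lambda>k. (\<xi> $ k)\<^sup>2"] by (simp add: ang_form_eq[OF ij])
qed

text \<open>Diagonalisation in the radial, angular and remaining directions.\<close>
lemma ang_form_polar:
  assumes ij: "i \<noteq> j" and x: "x $ i = r * cos t" "x $ j = r * sin t"
  shows "ang_form i j x \<xi> = (cos t * \<xi> $ i + sin t * \<xi> $ j)\<^sup>2 + (1 - r\<^sup>2) * (cos t * \<xi> $ j - sin t * \<xi> $ i)\<^sup>2
     + (\<Sum>k\<in>UNIV - {i, j}. (\<xi> $ k)\<^sup>2)"
proof -
  have "(cos t)\<^sup>2 + (sin t)\<^sup>2 = 1" by simp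
  then have "(\<xi> $ i)\<^sup>2 + (\<xi> $ j)\<^sup>2 - (r * cos t * \<xi> $ j - r * sin t * \<xi> $ i)\<^sup>2
    = (cos t * \<xi> $ i + sin t * \<xi> $ j)\<^sup>2 + (1 - r\<^sup>2) * (cos t * \<xi> $ j - sin t * \<xi> $ i)\<^sup>2"
    by algebra
  then show ?thesis by (simp add: ang_form_eq[OF ij] x)
qed

section \<open>Smooth test functions\<close>

lemma has_derivative_grad:
  assumes "f differentiable (at x)"
  shows "(f has_derivative (\<lambda>h. grad f x \<bullet> h)) (at x)"
proof -
  let ?F = "frechet_derivative f (at x)"
  have F: "(f has_derivative ?F) (at x)" using assms frechet_derivative_works by blast
  then have "linear ?F" by (rule has_derivative_linear)
  have "?F h = grad f x \<bullet> h" for h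
  proof -
    have "?F h = ?F (\<Sum>i\<in>UNIV. h $ i *\<^sub>R axis i 1)" by (simp add: basis_expansion flip: scalar_mult_eq_scaleR)
    also have "\<dots> = (\<Sum>i\<in>UNIV. h $ i *\<^sub>R ?F (axis i 1))"
      using \<open>linear ?F\<close> by (simp add: linear_sum linear_cmul)
    also have "\<dots> = grad f x \<bullet> h" by (simp add: grad_def inner_vec_def mult.commute)
    finally show ?thesis .
  qed
  then have "?F = (\<lambda>h. grad f x \<bullet> h)" by blast
  then show ?thesis using F by simp
qed

lemma grad_eqI:
  assumes "(f has_derivative (\<lambda>h. g \<bullet> h)) (at x)"
  shows "grad f x = g"
proof -
  have "frechet_derivative f (at x) = (\<lambda>h. g \<bullet> h)"
    using assms by (rule frechet_derivative_at[symmetric])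
  then show ?thesis by (simp add: grad_def vec_eq_iff inner_axis)
qed

lemma has_derivative_grad_line:
  fixes f :: "real ^ 'n \<Rightarrow> real"
  assumes "f differentiable (at (x + s *\<^sub>R e))"
  shows "((\<lambda>s. f (x + s *\<^sub>R e)) has_real_derivative grad f (x + s *\<^sub>R e) \<bullet> e) (at s)"
proof -
  have "((\<lambda>s. x + s *\<^sub>R e) has_derivative (\<lambda>h. h *\<^sub>R e)) (at s)"
    by (auto intro!: derivative_eq_intros)
  from has_derivative_compose[OF this has_derivative_grad[OF assms]]
  show ?thesis unfolding has_field_derivative_def
    by (rule has_derivative_eq_rhs) (auto simp: fun_eq_iff mult.commute)
qed

lemma Ck_Suc_imp: "Ck (Suc k) f \<Longrightarrow> Ck k f"
proof (induction k arbitrary: f)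
  case 0
  then show ?case by (auto intro!: continuous_at_imp_continuous_on differentiable_imp_continuous_within)
next
  case (Suc k)
  then show ?case by (metis Ck.simps(2))
qed

lemma Ck_const: "Ck k (\<lambda>x::real^'n. c)"
proof (induction k arbitrary: c)
  case (Suc k)
  have "grad (\<lambda>x::real^'n. c) x = 0" for x by (rule grad_eqI) (auto intro!: derivative_eq_intros)
  then show ?case using Suc by simp
qed simp

lemma Ck_nth: "Ck k (\<lambda>x::real^'n. x $ l)"
proof (cases k)
  case (Suc m)
  have d: "((\<lambda>x::real^'n. x $ l) has_derivative (\<lambda>h. axis l 1 \<bullet> h)) (at x)" for x
    by (simp add: inner_axis' bounded_linear_imp_has_derivative bounded_linear_vec_nth)
  have "grad (\<lambda>x::real^'n. x $ l) x = axis l 1" for x by (rule grad_eqI[OF d])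
  moreover have "(\<lambda>x::real^'n. x $ l) differentiable (at x)" for x using d differentiable_def by blast
  ultimately show ?thesis using Suc by (simp add: Ck_const)
qed (simp add: continuous_intros)

lemma Ck_add: "Ck k f \<Longrightarrow> Ck k g \<Longrightarrow> Ck k (\<lambda>x. f x + g x)"
proof (induction k arbitrary: f g)
  case (Suc k)
  have "grad (\<lambda>x. f x + g x) x = grad f x + grad g x" for x
    by (rule grad_eqI) (use Suc.prems in \<open>auto intro!: derivative_eq_intros has_derivative_grad simp: inner_add_left\<close>)
  then show ?case using Suc by simp
qed (simp add: continuous_intros)

lemma Ck_mult: "Ck k f \<Longrightarrow> Ck k g \<Longrightarrow> Ck k (\<lambda>x. f x * g x)"
proof (induction k arbitrary: f g)
  case (Suc k)
  have "grad (\<lambda>x. f x * g x) x = f x *\<^sub>R grad g x + g x *\<^sub>R grad f x" for x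
    by (rule grad_eqI) (use Suc.prems in \<open>auto intro!: derivative_eq_intros has_derivative_grad simp: inner_add_left\<close>)
  then show ?case using Suc Ck_Suc_imp[OF Suc.prems(1)] Ck_Suc_imp[OF Suc.prems(2)]
    by (auto intro!: Ck_add)
qed (simp add: continuous_intros)

lemma Ck_diff: "Ck k f \<Longrightarrow> Ck k g \<Longrightarrow> Ck k (\<lambda>x. f x - g x)"
  using Ck_add[OF _ Ck_mult[OF Ck_const[of k "-1"]], of f g] by simp

lemma Ck_prod: "(\<And>l. l \<in> I \<Longrightarrow> Ck k (f l)) \<Longrightarrow> Ck k (\<lambda>x. \<Prod>l\<in>I. f l x)"
  by (induction I rule: infinite_finite_induct) (auto intro: Ck_const Ck_mult)

text \<open>The family is closed under differentiation up to linear combinations, so that smoothness of exp(-1/t) needs no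
polynomials in 1/t.\<close>
definition flat :: "nat \<Rightarrow> real \<Rightarrow> real" where
  "flat m t = (if t \<le> 0 then 0 else inverse t ^ m * exp (- inverse t))"

lemma flat_nonneg: "0 \<le> flat m t" by (simp add: flat_def)

text \<open>From (s/n)^n <= exp s with s = 1/t.\<close>
lemma flat_le: "flat m t \<le> real (m + n) ^ (m + n) * t ^ n" if "0 < t" "0 < m + n"
proof -
  define s where "s = inverse t"
  have s: "0 < s" "s * t = 1" using that by (simp_all add: s_def)
  have "(s / real (m + n)) ^ (m + n) \<le> (1 + s / real (m + n)) ^ (m + n)"
    using s by (intro power_mono) auto
  also have "\<dots> \<le> exp s" using s that by (intro exp_ge_one_plus_x_over_n_power_n) auto
  finally have "s ^ (m + n) * exp (- s) \<le> real (m + n) ^ (m + n)"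
    using that by (simp add: power_divide exp_minus divide_simps mult.commute)
  then have "s ^ (m + n) * exp (- s) * t ^ n \<le> real (m + n) ^ (m + n) * t ^ n"
    using that by (intro mult_right_mono) auto
  also have "s ^ (m + n) * exp (- s) * t ^ n = s ^ m * exp (- s) * (s * t) ^ n"
    by (simp add: power_add power_mult_distrib mult_ac)
  finally show ?thesis using that s by (simp add: flat_def s_def)
qed

text \<open>At 0 the difference quotient is at most a constant times |h|, because exp(-1/h) is at most a constant times
h^(m+2) for h > 0.\<close>
lemma flat_has_derivative:
  "(flat m has_real_derivative flat (m + 2) t - real m * flat (m + 1) t) (at t)"
proof -
  consider "t < 0" | "t > 0" | "t = 0" by linarith
  then show ?thesis
  proof cases
    case 1
    have "((\<lambda>_. 0) has_real_derivative 0) (at t)" by simp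
    moreover have "eventually (\<lambda>s. 0 = flat m s) (nhds t)"
      using eventually_nhds_in_open[of "{..<0}" t] 1 by (auto simp: flat_def elim!: eventually_mono)
    ultimately have "(flat m has_real_derivative 0) (at t)" by (simp add: DERIV_cong_ev)
    then show ?thesis using 1 by (simp add: flat_def)
  next
    case 2
    have i: "(inverse has_real_derivative - (inverse t ^ 2)) (at t)"
      using DERIV_inverse[of t] 2 by (simp add: numeral_2_eq_2)
    have "((\<lambda>s. inverse s ^ m) has_real_derivative - (real m * inverse t ^ (m + 1))) (at t)"
      using DERIV_power[OF i, of m] by (cases m) (simp_all add: power2_eq_square algebra_simps)
    from DERIV_mult[OF this DERIV_chain2[OF DERIV_exp DERIV_minus[OF i]]]
    have "((\<lambda>s. inverse s ^ m * exp (- inverse s)) has_real_derivative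
       (inverse t ^ (m + 2) * exp (- inverse t) - real m * (inverse t ^ (m + 1) * exp (- inverse t)))) (at t)"
      by (simp add: power2_eq_square algebra_simps)
    moreover have "eventually (\<lambda>s. inverse s ^ m * exp (- inverse s) = flat m s) (nhds t)"
      using eventually_nhds_in_open[of "{0<..}" t] 2 by (auto simp: flat_def elim!: eventually_mono)
    ultimately have "(flat m has_real_derivative
       (inverse t ^ (m + 2) * exp (- inverse t) - real m * (inverse t ^ (m + 1) * exp (- inverse t)))) (at t)"
      by (simp add: DERIV_cong_ev)
    then show ?thesis using 2 by (simp add: flat_def)
  next
    case 3
    define C where "C = real (m + 2) ^ (m + 2)"
    have "((\<lambda>h. flat m h / h) \<longlongrightarrow> 0) (at 0)"
    proof (rule Lim_null_comparison)
      show "((\<lambda>h. C * \<bar>h\<bar>) \<longlongrightarrow> 0) (at 0)" by (auto intro!: tendsto_eq_intros)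
      show "eventually (\<lambda>h. norm (flat m h / h) \<le> C * \<bar>h\<bar>) (at 0)"
      proof (rule always_eventually, rule allI)
        fix h :: real
        show "norm (flat m h / h) \<le> C * \<bar>h\<bar>"
        proof (cases "0 < h")
          case True
          then have "flat m h / h \<le> C * h ^ 2 / h"
            using flat_le[of h m 2] by (intro divide_right_mono) (auto simp: C_def)
          then show ?thesis using True flat_nonneg[of m h] by (simp add: power2_eq_square)
        next
          case False
          have "0 \<le> C" by (simp add: C_def)
          then show ?thesis using False by (simp add: flat_def mult_nonneg_nonpos)
        qed
      qed
    qed
    then show ?thesis using 3 by (simp add: DERIV_def flat_def)
  qed
qed

lemma continuous_on_flat: "continuous_on S (flat m)"
  by (meson DERIV_isCont continuous_at_imp_continuous_on flat_has_derivative)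

lemma flat_0_le_1: "flat 0 t \<le> 1" by (simp add: flat_def)

lemma flat_2_le: "flat 2 t \<le> 4"
  using flat_le[of t 2 0] by (cases "0 < t") (simp_all add: flat_def)

text \<open>The induction on k has to range over all m, since differentiation raises m.\<close>
lemma Ck_flat:
  fixes g :: "real ^ 'n \<Rightarrow> real"
  assumes g: "\<And>k. Ck k g"
  shows "Ck k (\<lambda>x. flat m (g x))"
proof (induction k arbitrary: m)
  case 0
  then show ?case using g[of 0] by (auto intro: continuous_on_compose2[OF continuous_on_flat])
next
  case (Suc k)
  have dg: "g differentiable (at x)" for x using g[of "Suc 0"] by simp
  have d: "((\<lambda>x. flat m (g x)) has_derivative (\<lambda>h. ((flat (m + 2) (g x) - real m * flat (m + 1) (g x)) *\<^sub>R grad g x) \<bullet> h)) (at x)" for x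
    using has_derivative_compose[OF has_derivative_grad[OF dg] flat_has_derivative[unfolded has_field_derivative_def]]
    by simp
  have "grad (\<lambda>x. flat m (g x)) x = (flat (m + 2) (g x) - real m * flat (m + 1) (g x)) *\<^sub>R grad g x" for x
    by (rule grad_eqI[OF d])
  moreover have "(\<lambda>x. flat m (g x)) differentiable (at x)" for x using d differentiable_def by blast
  moreover have "Ck k (\<lambda>x. grad g x $ l)" for l using g[of "Suc k"] by simp
  ultimately show ?case using Suc by (auto intro!: Ck_mult Ck_diff Ck_const)
qed

text \<open>The parameter m sets the steepness in each direction: for m tending to infinity the functions increase to the indicator of
the box, and m_k = 1/w_k^2 on a box of half-widths w_k makes the profile independent of w.\<close>
definition box_bump :: "real ^ 'n \<Rightarrow> real ^ 'n \<Rightarrow> real ^ 'n \<Rightarrow> real ^ 'n \<Rightarrow> real" where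
  "box_bump m a b x = (\<Prod>k\<in>UNIV. flat 0 (m $ k * ((x $ k - a $ k) * (b $ k - x $ k))))"

lemma Ck_box_bump: "Ck k (box_bump m a b)"
proof -
  have "Ck k (\<lambda>x. \<Prod>l\<in>UNIV. flat 0 (m $ l * ((x $ l - a $ l) * (b $ l - x $ l))))"
    by (intro Ck_prod Ck_flat Ck_mult Ck_diff Ck_const Ck_nth)
  then show ?thesis by (simp add: box_bump_def[abs_def])
qed

lemma box_bump_nonneg: "0 \<le> box_bump m a b x"
  by (simp add: box_bump_def prod_nonneg flat_nonneg)

lemma box_bump_le_1: "box_bump m a b x \<le> 1"
  unfolding box_bump_def by (rule prod_le_1) (auto simp: flat_nonneg flat_0_le_1)

lemma box_bump_eq_0:
  assumes m: "\<And>k. 0 < m $ k" and ab: "\<And>k. a $ k \<le> b $ k" and x: "x \<notin> box a b"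
  shows "box_bump m a b x = 0"
proof -
  obtain k where k: "\<not> (a $ k < x $ k \<and> x $ k < b $ k)" using x by (auto simp: mem_box_cart)
  have "(x $ k - a $ k) * (b $ k - x $ k) \<le> 0"
    using k ab[of k] by (auto simp: mult_le_0_iff)
  then have "m $ k * ((x $ k - a $ k) * (b $ k - x $ k)) \<le> 0" using m[of k] by (simp add: mult_le_0_iff)
  then have "flat 0 (m $ k * ((x $ k - a $ k) * (b $ k - x $ k))) = 0" by (simp add: flat_def)
  then show ?thesis unfolding box_bump_def by (auto intro!: prod_zero)
qed

lemma box_bump_in_test_functions:
  assumes m: "\<And>k. 0 < m $ k" and ab: "\<And>k. a $ k \<le> b $ k" and sub: "cbox a b \<subseteq> \<Omega>"
  shows "box_bump m a b \<in> test_functions \<Omega>"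
proof -
  have "{x. box_bump m a b x \<noteq> 0} \<subseteq> cbox a b"
    using box_bump_eq_0[OF m ab] box_subset_cbox by blast
  then have c: "closure {x. box_bump m a b x \<noteq> 0} \<subseteq> cbox a b" by (rule closure_minimal) (rule closed_cbox)
  moreover have "compact (closure {x. box_bump m a b x \<noteq> 0})"
    using c by (meson bounded_cbox bounded_subset closed_closure compact_eq_bounded_closed)
  ultimately show ?thesis using sub by (auto simp: test_functions_def Ck_box_bump)
qed

text \<open>One factor is differentiated, the others are at most 1.\<close>
lemma abs_grad_box_bump_le:
  assumes m: "\<And>k. 0 < m $ k" and x: "x \<in> box a b"
  shows "\<bar>grad (box_bump m a b) x $ k\<bar> \<le> 4 * (m $ k * (b $ k - a $ k))"
proof -
  define P where "P = (\<Prod>l\<in>UNIV - {k}. flat 0 (m $ l * ((x $ l - a $ l) * (b $ l - x $ l))))"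
  have P: "0 \<le> P" "P \<le> 1"
    unfolding P_def by (auto intro!: prod_nonneg prod_le_1 simp: flat_nonneg flat_0_le_1)
  define w where "w s = m $ k * ((x $ k + s - a $ k) * (b $ k - (x $ k + s)))" for s
  have eq: "box_bump m a b (x + s *\<^sub>R axis k 1) = flat 0 (w s) * P" for s
    unfolding box_bump_def P_def w_def by (subst prod.remove[of UNIV k]) (auto intro!: prod.cong simp: axis_def)
  have "(w has_real_derivative m $ k * (a $ k + b $ k - 2 * x $ k)) (at 0)"
    unfolding w_def by (auto intro!: derivative_eq_intros simp: algebra_simps)
  from DERIV_chain2[OF flat_has_derivative this, of 0]
  have d: "((\<lambda>s. flat 0 (w s) * P) has_real_derivative flat 2 (w 0) * (m $ k * (a $ k + b $ k - 2 * x $ k)) * P) (at 0)"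
    by (auto intro!: DERIV_cmult_right simp: numeral_2_eq_2)
  have diff: "box_bump m a b differentiable (at x)" for x using Ck_box_bump[of "Suc 0" m a b] by simp
  have "((\<lambda>s. box_bump m a b (x + s *\<^sub>R axis k 1)) has_real_derivative grad (box_bump m a b) x $ k) (at 0)"
    using has_derivative_grad_line[of "box_bump m a b" x 0 "axis k 1"] diff by (simp add: inner_axis)
  with d have "grad (box_bump m a b) x $ k = flat 2 (w 0) * (m $ k * (a $ k + b $ k - 2 * x $ k)) * P"
    unfolding eq by (rule DERIV_unique[rotated])
  also have "\<bar>\<dots>\<bar> = flat 2 (w 0) * (m $ k * \<bar>a $ k + b $ k - 2 * x $ k\<bar>) * P"
    using P m[of k] flat_nonneg[of 2 "w 0"] by (simp add: abs_mult)
  also have "\<dots> \<le> 4 * (m $ k * (b $ k - a $ k)) * 1"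
  proof -
    have "a $ k < x $ k" "x $ k < b $ k" using x by (auto simp: mem_box_cart)
    then have "\<bar>a $ k + b $ k - 2 * x $ k\<bar> \<le> b $ k - a $ k" by auto
    then show ?thesis using P m[of k] flat_2_le[of "w 0"] flat_nonneg[of 2 "w 0"]
      by (intro mult_mono mult_left_mono) (auto intro!: mult_nonneg_nonneg)
  qed
  finally show ?thesis by simp
qed

lemma test_function_smooth:
  assumes "\<phi> \<in> test_functions \<Omega>"
  shows "\<phi> differentiable (at x)" "continuous_on UNIV \<phi>" "continuous_on UNIV (grad \<phi>)"
proof -
  have C: "Ck k \<phi>" for k using assms by (simp add: test_functions_def)
  show "\<phi> differentiable (at x)" using C[of "Suc 0"] by simp
  show "continuous_on UNIV \<phi>" using C[of 0] by simp
  have "continuous_on UNIV (\<lambda>x. \<chi> i. grad \<phi> x $ i)"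
    using C[of "Suc 0"] by (intro continuous_on_vec_lambda) simp
  then show "continuous_on UNIV (grad \<phi>)" by (simp add: vec_lambda_eta)
qed

lemma test_function_support:
  assumes "\<phi> \<in> test_functions \<Omega>"
  shows "\<exists>K. compact K \<and> K \<subseteq> \<Omega> \<and> (\<forall>x. x \<notin> K \<longrightarrow> \<phi> x = 0 \<and> grad \<phi> x = 0)"
proof -
  define K where "K = closure {x. \<phi> x \<noteq> 0}"
  have K: "compact K" "K \<subseteq> \<Omega>" using assms by (simp_all add: test_functions_def K_def)
  have z: "\<phi> x = 0" if "x \<notin> K" for x
    using that closure_subset[of "{x. \<phi> x \<noteq> 0}"] by (auto simp: K_def)
  have "grad \<phi> x = 0" if x: "x \<notin> K" for x
  proof (rule grad_eqI)
    have "open (- K)" using compact_imp_closed[OF K(1)] by auto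
    then have "(\<phi> has_derivative (\<lambda>h. 0)) (at x)"
      by (rule has_derivative_transform_within_open[of "\<lambda>_. 0", rotated]) (use x z in auto)
    then show "(\<phi> has_derivative (\<lambda>h. 0 \<bullet> h)) (at x)" by simp
  qed
  then show ?thesis using K z by blast
qed

section \<open>Weak gradients\<close>

lemma lebesgue_on_eq_lborel:
  fixes f :: "'a::euclidean_space \<Rightarrow> 'b::euclidean_space"
  assumes \<Omega>: "\<Omega> \<in> sets lebesgue" and [measurable]: "f \<in> borel_measurable borel" and z: "\<And>x. x \<notin> \<Omega> \<Longrightarrow> f x = 0"
  shows "integrable (lebesgue_on \<Omega>) f \<longleftrightarrow> integrable lborel f" "(LINT x|lebesgue_on \<Omega>. f x) = (LINT x|lborel. f x)"
proof -
  have e: "(\<lambda>x. indicator \<Omega> x *\<^sub>R f x) = f" using z by (auto simp: fun_eq_iff indicator_def)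
  show "integrable (lebesgue_on \<Omega>) f \<longleftrightarrow> integrable lborel f"
    using \<Omega> by (subst integrable_restrict_space) (simp_all add: e integrable_completion)
  show "(LINT x|lebesgue_on \<Omega>. f x) = (LINT x|lborel. f x)"
    using \<Omega> by (subst integral_restrict_space) (simp_all add: e integral_completion)
qed

lemma integrable_test_function_mult:
  fixes \<phi> :: "'a::euclidean_space \<Rightarrow> real" and g :: "'a \<Rightarrow> 'b::euclidean_space"
  assumes \<Omega>: "\<Omega> \<in> sets lebesgue" and K: "compact K" "K \<subseteq> \<Omega>" and g: "g absolutely_integrable_on K"
    and \<phi>: "continuous_on UNIV \<phi>" and z: "\<And>x. x \<notin> K \<Longrightarrow> \<phi> x = 0"
  shows "integrable (lebesgue_on \<Omega>) (\<lambda>x. \<phi> x *\<^sub>R g x)"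
proof -
  have [measurable]: "\<phi> \<in> borel_measurable borel" by (rule borel_measurable_continuous_onI[OF \<phi>])
  obtain B where B: "0 \<le> B" "\<And>x. \<bar>\<phi> x\<bar> \<le> B" using bounded_of_compact_support[OF K(1) \<phi> z] by blast
  have i: "integrable lebesgue (\<lambda>x. indicator K x *\<^sub>R g x)" using g by (simp add: set_integrable_def)
  have "integrable lebesgue (\<lambda>x. \<phi> x *\<^sub>R (indicator K x *\<^sub>R g x))"
  proof (rule Bochner_Integration.integrable_bound)
    show "integrable lebesgue (\<lambda>x. B *\<^sub>R (indicator K x *\<^sub>R g x))" using i by (rule integrable_scaleR_right)
    show "(\<lambda>x. \<phi> x *\<^sub>R (indicator K x *\<^sub>R g x)) \<in> borel_measurable lebesgue"
      by (intro borel_measurable_scaleR borel_measurable_integrable[OF i] measurable_completion) simp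
    show "AE x in lebesgue. norm (\<phi> x *\<^sub>R (indicator K x *\<^sub>R g x)) \<le> norm (B *\<^sub>R (indicator K x *\<^sub>R g x))"
      using B by (intro AE_I2) (auto simp: indicator_def intro!: mult_right_mono)
  qed
  moreover have "(\<lambda>x. \<phi> x *\<^sub>R (indicator K x *\<^sub>R g x)) = (\<lambda>x. indicator \<Omega> x *\<^sub>R (\<phi> x *\<^sub>R g x))"
    using z K(2) by (auto simp: indicator_def fun_eq_iff)
  ultimately have "integrable lebesgue (\<lambda>x. indicator \<Omega> x *\<^sub>R (\<phi> x *\<^sub>R g x))" by (simp only:)
  then show ?thesis by (rule integrable_restrict_space[THEN iffD2, rotated]) (use \<Omega> in simp)
qed

lemma integral_grad_eq_0:
  fixes f :: "real ^ 'n \<Rightarrow> real"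
  assumes K: "compact K" and z: "\<And>x. x \<notin> K \<Longrightarrow> f x = 0" "\<And>x. x \<notin> K \<Longrightarrow> grad f x = 0"
    and d: "\<And>x. f differentiable (at x)" and c: "continuous_on UNIV (grad f)"
  shows "(LINT x|lborel. grad f x) = 0"
proof -
  have i: "integrable lborel (grad f)" by (rule integrable_lborel_of_compact_support[OF K c z(2)])
  have "(LINT x|lborel. grad f x) $ k = 0" for k
  proof -
    have "(LINT x|lborel. grad f x) $ k = (LINT x|lborel. grad f x) \<bullet> axis k 1" by (simp add: inner_axis)
    also have "\<dots> = (LINT x|lborel. grad f x \<bullet> axis k 1)"
      by (rule integral_inner_left[symmetric]) (use i in simp)
    also have "\<dots> = 0"
    proof (rule integral_directional_derivative_eq_0[OF K])
      show "continuous_on UNIV f"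
        using d by (intro continuous_at_imp_continuous_on ballI differentiable_imp_continuous_within)
      show "continuous_on UNIV (\<lambda>x. grad f x \<bullet> axis k 1)" by (intro continuous_intros c)
      show "((\<lambda>s. f (x + s *\<^sub>R axis k 1)) has_real_derivative grad f (x + s *\<^sub>R axis k 1) \<bullet> axis k 1) (at s)" for x s
        by (rule has_derivative_grad_line[OF d])
    qed (simp_all add: z)
    finally show ?thesis .
  qed
  then show ?thesis by (simp add: vec_eq_iff)
qed

lemma absolutely_integrable_on_compact:
  fixes f :: "'a::euclidean_space \<Rightarrow> 'b::euclidean_space"
  assumes "compact K" "continuous_on K f"
  shows "f absolutely_integrable_on K"
  using borel_integrable_compact[OF assms] borel_measurable_integrable[OF borel_integrable_compact[OF assms]]
  by (simp add: set_integrable_def integrable_completion)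

text \<open>Integration by parts: the gradient of the product of two test functions has integral 0.\<close>
lemma has_weak_grad_test_function:
  fixes \<phi> :: "real ^ 'n \<Rightarrow> real"
  assumes \<phi>: "\<phi> \<in> test_functions \<Omega>" and \<Omega>: "\<Omega> \<in> sets lebesgue"
  shows "has_weak_grad \<Omega> \<phi> (grad \<phi>)"
proof -
  obtain K where Ks: "compact K" "K \<subseteq> \<Omega>" "\<And>x. x \<notin> K \<Longrightarrow> \<phi> x = 0" "\<And>x. x \<notin> K \<Longrightarrow> grad \<phi> x = 0"
    using test_function_support[OF \<phi>] by blast
  note K = Ks test_function_smooth[OF \<phi>]
  have 1: "locally_integrable \<Omega> \<phi>" "locally_integrable \<Omega> (grad \<phi>)"
    unfolding locally_integrable_def
    by (auto intro!: absolutely_integrable_on_compact continuous_on_subset[OF K(6)] continuous_on_subset[OF K(7)])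
  moreover have "(LINT x|lebesgue_on \<Omega>. \<phi> x *\<^sub>R grad \<psi> x) = - (LINT x|lebesgue_on \<Omega>. \<psi> x *\<^sub>R grad \<phi> x)"
    if \<psi>: "\<psi> \<in> test_functions \<Omega>" for \<psi>
  proof -
    obtain L where Ls: "compact L" "L \<subseteq> \<Omega>" "\<And>x. x \<notin> L \<Longrightarrow> \<psi> x = 0" "\<And>x. x \<notin> L \<Longrightarrow> grad \<psi> x = 0"
    using test_function_support[OF \<psi>] by blast
  note L = Ls test_function_smooth[OF \<psi>]
    have d: "((\<lambda>x. \<phi> x * \<psi> x) has_derivative (\<lambda>h. (\<phi> x *\<^sub>R grad \<psi> x + \<psi> x *\<^sub>R grad \<phi> x) \<bullet> h)) (at x)" for x
      by (auto intro!: derivative_eq_intros has_derivative_grad K(5) L(5) simp: inner_add_left)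
    have g: "grad (\<lambda>x. \<phi> x * \<psi> x) = (\<lambda>x. \<phi> x *\<^sub>R grad \<psi> x + \<psi> x *\<^sub>R grad \<phi> x)"
      using grad_eqI[OF d] by blast
    have c1: "continuous_on UNIV (\<lambda>x. \<phi> x *\<^sub>R grad \<psi> x)" and c2: "continuous_on UNIV (\<lambda>x. \<psi> x *\<^sub>R grad \<phi> x)"
      by (intro continuous_intros K L)+
    have i1: "integrable lborel (\<lambda>x. \<phi> x *\<^sub>R grad \<psi> x)"
      by (rule integrable_lborel_of_compact_support[OF K(1) c1]) (simp add: K)
    have i2: "integrable lborel (\<lambda>x. \<psi> x *\<^sub>R grad \<phi> x)"
      by (rule integrable_lborel_of_compact_support[OF K(1) c2]) (simp add: K)
    have "(LINT x|lborel. grad (\<lambda>x. \<phi> x * \<psi> x) x) = 0"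
    proof (rule integral_grad_eq_0[OF K(1)])
      show "(\<lambda>x. \<phi> x * \<psi> x) differentiable (at x)" for x using d differentiable_def by blast
      show "continuous_on UNIV (grad (\<lambda>x. \<phi> x * \<psi> x))" unfolding g by (intro continuous_intros c1 c2)
    qed (simp_all add: K g)
    then have "(LINT x|lborel. \<phi> x *\<^sub>R grad \<psi> x) = - (LINT x|lborel. \<psi> x *\<^sub>R grad \<phi> x)"
      using i1 i2 by (simp add: g eq_neg_iff_add_eq_0)
    moreover have "(LINT x|lebesgue_on \<Omega>. \<phi> x *\<^sub>R grad \<psi> x) = (LINT x|lborel. \<phi> x *\<^sub>R grad \<psi> x)"
      using K(2,3) by (intro lebesgue_on_eq_lborel \<Omega> borel_measurable_continuous_onI c1) auto
    moreover have "(LINT x|lebesgue_on \<Omega>. \<psi> x *\<^sub>R grad \<phi> x) = (LINT x|lborel. \<psi> x *\<^sub>R grad \<phi> x)"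
      using K(2,4) by (intro lebesgue_on_eq_lborel \<Omega> borel_measurable_continuous_onI c2) auto
    ultimately show ?thesis by simp
  qed
  ultimately show ?thesis by (simp add: has_weak_grad_def)
qed

text \<open>The bumps converge to the indicator of the open box and are dominated by it.\<close>
lemma integral_cbox_eq_0:
  fixes d :: "real ^ 'n \<Rightarrow> real ^ 'n"
  assumes \<Omega>: "\<Omega> \<in> sets lebesgue" and li: "locally_integrable \<Omega> d"
    and z: "\<And>\<phi>. \<phi> \<in> test_functions \<Omega> \<Longrightarrow> (LINT x|lebesgue_on \<Omega>. \<phi> x *\<^sub>R d x) = 0"
    and sub: "cbox a b \<subseteq> \<Omega>" and ab: "\<And>k. a $ k \<le> b $ k"
  shows "integral (cbox a b) d = 0"
proof -
  define \<phi> where "\<phi> n = box_bump (\<chi> k. real (Suc n)) a b" for n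
  have \<phi>: "\<phi> n \<in> test_functions \<Omega>" for n
    unfolding \<phi>_def by (rule box_bump_in_test_functions[OF _ ab sub]) simp
  have \<phi>0: "\<phi> n x = 0" if "x \<notin> box a b" for n x
    unfolding \<phi>_def by (rule box_bump_eq_0[OF _ ab that]) simp
  have dK: "d absolutely_integrable_on cbox a b" using li sub by (simp add: locally_integrable_def)
  have i: "integrable lebesgue (\<lambda>x. indicator (cbox a b) x *\<^sub>R d x)" using dK by (simp add: set_integrable_def)
  have [measurable]: "\<phi> n \<in> borel_measurable borel" for n
  proof -
    have "continuous_on UNIV (\<phi> n)" using Ck_box_bump[of 0] by (simp add: \<phi>_def)
    then show ?thesis by (rule borel_measurable_continuous_onI)
  qed
  have lim: "(\<lambda>n. LINT x|lebesgue. \<phi> n x *\<^sub>R (indicator (cbox a b) x *\<^sub>R d x)) \<longlonglongrightarrow> (LINT x|lebesgue. indicator (box a b) x *\<^sub>R d x)"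
  proof (rule integral_dominated_convergence[where w = "\<lambda>x. norm (indicator (cbox a b) x *\<^sub>R d x)"])
    have "(\<lambda>x. indicator (box a b) x *\<^sub>R (indicator (cbox a b) x *\<^sub>R d x)) \<in> borel_measurable lebesgue"
      by (intro borel_measurable_scaleR[OF borel_measurable_indicator borel_measurable_integrable[OF i]]) simp
    also have "(\<lambda>x. indicator (box a b) x *\<^sub>R (indicator (cbox a b) x *\<^sub>R d x)) = (\<lambda>x. indicator (box a b) x *\<^sub>R d x)"
      using box_subset_cbox[of a b] by (auto simp: fun_eq_iff indicator_def)
    finally show "(\<lambda>x. indicator (box a b) x *\<^sub>R d x) \<in> borel_measurable lebesgue" .
    show "(\<lambda>x. \<phi> n x *\<^sub>R (indicator (cbox a b) x *\<^sub>R d x)) \<in> borel_measurable lebesgue" for n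
      by (intro borel_measurable_scaleR borel_measurable_integrable[OF i] measurable_completion) simp
    show "integrable lebesgue (\<lambda>x. norm (indicator (cbox a b) x *\<^sub>R d x))" using i by (rule integrable_norm)
    show "AE x in lebesgue. norm (\<phi> n x *\<^sub>R (indicator (cbox a b) x *\<^sub>R d x)) \<le> norm (indicator (cbox a b) x *\<^sub>R d x)" for n
      using box_bump_nonneg[of "\<chi> k. real (Suc n)" a b] box_bump_le_1[of "\<chi> k. real (Suc n)" a b]
      by (intro AE_I2) (auto simp: \<phi>_def indicator_def mult_left_le_one_le)
    show "AE x in lebesgue. (\<lambda>n. \<phi> n x *\<^sub>R (indicator (cbox a b) x *\<^sub>R d x)) \<longlonglongrightarrow> indicator (box a b) x *\<^sub>R d x"
    proof (rule AE_I2)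
      fix x
      show "(\<lambda>n. \<phi> n x *\<^sub>R (indicator (cbox a b) x *\<^sub>R d x)) \<longlonglongrightarrow> indicator (box a b) x *\<^sub>R d x"
      proof (cases "x \<in> box a b")
        case True
        have "(\<lambda>n. flat 0 (real (Suc n) * ((x $ k - a $ k) * (b $ k - x $ k)))) \<longlonglongrightarrow> 1" for k
        proof -
          define c where "c = (x $ k - a $ k) * (b $ k - x $ k)"
          have c: "0 < c" using True by (simp add: c_def mem_box_cart)
          have "(\<lambda>n. exp (- (inverse c * inverse (real (Suc n))))) \<longlonglongrightarrow> exp (- (inverse c * 0))"
            by (intro tendsto_intros LIMSEQ_inverse_real_of_nat)
          moreover have "flat 0 (real (Suc n) * c) = exp (- (inverse c * inverse (real (Suc n))))" for n
            using c by (simp add: flat_def mult_le_0_iff)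
          ultimately show ?thesis by (simp add: c_def)
        qed
        then have "(\<lambda>n. \<Prod>k\<in>UNIV. flat 0 (real (Suc n) * ((x $ k - a $ k) * (b $ k - x $ k)))) \<longlonglongrightarrow> (\<Prod>k\<in>(UNIV::'n set). 1)"
          by (intro tendsto_prod)
        then have "(\<lambda>n. \<phi> n x) \<longlonglongrightarrow> 1" by (simp add: \<phi>_def box_bump_def)
        from tendsto_scaleR[OF this tendsto_const[of "d x"]] show ?thesis
          using True box_subset_cbox[of a b] by (auto simp: indicator_def)
      qed (simp add: \<phi>0)
    qed
  qed
  have "(LINT x|lebesgue. \<phi> n x *\<^sub>R (indicator (cbox a b) x *\<^sub>R d x)) = 0" for n
  proof -
    have "(LINT x|lebesgue. \<phi> n x *\<^sub>R (indicator (cbox a b) x *\<^sub>R d x)) = (LINT x|lebesgue. indicator \<Omega> x *\<^sub>R (\<phi> n x *\<^sub>R d x))"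
      using \<phi>0 sub box_subset_cbox[of a b] by (intro Bochner_Integration.integral_cong) (auto simp: indicator_def)
    also have "\<dots> = 0" using z[OF \<phi>[of n]] \<Omega> by (subst (asm) integral_restrict_space) auto
    finally show ?thesis .
  qed
  with lim have "(LINT x|lebesgue. indicator (box a b) x *\<^sub>R d x) = 0" by (simp add: LIMSEQ_const_iff)
  moreover have "d absolutely_integrable_on box a b"
    by (rule set_integrable_subset[OF dK]) (auto simp: box_subset_cbox)
  ultimately have "integral (box a b) d = 0"
    using set_lebesgue_integral_eq_integral(2)[of "box a b" d] by (simp add: set_lebesgue_integral_def)
  then show ?thesis by (simp add: integral_open_interval)
qed

text \<open>The fundamental lemma of the calculus of variations: the integrals over all small cubes vanish, and almost every
point is a Lebesgue point with respect to the cubes having it as a corner.\<close>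
lemma AE_eq_0_of_test_functions:
  fixes d :: "real ^ 'n \<Rightarrow> real ^ 'n"
  assumes \<Omega>: "open \<Omega>" and li: "locally_integrable \<Omega> d"
    and z: "\<And>\<phi>. \<phi> \<in> test_functions \<Omega> \<Longrightarrow> (LINT x|lebesgue_on \<Omega>. \<phi> x *\<^sub>R d x) = 0"
  shows "AE x in lebesgue_on \<Omega>. d x = 0"
proof -
  have \<Omega>l: "\<Omega> \<in> sets lebesgue" using \<Omega> by simp
  have neg: "negligible {x \<in> box a b. d x \<noteq> 0}" if sub: "cbox a b \<subseteq> \<Omega>" for a b
  proof -
    define f where "f x = (if x \<in> cbox a b then d x else 0)" for x
    have "d absolutely_integrable_on cbox a b" using li sub by (simp add: locally_integrable_def)
    then have "d integrable_on cbox a b" by (rule absolutely_integrable_on_def[THEN iffD1, THEN conjunct1])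
    then have "f integrable_on UNIV" unfolding f_def by (simp add: integrable_restrict_UNIV)
    then have fi: "f integrable_on cbox u v" for u v by (rule integrable_on_subcbox) simp
    define e1 :: "real ^ 'n" where "e1 = One"
    have one: "e1 $ k = 1" for k
    proof -
      have "e1 $ k = e1 \<bullet> axis k 1" by (rule cart_eq_inner_axis)
      also have "\<dots> = 1"
        using inner_sum_left_Basis[of "axis k 1 :: real ^ 'n" "\<lambda>_. 1"] by (simp add: e1_def axis_in_Basis_iff)
      finally show ?thesis .
    qed
    obtain N where N: "negligible N" "\<And>x e. x \<notin> N \<Longrightarrow> 0 < e \<Longrightarrow>
        \<exists>s>0. \<forall>h. 0 < h \<and> h < s \<longrightarrow> norm (integral (cbox x (x + h *\<^sub>R e1)) f /\<^sub>R h ^ DIM(real ^ 'n) - f x) < e"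
      using integrable_ccontinuous_explicit[OF fi] unfolding e1_def by blast
    have "d x = 0" if x: "x \<in> box a b" "x \<notin> N" for x
    proof (rule ccontr)
      assume "d x \<noteq> 0"
      then obtain s where s: "0 < s" "\<And>h. 0 < h \<Longrightarrow> h < s \<Longrightarrow> norm (integral (cbox x (x + h *\<^sub>R e1)) f /\<^sub>R h ^ DIM(real ^ 'n) - f x) < norm (d x)"
        using N(2)[OF x(2), of "norm (d x)"] by auto
      \<comment> \<open>A side length for which the cube at x stays in the box.\<close>
      define h where "h = Min (insert (s / 2) (range (\<lambda>k. b $ k - x $ k)))"
      have "h \<in> insert (s / 2) (range (\<lambda>k. b $ k - x $ k))" unfolding h_def by (rule Min_in) auto
      then have "0 < h" using x(1) s(1) by (auto simp: mem_box_cart)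
      moreover have "h \<le> s / 2" "\<And>k. h \<le> b $ k - x $ k"
        unfolding h_def by (rule Min_le; simp)+
      ultimately have h: "h \<le> s / 2" "\<And>k. h \<le> b $ k - x $ k" "0 < h" by auto
      have hc: "cbox x (x + h *\<^sub>R e1) \<subseteq> cbox a b"
      proof
        fix y assume "y \<in> cbox x (x + h *\<^sub>R e1)"
        then have y: "x $ k \<le> y $ k" "y $ k \<le> x $ k + h" for k by (simp_all add: mem_box_cart one)
        have "a $ k \<le> y $ k \<and> y $ k \<le> b $ k" for k
          using y[of k] h(2)[of k] x(1) by (simp add: mem_box_cart) (smt (verit))
        then show "y \<in> cbox a b" by (simp add: mem_box_cart)
      qed
      have "integral (cbox x (x + h *\<^sub>R e1)) f = integral (cbox x (x + h *\<^sub>R e1)) d"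
        using hc by (intro integral_cong) (auto simp: f_def)
      also have "\<dots> = 0"
        using hc sub h(3) by (intro integral_cbox_eq_0[OF \<Omega>l li z]) (auto simp: one)
      finally have "norm (f x) < norm (d x)" using s(2)[of h] h(1,3) s(1) by simp
      then show False using x(1) box_subset_cbox[of a b] by (auto simp: f_def)
    qed
    then have "{x \<in> box a b. d x \<noteq> 0} \<subseteq> N" by blast
    then show ?thesis using N(1) by (rule negligible_subset[rotated])
  qed
  obtain \<D> where D: "countable \<D>" "\<D> \<subseteq> Pow \<Omega>" "\<And>X. X \<in> \<D> \<Longrightarrow> \<exists>a b. X = cbox a b" "\<Union>\<D> = \<Omega>"
    using open_countable_Union_open_cbox[OF \<Omega>] by metis
  have "negligible {x \<in> X. d x \<noteq> 0}" if X: "X \<in> \<D>" for X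
  proof -
    obtain a b where ab: "X = cbox a b" using D(3)[OF X] by blast
    have "{x \<in> X. d x \<noteq> 0} \<subseteq> {x \<in> box a b. d x \<noteq> 0} \<union> (cbox a b - box a b)" unfolding ab by blast
    moreover have "negligible \<dots>"
      using D(2) X ab by (intro negligible_Un neg negligible_frontier_interval) auto
    ultimately show ?thesis by (rule negligible_subset[rotated])
  qed
  then have "negligible (\<Union>X\<in>\<D>. {x \<in> X. d x \<noteq> 0})"
    by (intro negligible_countable_Union) (use D(1) in auto)
  moreover have "(\<Union>X\<in>\<D>. {x \<in> X. d x \<noteq> 0}) = {x \<in> \<Omega>. d x \<noteq> 0}" using D(4) by auto
  ultimately have "{x \<in> \<Omega>. d x \<noteq> 0} \<in> null_sets lebesgue" by (simp add: negligible_iff_null_sets)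
  then have "AE x in lebesgue. x \<notin> {x \<in> \<Omega>. d x \<noteq> 0}" by (rule AE_not_in)
  then show ?thesis using \<Omega>l by (subst AE_restrict_space_iff) auto
qed

lemma has_weak_grad_diff:
  assumes \<Omega>: "\<Omega> \<in> sets lebesgue" and u: "has_weak_grad \<Omega> u g" and v: "has_weak_grad \<Omega> v h"
  shows "has_weak_grad \<Omega> (\<lambda>x. u x - v x) (\<lambda>x. g x - h x)"
  unfolding has_weak_grad_def
proof (intro conjI ballI)
  show "locally_integrable \<Omega> (\<lambda>x. u x - v x)" "locally_integrable \<Omega> (\<lambda>x. g x - h x)"
    using u v by (auto simp: has_weak_grad_def locally_integrable_def)
  fix \<phi> assume \<phi>: "\<phi> \<in> test_functions \<Omega>"
  obtain K where Ks: "compact K" "K \<subseteq> \<Omega>" "\<And>x. x \<notin> K \<Longrightarrow> \<phi> x = 0" "\<And>x. x \<notin> K \<Longrightarrow> grad \<phi> x = 0"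
    using test_function_support[OF \<phi>] by blast
  note K = Ks test_function_smooth[OF \<phi>]
  have gi: "integrable (lebesgue_on \<Omega>) (\<lambda>x. \<phi> x *\<^sub>R g x)" if "locally_integrable \<Omega> g" for g :: "real ^ 'a \<Rightarrow> real ^ 'a"
    using that K by (intro integrable_test_function_mult[OF \<Omega> K(1,2)]) (auto simp: locally_integrable_def)
  have ui: "integrable (lebesgue_on \<Omega>) (\<lambda>x. u x *\<^sub>R grad \<phi> x)" if "locally_integrable \<Omega> u" for u :: "real ^ 'a \<Rightarrow> real"
  proof -
    have "integrable (lebesgue_on \<Omega>) (\<lambda>x. (grad \<phi> x $ k) *\<^sub>R u x)" for k
      using that K by (intro integrable_test_function_mult[OF \<Omega> K(1,2)]) (auto simp: locally_integrable_def intro!: continuous_intros)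
    then have "integrable (lebesgue_on \<Omega>) (\<lambda>x. \<Sum>k\<in>UNIV. ((grad \<phi> x $ k) *\<^sub>R u x) *\<^sub>R axis k (1::real))"
      by (intro Bochner_Integration.integrable_sum integrable_scaleR_left) auto
    moreover have "(\<Sum>k\<in>UNIV. ((grad \<phi> x $ k) *\<^sub>R u x) *\<^sub>R axis k (1::real)) = u x *\<^sub>R grad \<phi> x" for x
      by (simp add: vec_eq_iff axis_def if_distrib sum.delta mult.commute cong: if_cong)
    ultimately show ?thesis by simp
  qed
  have l: "locally_integrable \<Omega> u" "locally_integrable \<Omega> v" "locally_integrable \<Omega> g" "locally_integrable \<Omega> h"
    using u v by (auto simp: has_weak_grad_def)
  show "(LINT x|lebesgue_on \<Omega>. (u x - v x) *\<^sub>R grad \<phi> x) = - (LINT x|lebesgue_on \<Omega>. \<phi> x *\<^sub>R (g x - h x))"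
    using u v \<phi> ui[OF l(1)] ui[OF l(2)] gi[OF l(3)] gi[OF l(4)]
    by (simp add: has_weak_grad_def scaleR_diff_left scaleR_diff_right)
qed

lemma has_weak_grad_unique:
  assumes \<Omega>: "open \<Omega>" and g: "has_weak_grad \<Omega> u g" and h: "has_weak_grad \<Omega> u h"
  shows "AE x in lebesgue_on \<Omega>. g x = h x"
proof -
  have d: "has_weak_grad \<Omega> (\<lambda>x. u x - u x) (\<lambda>x. g x - h x)"
    using \<Omega> g h by (intro has_weak_grad_diff) auto
  have "AE x in lebesgue_on \<Omega>. g x - h x = 0"
  proof (rule AE_eq_0_of_test_functions[OF \<Omega>])
    show "locally_integrable \<Omega> (\<lambda>x. g x - h x)" using d by (simp add: has_weak_grad_def)
    show "(LINT x|lebesgue_on \<Omega>. \<phi> x *\<^sub>R (g x - h x)) = 0" if "\<phi> \<in> test_functions \<Omega>" for \<phi>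
      using d that by (auto simp: has_weak_grad_def)
  qed
  then show ?thesis by simp
qed

lemma weak_grad_AE_eq:
  assumes "open \<Omega>" "has_weak_grad \<Omega> u g"
  shows "AE x in lebesgue_on \<Omega>. weak_grad \<Omega> u x = g x"
proof -
  have "has_weak_grad \<Omega> u (weak_grad \<Omega> u)" unfolding weak_grad_def
    by (rule someI[of "has_weak_grad \<Omega> u", OF assms(2)])
  then show ?thesis using assms by (intro has_weak_grad_unique)
qed

section \<open>Calculus of powers and of curves\<close>

text \<open>A form for two real functions with upper bounds of the integrals, so that the bounds compose.\<close>
lemma nn_integral_Hoelder2:
  fixes f h :: "'a \<Rightarrow> real"
  assumes \<alpha>: "0 < \<alpha>" "0 < \<beta>" "\<alpha> + \<beta> = 1"
    and [measurable]: "f \<in> borel_measurable M" "h \<in> borel_measurable M"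
    and f0: "\<And>x. 0 \<le> f x" and h0: "\<And>x. 0 \<le> h x"
    and F: "(\<integral>\<^sup>+x. ennreal (f x) \<partial>M) \<le> ennreal F" "0 \<le> F"
    and H: "(\<integral>\<^sup>+x. ennreal (h x) \<partial>M) \<le> ennreal H" "0 \<le> H"
  shows "(\<integral>\<^sup>+x. ennreal (f x powr \<alpha> * h x powr \<beta>) \<partial>M) \<le> ennreal (F powr \<alpha> * H powr \<beta>)"
proof -
  define k where "k b x = ennreal (if b then f x else h x)" for b x
  define c where "c b = (if b then \<alpha> else \<beta>)" for b
  have [measurable]: "k b \<in> borel_measurable M" for b unfolding k_def by (cases b) simp_all
  have "(\<integral>\<^sup>+x. ennreal (f x powr \<alpha> * h x powr \<beta>) \<partial>M) = (\<integral>\<^sup>+x. (\<Prod>b\<in>UNIV. epowr (k b x) (c b)) \<partial>M)"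
    by (intro nn_integral_cong) (simp add: UNIV_bool k_def c_def f0 h0 ennreal_mult' mult.commute)
  also have "\<dots> \<le> (\<Prod>b\<in>UNIV. epowr (\<integral>\<^sup>+x. k b x \<partial>M) (c b))"
    using \<alpha> by (intro nn_integral_Hoelder) (auto simp: UNIV_bool c_def)
  also have "\<dots> = epowr (\<integral>\<^sup>+x. ennreal (h x) \<partial>M) \<beta> * epowr (\<integral>\<^sup>+x. ennreal (f x) \<partial>M) \<alpha>"
    by (simp add: UNIV_bool k_def c_def)
  also have "\<dots> \<le> epowr (ennreal H) \<beta> * epowr (ennreal F) \<alpha>"
    using \<alpha> F H by (intro mult_mono epowr_mono) auto
  also have "\<dots> = ennreal (F powr \<alpha> * H powr \<beta>)" using F H by (simp add: ennreal_mult' mult.commute)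
  finally show ?thesis .
qed

lemma has_real_derivative_abs_powr:
  fixes s :: real
  assumes "1 < \<gamma>"
  shows "((\<lambda>s. \<bar>s\<bar> powr \<gamma>) has_real_derivative \<gamma> * \<bar>s\<bar> powr (\<gamma> - 1) * sgn s) (at s)"
proof -
  consider "s > 0" | "s < 0" | "s = 0" by linarith
  then show ?thesis
  proof cases
    case 1
    have "((\<lambda>s. s powr \<gamma>) has_real_derivative \<gamma> * s powr (\<gamma> - 1)) (at s)"
      using 1 by (rule has_real_derivative_powr)
    then have "((\<lambda>s. \<bar>s\<bar> powr \<gamma>) has_real_derivative \<gamma> * s powr (\<gamma> - 1)) (at s)"
      by (rule has_field_derivative_transform_within_open[where S = "{0<..}"]) (use 1 in auto)
    then show ?thesis using 1 by simp
  next
    case 2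
    have "((\<lambda>s. (- s) powr \<gamma>) has_real_derivative \<gamma> * (- s) powr (\<gamma> - 1) * (- 1)) (at s)"
      using 2 by (intro DERIV_chain2[OF has_real_derivative_powr]) (auto intro!: derivative_eq_intros)
    then have "((\<lambda>s. \<bar>s\<bar> powr \<gamma>) has_real_derivative \<gamma> * (- s) powr (\<gamma> - 1) * (- 1)) (at s)"
      by (rule has_field_derivative_transform_within_open[where S = "{..<0}"]) (use 2 in auto)
    then show ?thesis using 2 by simp
  next
    case 3
    have "((\<lambda>h. \<bar>h\<bar> powr \<gamma> / h) \<longlongrightarrow> 0) (at 0)"
    proof (rule Lim_null_comparison)
      have "((\<lambda>h::real. \<bar>h\<bar> powr (\<gamma> - 1)) \<longlongrightarrow> \<bar>0\<bar> powr (\<gamma> - 1)) (at 0)"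
        using assms by (intro tendsto_powr2 tendsto_intros) auto
      then show "((\<lambda>h::real. \<bar>h\<bar> powr (\<gamma> - 1)) \<longlongrightarrow> 0) (at 0)" by simp
      show "eventually (\<lambda>h. norm (\<bar>h\<bar> powr \<gamma> / h) \<le> \<bar>h\<bar> powr (\<gamma> - 1)) (at 0)"
        by (rule always_eventually) (auto simp: powr_diff)
    qed
    then show ?thesis using 3 by (simp add: DERIV_def)
  qed
qed

lemma continuous_on_abs_powr: "continuous_on S (\<lambda>s::real. \<bar>s\<bar> powr a)" if "0 < a"
  using that by (intro continuous_on_powr' continuous_intros) auto

text \<open>Splitting into positive and negative part reduces this to the continuity of powers.\<close>
lemma continuous_on_abs_powr_sgn:
  assumes "0 < a"
  shows "continuous_on UNIV (\<lambda>s::real. \<bar>s\<bar> powr a * sgn s)"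
proof -
  \<comment> \<open>At s = 0 both sides vanish because 0 powr a = 0.\<close>
  have eq: "(\<lambda>s::real. \<bar>s\<bar> powr a * sgn s) = (\<lambda>s. \<bar>max s 0\<bar> powr a - \<bar>min s 0\<bar> powr a)"
    using assms by (auto simp: fun_eq_iff sgn_if max_def min_def)
  show ?thesis unfolding eq
    by (intro continuous_intros continuous_on_compose2[OF continuous_on_abs_powr[OF assms, of UNIV]]) auto
qed

lemma has_vector_derivative_vec:
  fixes f :: "real \<Rightarrow> real ^ 'n"
  assumes "\<And>l. ((\<lambda>s. f s $ l) has_real_derivative w $ l) (at s)"
  shows "(f has_vector_derivative w) (at s)"
proof -
  have "((\<lambda>x. f x \<bullet> b) has_derivative (\<lambda>h. (h *\<^sub>R w) \<bullet> b)) (at s)" if "b \<in> Basis" for b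
  proof -
    from that obtain k where b: "b = axis k 1" by (auto simp: Basis_vec_def)
    have "(*) (w $ k) = (\<lambda>h. h * w $ k)" by (auto simp: fun_eq_iff)
    then show ?thesis using assms[of k] by (simp add: b inner_axis has_field_derivative_def)
  qed
  then show ?thesis unfolding has_vector_derivative_def
    by (subst has_derivative_componentwise_within) auto
qed

section \<open>Hardy's inequality with the degenerate weight\<close>

text \<open>A continuously differentiable function u with gradient g, supported in a compact part of the ball. The gradient is a
parameter so that it need not be computed.\<close>
locale C1_in_ball =
  fixes u :: "real ^ 'n \<Rightarrow> real" and g :: "real ^ 'n \<Rightarrow> real ^ 'n" and K :: "(real ^ 'n) set" and i j :: 'n
  assumes ij: "i \<noteq> j" and K: "compact K" "K \<subseteq> ball 0 1"
    and u0: "\<And>x. x \<notin> K \<Longrightarrow> u x = 0" and g0: "\<And>x. x \<notin> K \<Longrightarrow> g x = 0"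
    and der: "\<And>x. (u has_derivative (\<lambda>h. g x \<bullet> h)) (at x)" and contg: "continuous_on UNIV g"
begin

text \<open>The eigenvalue of the energy form in the direction of rotation. It vanishes where r = 1.\<close>
definition gap :: "real ^ 'n \<Rightarrow> real" where
  "gap x = 1 - ((x $ i)\<^sup>2 + (x $ j)\<^sup>2)"
definition energy_density :: "real ^ 'n \<Rightarrow> real" where
  "energy_density x = ang_form i j x (g x)"

lemma gap_le_1: "gap x \<le> 1"
  unfolding gap_def using zero_le_power2[of "x $ i"] zero_le_power2[of "x $ j"] by linarith

lemma gap_pos: "0 < gap x" if "x \<in> ball 0 1"
proof -
  have "(norm x)\<^sup>2 < 1" using that by (simp add: power_less_one_iff)
  moreover have "(x $ i)\<^sup>2 + (x $ j)\<^sup>2 \<le> (norm x)\<^sup>2"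
    using norm_sq_split[OF ij, of x] by (simp add: sum_nonneg)
  ultimately show ?thesis by (simp add: gap_def)
qed

lemma K_coord: "\<bar>x $ k\<bar> < 1" if "x \<in> K"
  using component_le_norm_cart[of x k] that K(2) by auto

lemma gap_pos_K: "0 < gap x" if "x \<in> K" using gap_pos K(2) that by auto

lemma energy_density_outside: "energy_density x = 0" if "x \<notin> K" using g0[OF that] by (simp add: energy_density_def ang_form_def)

lemma energy_density_nonneg: "0 \<le> energy_density x"
proof (cases "x \<in> K")
  case True
  then show ?thesis using gap_pos_K[of x] unfolding energy_density_def gap_def by (intro ang_form_nonneg ij) auto
qed (simp add: energy_density_outside)

lemma contu: "continuous_on UNIV u"
  using der has_derivative_continuous by (blast intro: continuous_at_imp_continuous_on)

lemma cont_gap: "continuous_on S gap" unfolding gap_def by (intro continuous_intros)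

lemma cont_energy_density: "continuous_on UNIV energy_density"
  unfolding energy_density_def ang_form_def by (intro continuous_intros contg)

lemma energy_density_integrable: "integrable lborel energy_density"
  by (rule integrable_lborel_of_compact_support[OF K(1) cont_energy_density energy_density_outside])

lemma der_line: "((\<lambda>s. u (x + s *\<^sub>R axis k 1)) has_real_derivative g (x + s *\<^sub>R axis k 1) $ k) (at s)"
proof -
  have "((\<lambda>s. x + s *\<^sub>R axis k 1) has_derivative (\<lambda>h. h *\<^sub>R axis k 1)) (at s)"
    by (auto intro!: derivative_eq_intros)
  from has_derivative_compose[OF this der]
  show ?thesis unfolding has_field_derivative_def
    by (rule has_derivative_eq_rhs) (auto simp: fun_eq_iff inner_axis)
qed

lemma gap_line: "gap (x + s *\<^sub>R axis k 1) = 1 - ((x $ i + (if k = i then s else 0))\<^sup>2 + (x $ j + (if k = j then s else 0))\<^sup>2)"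
  by (auto simp: gap_def axis_def)

lemma der_gap_line:
  "((\<lambda>s. gap (x + s *\<^sub>R axis k 1)) has_real_derivative - (if k = i \<or> k = j then 2 * (x + s *\<^sub>R axis k 1) $ k else 0)) (at s)"
  unfolding gap_line using ij by (auto intro!: derivative_eq_intros simp: axis_def)

text \<open>F' is the k-th partial derivative of u^2 x_k / (1 - r^2), the k-th component of u^2 times the
vector field (x_i, x_j) / (1 - r^2).\<close>
lemma hardy_field_integral:
  assumes k: "k = i \<or> k = j"
  defines "F' \<equiv> \<lambda>x. (2 * u x * g x $ k * x $ k + (u x)\<^sup>2) / gap x + 2 * (u x)\<^sup>2 * (x $ k)\<^sup>2 / (gap x)\<^sup>2"
  shows "integrable lborel F'" "(LINT x|lborel. F' x) = 0"
proof -
  define F where "F x = (u x)\<^sup>2 * x $ k / gap x" for x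
  have tn: "gap x \<noteq> 0" if "x \<in> ball 0 1" for x using gap_pos[OF that] by simp
  have F0: "F x = 0" "F' x = 0" if "x \<notin> K" for x using u0[OF that] by (simp_all add: F_def F'_def)
  have cF: "continuous_on UNIV F"
    by (rule continuous_on_UNIV_of_compact_support[OF K(1) open_ball K(2) _ F0(1)])
       (auto simp: F_def tn intro!: continuous_intros continuous_on_subset[OF contu] cont_gap)
  have cF': "continuous_on UNIV F'"
    by (rule continuous_on_UNIV_of_compact_support[OF K(1) open_ball K(2) _ F0(2)])
       (auto simp: F'_def tn intro!: continuous_intros continuous_on_subset[OF contu] continuous_on_subset[OF contg] cont_gap)
  show "integrable lborel F'" by (rule integrable_lborel_of_compact_support[OF K(1) cF' F0(2)])
  show "(LINT x|lborel. F' x) = 0"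
  proof (rule integral_directional_derivative_eq_0[OF K(1) F0 cF cF'])
    fix x :: "real ^ 'n" and s :: real
    let ?y = "x + s *\<^sub>R axis k 1"
    show "((\<lambda>s. F (x + s *\<^sub>R axis k 1)) has_real_derivative F' ?y) (at s)"
    proof (cases "?y \<in> K")
      case True
      have x: "((\<lambda>s. (x + s *\<^sub>R axis k 1) $ k) has_real_derivative 1) (at s)"
        by (auto intro!: derivative_eq_intros)
      have nz: "gap ?y \<noteq> 0" using gap_pos_K[OF True] by simp
      show ?thesis unfolding F_def F'_def
        by (rule derivative_eq_intros der_line x der_gap_line nz refl)+
           (use k nz in \<open>simp add: field_simps power2_eq_square\<close>)
    next
      case False
      have "open ((\<lambda>s. x + s *\<^sub>R axis k 1) -` (- K))"
        using compact_imp_closed[OF K(1)] by (intro open_vimage) (auto intro!: continuous_intros)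
      then have "((\<lambda>s. F (x + s *\<^sub>R axis k 1)) has_real_derivative 0) (at s)"
        by (rule has_field_derivative_transform_within_open[of "\<lambda>_. 0", rotated]) (use False F0 in auto)
      then show ?thesis using F0(2)[OF False] by simp
    qed
  qed
qed

text \<open>With t = 1 - r^2, the sum of the two integrals that vanish is the integral of
2 u^2/t^2 + 2 (u/t) (x_i g_i + x_j g_j). Completing the square leaves the radial derivative, which the energy density dominates.\<close>
lemma hardy:
  shows "integrable lborel (\<lambda>x. (u x)\<^sup>2 / (gap x)\<^sup>2)"
    and "(LINT x|lborel. (u x)\<^sup>2 / (gap x)\<^sup>2) \<le> (LINT x|lborel. energy_density x)"
proof -
  define H where "H x = (u x)\<^sup>2 / (gap x)\<^sup>2" for x
  define Z where "Z x = x $ i * g x $ i + x $ j * g x $ j" for x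
  define F where "F k x = (2 * u x * g x $ k * x $ k + (u x)\<^sup>2) / gap x + 2 * (u x)\<^sup>2 * (x $ k)\<^sup>2 / (gap x)\<^sup>2" for k x
  have H0: "H x = 0" if "x \<notin> K" for x using u0[OF that] by (simp add: H_def)
  have tn: "gap x \<noteq> 0" if "x \<in> ball 0 1" for x using gap_pos[OF that] by simp
  have cH: "continuous_on UNIV H"
    by (rule continuous_on_UNIV_of_compact_support[OF K(1) open_ball K(2) _ H0])
       (auto simp: H_def tn intro!: continuous_intros continuous_on_subset[OF contu] cont_gap)
  show iH: "integrable lborel (\<lambda>x. (u x)\<^sup>2 / (gap x)\<^sup>2)"
    using integrable_lborel_of_compact_support[OF K(1) cH H0] by (simp add: H_def)
  have iF: "integrable lborel (F i)" "integrable lborel (F j)" "(LINT x|lborel. F i x) = 0" "(LINT x|lborel. F j x) = 0"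
    using hardy_field_integral[of i] hardy_field_integral[of j] by (simp_all add: F_def[abs_def])
  have pt: "H x \<le> (F i x + F j x) + energy_density x" for x
  proof (cases "x \<in> K")
    case True
    have gap: "0 < gap x" by (rule gap_pos_K[OF True])
    have "F i x + F j x = 2 * (u x / gap x) * Z x + 2 * H x"
    proof -
      have e: "(x $ i)\<^sup>2 + (x $ j)\<^sup>2 = 1 - gap x" by (simp add: gap_def)
      have "F i x + F j x = 2 * (u x / gap x) * Z x + 2 * (u x)\<^sup>2 / gap x + 2 * (u x)\<^sup>2 * ((x $ i)\<^sup>2 + (x $ j)\<^sup>2) / (gap x)\<^sup>2"
        using gap by (simp add: F_def Z_def field_simps)
      also have "\<dots> = 2 * (u x / gap x) * Z x + 2 * H x"
        unfolding e using gap by (simp add: H_def field_simps power2_eq_square)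
      finally show ?thesis .
    qed
    moreover have "0 \<le> (u x / gap x + Z x)\<^sup>2" by simp
    then have "0 \<le> H x + 2 * (u x / gap x) * Z x + (Z x)\<^sup>2"
      by (simp add: H_def power2_sum power_divide)
    moreover have "(Z x)\<^sup>2 \<le> energy_density x"
      using gap unfolding Z_def energy_density_def gap_def by (intro ang_form_ge_radial ij) simp
    ultimately show ?thesis by simp
  qed (simp add: H0 F_def u0 energy_density_outside)
  have "(LINT x|lborel. H x) \<le> (LINT x|lborel. (F i x + F j x) + energy_density x)"
    by (intro integral_mono pt Bochner_Integration.integrable_add iF energy_density_integrable) (use iH in \<open>simp add: H_def\<close>)
  also have "\<dots> = (LINT x|lborel. energy_density x)" using iF energy_density_integrable by simp
  finally show "(LINT x|lborel. (u x)\<^sup>2 / (gap x)\<^sup>2) \<le> (LINT x|lborel. energy_density x)" by (simp add: H_def)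
qed

end

section \<open>A weighted Gagliardo inequality\<close>

locale C1_in_ball_powr = C1_in_ball u g K i j for u :: "real ^ 'n \<Rightarrow> real" and g K and i j :: 'n +
  fixes \<gamma> :: real
  assumes \<gamma>: "1 < \<gamma>"
begin

text \<open>The inequality of Gagliardo type is an L^1 inequality; it is applied to a power of u.\<close>
definition upow :: "real ^ 'n \<Rightarrow> real" where "upow x = \<bar>u x\<bar> powr \<gamma>"
definition dupow :: "real ^ 'n \<Rightarrow> real" where "dupow x = \<gamma> * \<bar>u x\<bar> powr (\<gamma> - 1) * sgn (u x)"
text \<open>The power plus the square root of the energy form of its gradient.\<close>
definition gdens :: "real ^ 'n \<Rightarrow> real" where "gdens x = upow x + \<bar>dupow x\<bar> * sqrt (energy_density x)"
definition gmass :: real where "gmass = (LINT x|lborel. gdens x)"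
definition loomis_whitney_exp :: real where "loomis_whitney_exp = 1 / (real CARD('n) - 1)"

lemma loomis_whitney_exp_pos: "0 < loomis_whitney_exp" using two_le_CARD[OF ij] by (simp add: loomis_whitney_exp_def)

lemma upow_nonneg [simp]: "0 \<le> upow x" by (simp add: upow_def)
lemma upow_outside: "upow x = 0" "dupow x = 0" "gdens x = 0" if "x \<notin> K"
  using u0[OF that] energy_density_outside[OF that] by (simp_all add: upow_def dupow_def gdens_def)
lemma gdens_nonneg: "0 \<le> gdens x" by (simp add: gdens_def energy_density_nonneg)

lemma abs_dupow: "\<bar>dupow x\<bar> = \<gamma> * \<bar>u x\<bar> powr (\<gamma> - 1)"
  using \<gamma> by (simp add: dupow_def abs_mult abs_sgn_eq)

lemma cont_upow: "continuous_on UNIV upow"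
  unfolding upow_def by (rule continuous_on_compose2[OF continuous_on_abs_powr[of \<gamma> UNIV] contu]) (use \<gamma> in auto)

lemma cont_dupow: "continuous_on UNIV dupow"
proof -
  have "continuous_on UNIV (\<lambda>x. \<gamma> * (\<bar>u x\<bar> powr (\<gamma> - 1) * sgn (u x)))"
    by (intro continuous_on_mult continuous_on_const continuous_on_compose2[OF continuous_on_abs_powr_sgn[of "\<gamma> - 1"] contu])
       (use \<gamma> in auto)
  then show ?thesis by (simp add: dupow_def[abs_def] mult.assoc)
qed

lemma cont_gdens: "continuous_on UNIV gdens"
  unfolding gdens_def by (intro continuous_intros cont_upow cont_dupow cont_energy_density)

lemma gdens_integrable: "integrable lborel gdens"
  by (rule integrable_lborel_of_compact_support[OF K(1) cont_gdens upow_outside(3)])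

lemma nn_integral_gdens: "(\<integral>\<^sup>+x. ennreal (gdens x) \<partial>lborel) = ennreal gmass"
  unfolding gmass_def by (rule nn_integral_eq_integral[OF gdens_integrable]) (simp add: gdens_nonneg)

lemma gmass_nonneg: "0 \<le> gmass" unfolding gmass_def by (rule integral_nonneg_AE) (simp add: gdens_nonneg)

lemma gdens_measurable [measurable]: "gdens \<in> borel_measurable borel"
  by (rule borel_measurable_continuous_onI[OF cont_gdens])

lemma upow_measurable [measurable]: "upow \<in> borel_measurable borel"
  by (rule borel_measurable_continuous_onI[OF cont_upow])

lemma gap_measurable [measurable]: "gap \<in> borel_measurable borel"
  by (rule borel_measurable_continuous_onI[OF cont_gap])

lemma der_upow_path:
  assumes "(\<sigma> has_vector_derivative w) (at s)"
  shows "((\<lambda>s. upow (\<sigma> s)) has_real_derivative dupow (\<sigma> s) * (g (\<sigma> s) \<bullet> w)) (at s)"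
proof -
  have "(\<sigma> has_derivative (\<lambda>h. h *\<^sub>R w)) (at s)" using assms by (simp add: has_vector_derivative_def)
  from has_derivative_compose[OF this der]
  have "((\<lambda>s. u (\<sigma> s)) has_real_derivative g (\<sigma> s) \<bullet> w) (at s)" unfolding has_field_derivative_def
    by (rule has_derivative_eq_rhs) (auto simp: fun_eq_iff)
  from DERIV_chain2[OF has_real_derivative_abs_powr[OF \<gamma>] this]
  show ?thesis by (simp add: upow_def dupow_def)
qed

lemma vec_upd_path: "((\<lambda>s. vec_upd x k s) has_vector_derivative axis k 1) (at s)"
  by (rule has_vector_derivative_vec) (auto simp: axis_def intro!: derivative_eq_intros)

lemma prod_ennreal_powr_const:
  assumes "0 \<le> y"
  shows "(\<Prod>k\<in>(UNIV::'n set). ennreal (y powr loomis_whitney_exp)) = ennreal (y powr (CARD('n) * loomis_whitney_exp))"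
proof -
  have "(y powr loomis_whitney_exp) ^ CARD('n) = y powr (CARD('n) * loomis_whitney_exp)" by (cases "y = 0") (simp_all add: powr_power)
  then show ?thesis by (simp add: ennreal_power)
qed

text \<open>Multiplication by 1 - r^2 compensates the degeneracy: (1 - r^2) |g| is at most the square root of the energy
density, so the Cartesian derivatives of the product are controlled. This loses too much near r = 1
but only a constant factor near the axis.\<close>
lemma cartesian_Gagliardo:
  "(\<integral>\<^sup>+x. ennreal ((gap x * upow x) powr (CARD('n) * loomis_whitney_exp)) \<partial>lborel) \<le> ennreal ((4 * gmass) powr (CARD('n) * loomis_whitney_exp))"
proof -
  define D where "D k x = gap x * (dupow x * g x $ k) - (if k = i \<or> k = j then 2 * x $ k else 0) * upow x" for k x
  let ?a = "(\<chi> k. - 1) :: real ^ 'n" and ?b = "(\<chi> k. 1) :: real ^ 'n"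
  have tV: "\<bar>gap x * upow x\<bar> = gap x * upow x" for x
    using gap_pos_K[of x] upow_outside[of x] by (cases "x \<in> K") auto
  have bd: "2 * \<bar>gap x * upow x\<bar> + \<bar>D k x\<bar> \<le> 4 * gdens x" for k x
  proof (cases "x \<in> K")
    case True
    have gap: "0 < gap x" "gap x \<le> 1" using gap_pos_K[OF True] gap_le_1 by auto
    have "(g x $ k)\<^sup>2 \<le> (norm (g x))\<^sup>2"
      using power_mono[OF component_le_norm_cart[of "g x" k], of 2] by simp
    then have "(gap x * \<bar>g x $ k\<bar>)\<^sup>2 \<le> gap x * (norm (g x))\<^sup>2"
    proof -
      have "(gap x * \<bar>g x $ k\<bar>)\<^sup>2 = gap x * (gap x * (g x $ k)\<^sup>2)" by (simp add: power2_eq_square)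
      also have "\<dots> \<le> gap x * (1 * (norm (g x))\<^sup>2)"
        using gap \<open>(g x $ k)\<^sup>2 \<le> (norm (g x))\<^sup>2\<close> by (intro mult_left_mono mult_mono) auto
      finally show ?thesis by simp
    qed
    also have "\<dots> \<le> energy_density x" unfolding gap_def energy_density_def by (rule ang_form_ge[OF ij])
    finally have tg: "gap x * \<bar>g x $ k\<bar> \<le> sqrt (energy_density x)" by (rule real_le_rsqrt)
    have "\<bar>D k x\<bar> \<le> \<bar>gap x * (dupow x * g x $ k)\<bar> + \<bar>(if k = i \<or> k = j then 2 * x $ k else 0) * upow x\<bar>"
      unfolding D_def by (rule abs_triangle_ineq4)
    also have "\<bar>gap x * (dupow x * g x $ k)\<bar> = \<bar>dupow x\<bar> * (gap x * \<bar>g x $ k\<bar>)" using gap by (simp add: abs_mult)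
    also have "\<dots> \<le> \<bar>dupow x\<bar> * sqrt (energy_density x)" using tg by (intro mult_left_mono) auto
    also have "\<bar>(if k = i \<or> k = j then 2 * x $ k else 0) * upow x\<bar> \<le> 2 * upow x"
      unfolding abs_mult using K_coord[OF True, of k] by (intro mult_mono) auto
    finally have "\<bar>D k x\<bar> \<le> \<bar>dupow x\<bar> * sqrt (energy_density x) + 2 * upow x" by simp
    moreover have "2 * \<bar>gap x * upow x\<bar> \<le> 2 * upow x" using gap upow_nonneg[of x] by (simp add: abs_mult mult_left_le_one_le)
    moreover have "0 \<le> \<bar>dupow x\<bar> * sqrt (energy_density x)" by (simp add: energy_density_nonneg)
    moreover have "b + a \<le> 4 * (v + y)" if "a \<le> y + 2 * v" "b \<le> 2 * v" "0 \<le> y" for a b v y :: real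
      using that by simp
    ultimately show ?thesis unfolding gdens_def by blast
  qed (simp add: D_def upow_outside)
  have "(\<integral>\<^sup>+x. ennreal ((gap x * upow x) powr (CARD('n) * loomis_whitney_exp)) \<partial>lborel)
      \<le> (\<integral>\<^sup>+x. indicator (cbox ?a ?b) x * (\<Prod>k\<in>(UNIV::'n set). ennreal ((1 * \<bar>gap x * upow x\<bar>) powr loomis_whitney_exp)) \<partial>lborel)"
  proof (rule nn_integral_mono)
    fix x
    show "ennreal ((gap x * upow x) powr (CARD('n) * loomis_whitney_exp))
      \<le> indicator (cbox ?a ?b) x * (\<Prod>k\<in>(UNIV::'n set). ennreal ((1 * \<bar>gap x * upow x\<bar>) powr loomis_whitney_exp))"
    proof (cases "x \<in> K")
      case True
      then have "x \<in> cbox ?a ?b" using K_coord[OF True] by (auto simp: mem_box_cart abs_less_iff less_imp_le)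
      moreover have "(\<Prod>k\<in>(UNIV::'n set). ennreal ((1 * \<bar>gap x * upow x\<bar>) powr loomis_whitney_exp)) = ennreal (\<bar>gap x * upow x\<bar> powr (CARD('n) * loomis_whitney_exp))"
        by (simp only: mult_1_left) (rule prod_ennreal_powr_const, simp)
      ultimately show ?thesis by (simp add: tV)
    qed (simp add: upow_outside)
  qed
  also have "\<dots> \<le> (\<Prod>k\<in>(UNIV::'n set). epowr (\<integral>\<^sup>+x. indicator (cbox ?a ?b) x * ennreal (1 * (2 * \<bar>gap x * upow x\<bar> + \<bar>D k x\<bar>)) \<partial>lborel) loomis_whitney_exp)"
    unfolding loomis_whitney_exp_def
  proof (rule box_Gagliardo[OF two_le_CARD[OF ij]])
    show "continuous_on UNIV (D k)" for k
      unfolding D_def by (cases "k = i \<or> k = j") (auto intro!: continuous_intros cont_gap cont_dupow contg cont_upow)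
    fix k :: 'n and x :: "real ^ 'n" and s :: real
    have "vec_upd x k s = vec_upd x k 0 + s *\<^sub>R axis k 1" for s by (simp add: vec_eq_iff axis_def)
    note p = this
    have "((\<lambda>s. gap (vec_upd x k s)) has_real_derivative - (if k = i \<or> k = j then 2 * vec_upd x k s $ k else 0)) (at s)"
      using der_gap_line[of "vec_upd x k 0" k s] by (simp only: p[symmetric])
    moreover have "((\<lambda>s. upow (vec_upd x k s)) has_real_derivative dupow (vec_upd x k s) * g (vec_upd x k s) $ k) (at s)"
      using der_upow_path[OF vec_upd_path] by (simp add: inner_axis)
    ultimately show "((\<lambda>s. gap (vec_upd x k s) * upow (vec_upd x k s)) has_real_derivative D k (vec_upd x k s)) (at s)"
      by (auto intro!: derivative_eq_intros simp: D_def algebra_simps)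
  qed auto
  also have "\<dots> \<le> (\<Prod>k\<in>(UNIV::'n set). epowr (ennreal (4 * gmass)) loomis_whitney_exp)"
  proof (intro prod_mono_ennreal epowr_mono)
    fix k
    have "(\<integral>\<^sup>+x. indicator (cbox ?a ?b) x * ennreal (1 * (2 * \<bar>gap x * upow x\<bar> + \<bar>D k x\<bar>)) \<partial>lborel) \<le> (\<integral>\<^sup>+x. ennreal (4 * gdens x) \<partial>lborel)"
      using bd by (intro nn_integral_mono) (auto simp: indicator_def ennreal_leI simp del: ennreal_plus)
    also have "\<dots> = ennreal (4 * gmass)"
      using gmass_nonneg by (simp add: ennreal_mult' nn_integral_cmult nn_integral_gdens)
    finally show "(\<integral>\<^sup>+x. indicator (cbox ?a ?b) x * ennreal (1 * (2 * \<bar>gap x * upow x\<bar> + \<bar>D k x\<bar>)) \<partial>lborel) \<le> ennreal (4 * gmass)" .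
  qed (use loomis_whitney_exp_pos in simp)
  also have "\<dots> = ennreal ((4 * gmass) powr (CARD('n) * loomis_whitney_exp))"
    using gmass_nonneg prod_ennreal_powr_const[of "4 * gmass"] by simp
  finally show ?thesis .
qed

text \<open>In the ball this is t^(1/(2(N-1))) v^(N/(N-1)) with t = 1 - r^2 and v = |u|^\<gamma>. The exponent of t comes from a
single weight sqrt t in the product over the coordinates.\<close>
definition wdens :: "real ^ 'n \<Rightarrow> real" where
  "wdens x = max 0 (gap x) powr (loomis_whitney_exp / 2) * upow x powr (CARD('n) * loomis_whitney_exp)"

lemma wdens_measurable [measurable]: "wdens \<in> borel_measurable borel"
  unfolding wdens_def by measurable

lemma wdens_nonneg: "0 \<le> wdens x" by (simp add: wdens_def)

lemma wdens_outside: "wdens x = 0" if "x \<notin> K" using upow_outside[OF that] by (simp add: wdens_def)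

text \<open>The k-th partial derivative of the polar parametrisation.\<close>
definition polar_dir :: "'n \<Rightarrow> real ^ 'n \<Rightarrow> real ^ 'n" where
  "polar_dir k p = (if k = i then cos (p $ j) *\<^sub>R axis i 1 + sin (p $ j) *\<^sub>R axis j 1
     else if k = j then (- (p $ i * sin (p $ j))) *\<^sub>R axis i 1 + (p $ i * cos (p $ j)) *\<^sub>R axis j 1
     else axis k 1)"

lemma inner_polar_dir: "\<xi> \<bullet> polar_dir k p = (if k = i then cos (p $ j) * \<xi> $ i + sin (p $ j) * \<xi> $ j
     else if k = j then p $ i * (cos (p $ j) * \<xi> $ j - sin (p $ j) * \<xi> $ i) else \<xi> $ k)"
  by (simp add: polar_dir_def inner_add_right inner_axis algebra_simps)

lemma polar_path: "((\<lambda>s. polar i j (vec_upd p k s)) has_vector_derivative polar_dir k (vec_upd p k s)) (at s)"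
proof (rule has_vector_derivative_vec)
  fix l
  show "((\<lambda>s. polar i j (vec_upd p k s) $ l) has_real_derivative polar_dir k (vec_upd p k s) $ l) (at s)"
    using ij by (auto simp: polar_def polar_dir_def axis_def intro!: derivative_eq_intros)
qed

lemma polar_nth: "polar i j p $ i = p $ i * cos (p $ j)" "polar i j p $ j = p $ i * sin (p $ j)"
  "k \<noteq> i \<Longrightarrow> k \<noteq> j \<Longrightarrow> polar i j p $ k = p $ k"
  using ij by (simp_all add: polar_def)

lemma polar_radius: "(polar i j p $ i)\<^sup>2 + (polar i j p $ j)\<^sup>2 = (p $ i)\<^sup>2"
  by (simp add: polar_nth power_mult_distrib flip: distrib_left)

lemma gap_polar: "gap (polar i j p) = 1 - (p $ i)\<^sup>2"
  by (simp add: gap_def polar_radius)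

lemma continuous_on_cos_nth: "continuous_on UNIV (\<lambda>p::real^'n. cos (p $ k))" "continuous_on UNIV (\<lambda>p::real^'n. sin (p $ k))"
proof -
  have nth: "continuous_on UNIV (\<lambda>p::real^'n. p $ k)" by (intro continuous_intros)
  show "continuous_on UNIV (\<lambda>p::real^'n. cos (p $ k))"
    by (rule continuous_on_compose2[of UNIV cos, OF _ nth]) (auto intro!: continuous_at_imp_continuous_on)
  show "continuous_on UNIV (\<lambda>p::real^'n. sin (p $ k))"
    by (rule continuous_on_compose2[of UNIV sin, OF _ nth]) (auto intro!: continuous_at_imp_continuous_on)
qed

lemma cont_polar_dir: "continuous_on UNIV (polar_dir k)"
proof -
  have nth: "continuous_on UNIV (\<lambda>p::real^'n. p $ k)" for k by (intro continuous_intros)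
  have "continuous_on UNIV (\<lambda>p. polar_dir k p)"
    unfolding polar_dir_def
    by (cases "k = i"; cases "k = j")
       (simp_all add: continuous_on_add continuous_on_diff continuous_on_scaleR continuous_on_minus continuous_on_mult continuous_on_cos_nth nth)
  then show ?thesis by simp
qed

text \<open>In polar coordinates sqrt(1 - r^2) is constant in the angle and may serve as the weight in that direction, where it
compensates exactly the degeneracy of the energy. The radius is kept in [1/2, 1], so that the Jacobian is
comparable to 1.\<close>
lemma polar_Gagliardo:
  "(\<integral>\<^sup>+x. indicator {x. 1 / 4 \<le> (x $ i)\<^sup>2 + (x $ j)\<^sup>2} x * ennreal (wdens x) \<partial>lborel) \<le> ennreal ((4 * gmass) powr (CARD('n) * loomis_whitney_exp))"
proof -
  let ?P = "polar i j"
  define D where "D k p = dupow (?P p) * (g (?P p) \<bullet> polar_dir k p)" for k p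
  define \<rho> where "\<rho> k p = (if k = j then sqrt (max 0 (1 - (p $ i)\<^sup>2)) else 1)" for k and p :: "real ^ 'n"
  define a :: "real ^ 'n" where "a = (\<chi> k. if k = i then 1 / 2 else if k = j then 0 else - 1)"
  define b :: "real ^ 'n" where "b = (\<chi> k. if k = i then 1 else if k = j then 2 * pi else 1)"
  let ?A = "{x::real^'n. 0 < (x $ i)\<^sup>2 + (x $ j)\<^sup>2 \<and> (x $ i)\<^sup>2 + (x $ j)\<^sup>2 \<le> 1\<^sup>2}"
  let ?B = "{p::real^'n. 0 < p $ i \<and> p $ i \<le> 1 \<and> 0 \<le> p $ j \<and> p $ j < 2 * pi}"
  let ?C = "{x::real^'n. 1 / 4 \<le> (x $ i)\<^sup>2 + (x $ j)\<^sup>2}"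
  have [measurable]: "(\<lambda>p::real^'n. p $ k) \<in> borel_measurable borel" for k
    by (intro borel_measurable_continuous_onI continuous_intros)
  have Pm[measurable]: "?P \<in> borel_measurable borel"
    by (rule borel_measurable_continuous_onI[OF continuous_polar])
  have "closed ?C" by (intro closed_Collect_le continuous_intros)
  then have [measurable]: "?C \<in> sets borel" by (rule borel_closed)
  have box: "p $ i \<in> {1/2..1}" "p $ j \<in> {0..2*pi}" if "p \<in> cbox a b" for p
    using that[unfolded mem_box_cart, rule_format, of i] that[unfolded mem_box_cart, rule_format, of j] ij
    by (simp_all add: a_def b_def)
  have \<rho>gdens[measurable]: "\<rho> k \<in> borel_measurable borel" for k
    unfolding \<rho>_def by (cases "k = j") simp_all
  \<comment> \<open>For the angle, sqrt(1 - r^2) matches the eigenvalue of the form, and the remaining factor r of the derivative is at most 1.\<close>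
  have bd: "\<rho> k p * (2 * \<bar>upow (?P p)\<bar> + \<bar>D k p\<bar>) \<le> 2 * gdens (?P p)" if p: "p \<in> cbox a b" for k p
  proof -
    have r: "0 \<le> p $ i" "(p $ i)\<^sup>2 \<le> 1" "p $ i \<le> 1" using box(1)[OF p] by (auto simp: power_le_one)
    have \<rho>: "0 \<le> \<rho> k p" "\<rho> k p \<le> 1" by (auto simp: \<rho>_def)
    define \<xi> where "\<xi> = g (?P p)"
    define A1 where "A1 = cos (p $ j) * \<xi> $ i + sin (p $ j) * \<xi> $ j"
    define A2 where "A2 = cos (p $ j) * \<xi> $ j - sin (p $ j) * \<xi> $ i"
    have qP: "energy_density (?P p) = A1\<^sup>2 + (1 - (p $ i)\<^sup>2) * A2\<^sup>2 + (\<Sum>k\<in>UNIV - {i, j}. (\<xi> $ k)\<^sup>2)"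
      unfolding energy_density_def \<xi>_def A1_def A2_def by (rule ang_form_polar[OF ij polar_nth(1,2)])
    have s0: "0 \<le> (\<Sum>k\<in>UNIV - {i, j}. (\<xi> $ k)\<^sup>2)" by (simp add: sum_nonneg)
    have a0: "0 \<le> (1 - (p $ i)\<^sup>2) * A2\<^sup>2" using r by simp
    have "(\<rho> k p * \<bar>\<xi> \<bullet> polar_dir k p\<bar>)\<^sup>2 \<le> energy_density (?P p)"
    proof -
      consider "k = i" | "k = j" | "k \<noteq> i" "k \<noteq> j" by blast
      then show ?thesis
      proof cases
        case 1
        then show ?thesis using ij s0 a0 by (simp add: \<rho>_def inner_polar_dir qP A1_def)
      next
        case 2
        then have "(\<rho> k p * \<bar>\<xi> \<bullet> polar_dir k p\<bar>)\<^sup>2 = (1 - (p $ i)\<^sup>2) * ((p $ i)\<^sup>2 * A2\<^sup>2)"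
          using ij r by (simp add: \<rho>_def inner_polar_dir A2_def power_mult_distrib)
        also have "\<dots> \<le> (1 - (p $ i)\<^sup>2) * (1 * A2\<^sup>2)"
          using r by (intro mult_left_mono mult_right_mono) auto
        also have "\<dots> \<le> energy_density (?P p)" using s0 by (simp add: qP)
        finally show ?thesis .
      next
        case 3
        then have "(\<xi> $ k)\<^sup>2 \<le> (\<Sum>k\<in>UNIV - {i, j}. (\<xi> $ k)\<^sup>2)" by (intro member_le_sum) auto
        moreover have "0 \<le> A1\<^sup>2" by simp
        ultimately have "(\<xi> $ k)\<^sup>2 \<le> energy_density (?P p)" unfolding qP using a0 by linarith
        then show ?thesis using 3 by (simp add: \<rho>_def inner_polar_dir)
      qed
    qed
    then have "\<rho> k p * \<bar>\<xi> \<bullet> polar_dir k p\<bar> \<le> sqrt (energy_density (?P p))" by (rule real_le_rsqrt)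
    then have "\<bar>dupow (?P p)\<bar> * (\<rho> k p * \<bar>\<xi> \<bullet> polar_dir k p\<bar>) \<le> \<bar>dupow (?P p)\<bar> * sqrt (energy_density (?P p))"
      by (intro mult_left_mono) auto
    moreover have "\<rho> k p * upow (?P p) \<le> 1 * upow (?P p)" using \<rho> by (intro mult_right_mono) auto
    ultimately have "2 * (\<rho> k p * upow (?P p)) + \<bar>dupow (?P p)\<bar> * (\<rho> k p * \<bar>\<xi> \<bullet> polar_dir k p\<bar>) \<le> 2 * upow (?P p) + \<bar>dupow (?P p)\<bar> * sqrt (energy_density (?P p))"
      by linarith
    also have "\<dots> \<le> 2 * gdens (?P p)" using energy_density_nonneg[of "?P p"] by (simp add: gdens_def)
    finally show ?thesis by (simp add: D_def abs_mult \<xi>_def algebra_simps)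
  qed
  have "(\<integral>\<^sup>+x. indicator ?C x * ennreal (wdens x) \<partial>lborel) = (\<integral>\<^sup>+x. indicator ?A x * (indicator ?C x * ennreal (wdens x)) \<partial>lborel)"
  proof (rule nn_integral_cong)
    fix x
    show "indicator ?C x * ennreal (wdens x) = indicator ?A x * (indicator ?C x * ennreal (wdens x))"
    proof (cases "x \<in> K")
      case True
      then show ?thesis using gap_pos_K[OF True] by (auto simp: indicator_def gap_def)
    qed (simp add: wdens_outside)
  qed
  also have "\<dots> = (\<integral>\<^sup>+p. indicator ?B p * ennreal (p $ i) * (indicator ?C (?P p) * ennreal (wdens (?P p))) \<partial>lborel)"
    by (rule nn_integral_polar[OF _ ij]) simp_all
  also have "\<dots> \<le> (\<integral>\<^sup>+p. indicator (cbox a b) p * (\<Prod>k\<in>UNIV. ennreal ((\<rho> k p * \<bar>upow (?P p)\<bar>) powr loomis_whitney_exp)) \<partial>lborel)"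
  proof (rule nn_integral_mono)
    fix p
    show "indicator ?B p * ennreal (p $ i) * (indicator ?C (?P p) * ennreal (wdens (?P p)))
        \<le> indicator (cbox a b) p * (\<Prod>k\<in>UNIV. ennreal ((\<rho> k p * \<bar>upow (?P p)\<bar>) powr loomis_whitney_exp))"
    proof (cases "p \<in> ?B \<and> ?P p \<in> ?C \<and> ?P p \<in> K")
      case True
      have r: "1 / 2 \<le> p $ i" "p $ i \<le> 1"
      proof -
        have "(1 / 2)\<^sup>2 \<le> (p $ i)\<^sup>2" using True polar_radius[of p] by (simp add: power_divide)
        then show "1 / 2 \<le> p $ i" using True by (intro power2_le_imp_le[of "1/2" "p $ i"]) auto
      qed (use True in auto)
      have "a $ k \<le> p $ k \<and> p $ k \<le> b $ k" for k
        using True r ij K_coord[of "?P p" k] polar_nth(3)[of k p]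
        by (cases "k = i"; cases "k = j") (auto simp: a_def b_def abs_less_iff)
      then have pb: "p \<in> cbox a b" by (simp add: mem_box_cart)
      have gap: "0 \<le> 1 - (p $ i)\<^sup>2" using r by (simp add: power_le_one)
      have "(\<Prod>k\<in>UNIV. ennreal ((\<rho> k p * \<bar>upow (?P p)\<bar>) powr loomis_whitney_exp)) = (\<Prod>k\<in>UNIV. ennreal (\<rho> k p powr loomis_whitney_exp) * ennreal (upow (?P p) powr loomis_whitney_exp))"
        by (intro prod.cong refl) (simp add: \<rho>_def powr_mult ennreal_mult')
      also have "\<dots> = (\<Prod>k\<in>UNIV. ennreal (\<rho> k p powr loomis_whitney_exp)) * (\<Prod>k\<in>(UNIV::'n set). ennreal (upow (?P p) powr loomis_whitney_exp))"
        by (rule prod.distrib)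
      also have "(\<Prod>k\<in>UNIV. ennreal (\<rho> k p powr loomis_whitney_exp)) = ennreal (\<rho> j p powr loomis_whitney_exp)"
        by (subst prod.remove[of UNIV j]) (auto simp: \<rho>_def)
      also have "\<rho> j p powr loomis_whitney_exp = max 0 (gap (?P p)) powr (loomis_whitney_exp / 2)"
        using gap by (simp add: \<rho>_def gap_polar powr_half_sqrt[symmetric] powr_powr mult.commute)
      also have "(\<Prod>k\<in>(UNIV::'n set). ennreal (upow (?P p) powr loomis_whitney_exp)) = ennreal (upow (?P p) powr (CARD('n) * loomis_whitney_exp))"
        by (rule prod_ennreal_powr_const) simp
      also have "ennreal (max 0 (gap (?P p)) powr (loomis_whitney_exp / 2)) * \<dots> = ennreal (wdens (?P p))"
        by (simp add: wdens_def ennreal_mult')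
      finally have "(\<Prod>k\<in>UNIV. ennreal ((\<rho> k p * \<bar>upow (?P p)\<bar>) powr loomis_whitney_exp)) = ennreal (wdens (?P p))" .
      moreover have "ennreal (p $ i) * ennreal (wdens (?P p)) \<le> 1 * ennreal (wdens (?P p))"
        using r by (intro mult_right_mono) (auto simp: ennreal_le_1)
      ultimately show ?thesis using True pb by simp
    next
      case False
      then consider "p \<notin> ?B" | "?P p \<notin> ?C" | "?P p \<notin> K" by blast
      then show ?thesis by cases (simp_all add: wdens_outside)
    qed
  qed
  also have "\<dots> \<le> (\<Prod>k\<in>UNIV. epowr (\<integral>\<^sup>+p. indicator (cbox a b) p * ennreal (\<rho> k p * (2 * \<bar>upow (?P p)\<bar> + \<bar>D k p\<bar>)) \<partial>lborel) loomis_whitney_exp)"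
    unfolding loomis_whitney_exp_def
  proof (rule box_Gagliardo[OF two_le_CARD[OF ij]])
    show "(\<lambda>p. upow (?P p)) \<in> borel_measurable borel" by measurable
    show "continuous_on UNIV (D k)" for k
      unfolding D_def
      by (intro continuous_intros continuous_on_compose2[OF cont_dupow continuous_polar] continuous_on_compose2[OF contg continuous_polar] cont_polar_dir) auto
    show "((\<lambda>s. upow (?P (vec_upd p k s))) has_real_derivative D k (vec_upd p k s)) (at s)" for k p s
      unfolding D_def by (rule der_upow_path[OF polar_path])
    show "\<rho> k (vec_upd p k s) = \<rho> k p" for k p s using ij by (auto simp: \<rho>_def)
    show "1 / 2 \<le> b $ k - a $ k" for k using pi_gt3 by (simp add: a_def b_def)
  qed (auto simp: \<rho>_def)
  also have "\<dots> \<le> (\<Prod>k\<in>(UNIV::'n set). epowr (ennreal (4 * gmass)) loomis_whitney_exp)"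
  proof (intro prod_mono_ennreal epowr_mono)
    fix k
    \<comment> \<open>The closed box contains the angle 2 pi, which the half-open strip does not.\<close>
    have "negligible {p::real^'n. p $ j = 2 * pi}"
      using negligible_standard_hyperplane[of "axis j 1 :: real ^ 'n" "2 * pi"]
      by (simp add: axis_in_Basis_iff inner_axis)
    then have "AE p in lebesgue. p \<notin> {p::real^'n. p $ j = 2 * pi}"
      unfolding negligible_iff_null_sets by (rule AE_not_in)
    then have ae: "AE p in lborel. p \<notin> {p::real^'n. p $ j = 2 * pi}" by (simp add: AE_completion_iff)
    have "(\<integral>\<^sup>+p. indicator (cbox a b) p * ennreal (\<rho> k p * (2 * \<bar>upow (?P p)\<bar> + \<bar>D k p\<bar>)) \<partial>lborel)
        \<le> (\<integral>\<^sup>+p. 4 * (indicator ?B p * ennreal (p $ i) * ennreal (gdens (?P p))) \<partial>lborel)"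
    proof (rule nn_integral_mono_AE)
      show "AE p in lborel. indicator (cbox a b) p * ennreal (\<rho> k p * (2 * \<bar>upow (?P p)\<bar> + \<bar>D k p\<bar>))
        \<le> 4 * (indicator ?B p * ennreal (p $ i) * ennreal (gdens (?P p)))"
        using ae
      proof eventually_elim
        fix p :: "real ^ 'n" assume pj: "p \<notin> {p. p $ j = 2 * pi}"
        show "indicator (cbox a b) p * ennreal (\<rho> k p * (2 * \<bar>upow (?P p)\<bar> + \<bar>D k p\<bar>))
          \<le> 4 * (indicator ?B p * ennreal (p $ i) * ennreal (gdens (?P p)))"
        proof (cases "p \<in> cbox a b")
          case True
          have B: "p \<in> ?B" using box[OF True] pj by auto
          have "\<rho> k p * (2 * \<bar>upow (?P p)\<bar> + \<bar>D k p\<bar>) \<le> 2 * gdens (?P p)" by (rule bd[OF True])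
          also have "\<dots> \<le> 4 * (p $ i * gdens (?P p))"
            using box(1)[OF True] mult_right_mono[of "1/2" "p $ i" "gdens (?P p)"] gdens_nonneg[of "?P p"] by simp
          finally have "ennreal (\<rho> k p * (2 * \<bar>upow (?P p)\<bar> + \<bar>D k p\<bar>)) \<le> ennreal (4 * (p $ i * gdens (?P p)))"
            by (rule ennreal_leI)
          also have "\<dots> = 4 * (ennreal (p $ i) * ennreal (gdens (?P p)))"
            using B gdens_nonneg by (simp add: ennreal_mult')
          finally show ?thesis using True B by simp
        qed simp
      qed
    qed
    also have "\<dots> = 4 * (\<integral>\<^sup>+p. indicator ?B p * ennreal (p $ i) * ennreal (gdens (?P p)) \<partial>lborel)"
    proof (rule nn_integral_cmult)
      have "{p \<in> space borel. 0 < p $ i \<and> p $ i \<le> 1 \<and> 0 \<le> p $ j \<and> p $ j < 2 * pi} \<in> sets (borel :: (real^'n) measure)"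
        by measurable
      then have [measurable]: "?B \<in> sets borel" by simp
      show "(\<lambda>p. indicator ?B p * ennreal (p $ i) * ennreal (gdens (?P p))) \<in> borel_measurable lborel" by measurable
    qed
    also have "(\<integral>\<^sup>+p. indicator ?B p * ennreal (p $ i) * ennreal (gdens (?P p)) \<partial>lborel) = (\<integral>\<^sup>+x. indicator ?A x * ennreal (gdens x) \<partial>lborel)"
      by (rule nn_integral_polar[OF _ ij, symmetric]) simp_all
    also have "4 * \<dots> \<le> 4 * (\<integral>\<^sup>+x. ennreal (gdens x) \<partial>lborel)"
      by (intro mult_left_mono nn_integral_mono) (auto simp: indicator_def)
    also have "\<dots> = ennreal (4 * gmass)" using gmass_nonneg by (simp add: nn_integral_gdens ennreal_mult')
    finally show "(\<integral>\<^sup>+p. indicator (cbox a b) p * ennreal (\<rho> k p * (2 * \<bar>upow (?P p)\<bar> + \<bar>D k p\<bar>)) \<partial>lborel) \<le> ennreal (4 * gmass)" .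
  qed (use loomis_whitney_exp_pos in simp)
  also have "\<dots> = ennreal ((4 * gmass) powr (CARD('n) * loomis_whitney_exp))"
    using gmass_nonneg prod_ennreal_powr_const[of "4 * gmass"] by simp
  finally show ?thesis .
qed

text \<open>For r < 1/2 the weight 1 - r^2 exceeds 3/4, so the Cartesian estimate applies there and the polar one elsewhere.\<close>
lemma weighted_bound:
  "(\<integral>\<^sup>+x. ennreal (wdens x) \<partial>lborel) \<le> ennreal (2 * (6 * gmass) powr (CARD('n) * loomis_whitney_exp))"
proof -
  let ?C = "{x::real^'n. 1 / 4 \<le> (x $ i)\<^sup>2 + (x $ j)\<^sup>2}"
  let ?e = "CARD('n) * loomis_whitney_exp"
  have "closed ?C" by (intro closed_Collect_le continuous_intros)
  then have [measurable]: "?C \<in> sets borel" by (rule borel_closed)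
  have e: "0 < ?e" using loomis_whitney_exp_pos by simp
  have "(\<integral>\<^sup>+x. ennreal (wdens x) \<partial>lborel)
     \<le> (\<integral>\<^sup>+x. indicator ?C x * ennreal (wdens x) + ennreal ((4 / 3) powr ?e) * ennreal ((gap x * upow x) powr ?e) \<partial>lborel)"
  proof (rule nn_integral_mono)
    fix x
    show "ennreal (wdens x) \<le> indicator ?C x * ennreal (wdens x) + ennreal ((4 / 3) powr ?e) * ennreal ((gap x * upow x) powr ?e)"
    proof (cases "x \<in> ?C \<or> x \<notin> K")
      case False
      then have gap: "3 / 4 < gap x" by (auto simp: gap_def)
      have "wdens x \<le> 1 * upow x powr ?e"
        unfolding wdens_def using gap gap_le_1[of x] loomis_whitney_exp_pos by (intro mult_right_mono) (auto simp: powr_le1)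
      also have "\<dots> \<le> (4 / 3 * (gap x * upow x)) powr ?e"
      proof -
        have "3 / 4 * upow x \<le> gap x * upow x" using gap by (intro mult_right_mono) auto
        then show ?thesis using e by (simp, intro powr_mono2) auto
      qed
      also have "\<dots> = (4 / 3) powr ?e * (gap x * upow x) powr ?e" using gap by (intro powr_mult)
      finally have "ennreal (wdens x) \<le> ennreal ((4 / 3) powr ?e * (gap x * upow x) powr ?e)" by (rule ennreal_leI)
      then show ?thesis using False by (simp add: ennreal_mult')
    qed (auto simp: wdens_outside)
  qed
  also have "\<dots> = (\<integral>\<^sup>+x. indicator ?C x * ennreal (wdens x) \<partial>lborel) + ennreal ((4 / 3) powr ?e) * (\<integral>\<^sup>+x. ennreal ((gap x * upow x) powr ?e) \<partial>lborel)"
    by (subst nn_integral_add) (simp_all add: nn_integral_cmult)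
  also have "\<dots> \<le> ennreal ((4 * gmass) powr ?e) + ennreal ((4 / 3) powr ?e) * ennreal ((4 * gmass) powr ?e)"
    by (intro add_mono mult_left_mono polar_Gagliardo cartesian_Gagliardo) simp
  also have "\<dots> = ennreal ((4 * gmass) powr ?e + (4 / 3 * (4 * gmass)) powr ?e)"
  proof -
    have "(4 / 3 * (4 * gmass)) powr ?e = (4 / 3) powr ?e * (4 * gmass) powr ?e" by (rule powr_mult)
    moreover have "ennreal (a + b * a) = ennreal a + ennreal b * ennreal a" if "0 \<le> a" "0 \<le> b" for a b
      using that by (simp add: ennreal_mult')
    ultimately show ?thesis by simp
  qed
  also have "\<dots> \<le> ennreal (2 * (6 * gmass) powr ?e)"
  proof (rule ennreal_leI)
    have "(4 * gmass) powr ?e \<le> (6 * gmass) powr ?e" "(4 / 3 * (4 * gmass)) powr ?e \<le> (6 * gmass) powr ?e"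
      using gmass_nonneg e by (intro powr_mono2; simp)+
    then show "(4 * gmass) powr ?e + (4 / 3 * (4 * gmass)) powr ?e \<le> 2 * (6 * gmass) powr ?e" by simp
  qed
  finally show ?thesis .
qed

end

section \<open>The critical inequality for test functions\<close>

text \<open>The value that results from the proof. It depends on the dimension only.\<close>
definition sobolev_const :: "nat \<Rightarrow> real" where
  "sobolev_const N = (let n = real N; \<gamma> = (4 * n - 2) / (2 * n - 3) in
     (2 * (6 * (1 + \<gamma>)) powr (n / (n - 1))) powr (4 * (n - 1) / (2 * n + 1)))"

lemma sobolev_const_pos: "0 < sobolev_const N" if "2 \<le> N"
proof -
  define n where "n = real N"
  have "0 < (4 * n - 2) / (2 * n - 3)" using that by (simp add: n_def)
  moreover have "0 < (2 * (6 * (1 + \<gamma>)) powr e) powr f" if "0 < \<gamma>" for \<gamma> e f :: real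
    using that by simp
  ultimately show ?thesis unfolding sobolev_const_def Let_def n_def by blast
qed

context C1_in_ball
begin

text \<open>Hardy's inequality, the weighted Gagliardo inequality and Hoelder's inequality bound A = integral of |u|^p by
a power of A with exponent smaller than 1 times a power of the energy.\<close>
lemma critical_Sobolev:
  defines "p \<equiv> crit_exp CARD('n)"
  shows "integrable lborel (\<lambda>x. \<bar>u x\<bar> powr p)"
    and "(LINT x|lborel. \<bar>u x\<bar> powr p) powr (2 / p) \<le> sobolev_const CARD('n) * (LINT x|lborel. energy_density x)"
proof -
  define n where "n = real CARD('n)"
  have n: "2 \<le> n" using two_le_CARD[OF ij] by (simp add: n_def)
  \<comment> \<open>This makes the exponent of u in the gradient of the power equal to p / 2.\<close>
  define \<gamma> where "\<gamma> = (4 * n - 2) / (2 * n - 3)"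
  have \<gamma>1: "1 < \<gamma>" using n by (simp add: \<gamma>_def field_simps)
  interpret C1_in_ball_powr u g K i j \<gamma> by unfold_locales (rule \<gamma>1)
  have p: "p = (4 * n + 2) / (2 * n - 3)" by (simp add: p_def crit_exp_def n_def)
  have p\<gamma>: "p = 2 * (\<gamma> - 1)" using n by (simp add: p \<gamma>_def field_simps)
  have p0: "0 < p" using \<gamma>1 p\<gamma> by simp
  have loomis_whitney_exp: "loomis_whitney_exp = 1 / (n - 1)" by (simp add: loomis_whitney_exp_def n_def)
  define Up where "Up x = \<bar>u x\<bar> powr p" for x
  define Hx where "Hx x = (u x)\<^sup>2 / (gap x)\<^sup>2" for x
  define A where "A = (LINT x|lborel. Up x)"
  define E where "E = (LINT x|lborel. energy_density x)"
  have um[measurable]: "u \<in> borel_measurable borel" by (rule borel_measurable_continuous_onI[OF contu])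
  have qm[measurable]: "energy_density \<in> borel_measurable borel" by (rule borel_measurable_continuous_onI[OF cont_energy_density])
  have Um[measurable]: "Up \<in> borel_measurable borel" unfolding Up_def by measurable
  have Hm[measurable]: "Hx \<in> borel_measurable borel" unfolding Hx_def by measurable
  have iU: "integrable lborel Up"
  proof (rule integrable_lborel_of_compact_support[OF K(1)])
    show "continuous_on UNIV Up" unfolding Up_def
      by (rule continuous_on_compose2[OF continuous_on_abs_powr[OF p0, of UNIV] contu]) auto
    show "Up x = 0" if "x \<notin> K" for x using u0[OF that] by (simp add: Up_def)
  qed
  then show "integrable lborel (\<lambda>x. \<bar>u x\<bar> powr p)" by (simp add: Up_def[abs_def])
  have A0: "0 \<le> A" unfolding A_def by (rule integral_nonneg_AE) (simp add: Up_def)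
  have E0: "0 \<le> E" unfolding E_def by (rule integral_nonneg_AE) (simp add: energy_density_nonneg)
  have nnA: "(\<integral>\<^sup>+x. ennreal (Up x) \<partial>lborel) = ennreal A"
    unfolding A_def by (rule nn_integral_eq_integral[OF iU]) (simp add: Up_def)
  have nnE: "(\<integral>\<^sup>+x. ennreal (energy_density x) \<partial>lborel) = ennreal E"
    unfolding E_def by (rule nn_integral_eq_integral[OF energy_density_integrable]) (simp add: energy_density_nonneg)
  have nnH: "(\<integral>\<^sup>+x. ennreal (Hx x) \<partial>lborel) \<le> ennreal E"
  proof -
    have "(\<integral>\<^sup>+x. ennreal (Hx x) \<partial>lborel) = ennreal (LINT x|lborel. Hx x)"
      by (rule nn_integral_eq_integral) (use hardy(1) in \<open>simp_all add: Hx_def\<close>)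
    also have "\<dots> \<le> ennreal E" unfolding Hx_def E_def by (rule ennreal_leI[OF hardy(2)])
    finally show ?thesis .
  qed
  have nnU2: "(\<integral>\<^sup>+x. ennreal ((u x)\<^sup>2) \<partial>lborel) \<le> ennreal E"
  proof -
    have "(u x)\<^sup>2 \<le> Hx x" for x
    proof (cases "x \<in> K")
      case True
      have "0 < (gap x)\<^sup>2" "(gap x)\<^sup>2 \<le> 1" using gap_pos_K[OF True] gap_le_1[of x] by (auto simp: power_le_one)
      then show ?thesis by (simp add: Hx_def pos_le_divide_eq mult_left_le)
    qed (simp add: u0 Hx_def)
    then have "(\<integral>\<^sup>+x. ennreal ((u x)\<^sup>2) \<partial>lborel) \<le> (\<integral>\<^sup>+x. ennreal (Hx x) \<partial>lborel)"
      by (intro nn_integral_mono ennreal_leI)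
    with nnH show ?thesis by (rule order_trans[rotated])
  qed
  have "p * (1 / 2) = \<gamma> - 1" by (simp add: p\<gamma>)
  then have sq: "Up x powr (1 / 2) = \<bar>u x\<bar> powr (\<gamma> - 1)" for x by (simp only: Up_def powr_powr)
  \<comment> \<open>The Cauchy-Schwarz bound for both summands of the integral of the gradient density.\<close>
  define S where "S = A powr (1 / 2) * E powr (1 / 2)"
  have S0: "0 \<le> S" by (simp add: S_def)
  have "ennreal gmass \<le> ennreal ((1 + \<gamma>) * S)"
  proof -
    have upow: "upow x = Up x powr (1 / 2) * ((u x)\<^sup>2) powr (1 / 2)" for x
    proof (cases "u x = 0")
      case False
      have "((u x)\<^sup>2) powr (1 / 2) = \<bar>u x\<bar> powr 1" by (simp add: powr_half_sqrt)
      then have "Up x powr (1 / 2) * ((u x)\<^sup>2) powr (1 / 2) = \<bar>u x\<bar> powr (\<gamma> - 1 + 1)"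
        unfolding sq powr_add by simp
      then show ?thesis by (simp add: upow_def)
    qed (simp add: upow_def Up_def)
    have dVq: "\<bar>dupow x\<bar> * sqrt (energy_density x) = \<gamma> * (Up x powr (1 / 2) * energy_density x powr (1 / 2))" for x
      by (simp add: abs_dupow sq powr_half_sqrt energy_density_nonneg)
    have 1: "(\<integral>\<^sup>+x. ennreal (Up x powr (1 / 2) * ((u x)\<^sup>2) powr (1 / 2)) \<partial>lborel) \<le> ennreal S"
      unfolding S_def by (rule nn_integral_Hoelder2) (use nnA nnU2 A0 E0 in \<open>auto simp: Up_def\<close>)
    have 2: "(\<integral>\<^sup>+x. ennreal (Up x powr (1 / 2) * energy_density x powr (1 / 2)) \<partial>lborel) \<le> ennreal S"
      unfolding S_def by (rule nn_integral_Hoelder2) (use nnA nnE A0 E0 energy_density_nonneg in \<open>auto simp: Up_def\<close>)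
    have "ennreal gmass = (\<integral>\<^sup>+x. ennreal (gdens x) \<partial>lborel)" by (simp add: nn_integral_gdens)
    also have "\<dots> = (\<integral>\<^sup>+x. ennreal (Up x powr (1 / 2) * ((u x)\<^sup>2) powr (1 / 2)) + ennreal \<gamma> * ennreal (Up x powr (1 / 2) * energy_density x powr (1 / 2)) \<partial>lborel)"
    proof (rule nn_integral_cong)
      fix x
      have "gdens x = Up x powr (1 / 2) * ((u x)\<^sup>2) powr (1 / 2) + \<gamma> * (Up x powr (1 / 2) * energy_density x powr (1 / 2))"
        unfolding gdens_def dVq upow ..
      moreover have "ennreal (a + \<gamma> * b) = ennreal a + ennreal \<gamma> * ennreal b" if "0 \<le> a" "0 \<le> b" for a b
        using that \<gamma>1 by (simp add: ennreal_mult')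
      ultimately show "ennreal (gdens x) = ennreal (Up x powr (1 / 2) * ((u x)\<^sup>2) powr (1 / 2)) + ennreal \<gamma> * ennreal (Up x powr (1 / 2) * energy_density x powr (1 / 2))"
        by simp
    qed
    also have "\<dots> = (\<integral>\<^sup>+x. ennreal (Up x powr (1 / 2) * ((u x)\<^sup>2) powr (1 / 2)) \<partial>lborel)
        + ennreal \<gamma> * (\<integral>\<^sup>+x. ennreal (Up x powr (1 / 2) * energy_density x powr (1 / 2)) \<partial>lborel)"
      by (subst nn_integral_add) (simp_all add: nn_integral_cmult)
    also have "\<dots> \<le> ennreal S + ennreal \<gamma> * ennreal S" by (intro add_mono mult_left_mono 1 2) simp
    also have "\<dots> = ennreal ((1 + \<gamma>) * S)"
      using S0 \<gamma>1 by (simp add: ennreal_mult' distrib_right)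
    finally show ?thesis .
  qed
  then have gmass: "gmass \<le> (1 + \<gamma>) * S" using S0 \<gamma>1 by (simp add: ennreal_le_iff)
  define e where "e = n * loomis_whitney_exp"
  have e: "e = n / (n - 1)" "0 < e" using n by (simp_all add: e_def loomis_whitney_exp)
  define B where "B = 2 * (6 * (1 + \<gamma>)) powr e * S powr e"
  have B0: "0 \<le> B" by (simp add: B_def)
  have nnh: "(\<integral>\<^sup>+x. ennreal (wdens x) \<partial>lborel) \<le> ennreal B"
  proof -
    have "6 * gmass \<le> 6 * ((1 + \<gamma>) * S)" using gmass by simp
    then have M6: "6 * gmass \<le> 6 * (1 + \<gamma>) * S" by (simp only: mult.assoc)
    have "(6 * gmass) powr e \<le> (6 * (1 + \<gamma>) * S) powr e"
      by (rule powr_mono2[OF _ _ M6]) (use gmass_nonneg e in auto)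
    also have "\<dots> = (6 * (1 + \<gamma>)) powr e * S powr e" by (rule powr_mult)
    finally have "2 * (6 * gmass) powr (CARD('n) * loomis_whitney_exp) \<le> B" by (simp add: B_def e_def n_def)
    then show ?thesis using weighted_bound by (meson ennreal_leI order_trans)
  qed
  \<comment> \<open>The exponents for which the powers of 1 - r^2 cancel; those of u then add up to p.\<close>
  define \<alpha> where "\<alpha> = 4 * (n - 1) / (4 * n - 3)"
  define \<beta> where "\<beta> = 1 / (4 * n - 3)"
  have \<alpha>\<beta>: "0 < \<alpha>" "0 < \<beta>" "\<alpha> + \<beta> = 1"
    using n by (simp_all add: \<alpha>_def \<beta>_def flip: add_divide_distrib)
  have cn: "loomis_whitney_exp * (n - 1) = 1" using n by (simp add: loomis_whitney_exp)
  have \<alpha>_eq: "\<alpha> = 4 * (n - 1) * \<beta>" by (simp add: \<alpha>_def \<beta>_def)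
  have "ennreal A \<le> ennreal (B powr \<alpha> * E powr \<beta>)"
  proof -
    have "Up x = wdens x powr \<alpha> * Hx x powr \<beta>" for x
    proof (cases "x \<in> K \<and> u x \<noteq> 0")
      case True
      then have gap: "0 < gap x" and u: "0 < \<bar>u x\<bar>" using gap_pos_K by auto
      have "loomis_whitney_exp / 2 * \<alpha> = 2 * (loomis_whitney_exp * (n - 1)) * \<beta>" unfolding \<alpha>_eq by (simp add: algebra_simps)
      then have e1: "loomis_whitney_exp / 2 * \<alpha> + (- 2) * \<beta> = 0" by (simp add: cn)
      have e2: "\<gamma> * (n * loomis_whitney_exp) * \<alpha> + 2 * \<beta> = p"
      proof -
        have "\<gamma> * (n * loomis_whitney_exp) * \<alpha> = \<gamma> * n * (loomis_whitney_exp * (n - 1)) * (4 * \<beta>)" unfolding \<alpha>_eq by (simp add: algebra_simps)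
        then have "\<gamma> * (n * loomis_whitney_exp) * \<alpha> = \<gamma> * n * (4 / (4 * n - 3))" by (simp add: cn \<beta>_def)
        then have "\<gamma> * (n * loomis_whitney_exp) * \<alpha> + 2 * \<beta> = (4 * (\<gamma> * n) + 2) / (4 * n - 3)" by (simp add: \<beta>_def add_divide_distrib)
        also have "4 * (\<gamma> * n) + 2 = p * (4 * n - 3)"
          using n by (simp add: \<gamma>_def p field_simps)
        finally show ?thesis using n by simp
      qed
      have "wdens x powr \<alpha> = gap x powr (loomis_whitney_exp / 2 * \<alpha>) * \<bar>u x\<bar> powr (\<gamma> * (n * loomis_whitney_exp) * \<alpha>)"
        using gap u by (simp add: wdens_def upow_def powr_mult powr_powr n_def)
      moreover have "Hx x powr \<beta> = gap x powr ((- 2) * \<beta>) * \<bar>u x\<bar> powr (2 * \<beta>)"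
      proof -
        have "Hx x = gap x powr (- 2) * \<bar>u x\<bar> powr 2"
          using gap u by (simp add: Hx_def powr_minus_divide)
        then show ?thesis by (simp only: powr_mult powr_powr)
      qed
      ultimately have "wdens x powr \<alpha> * Hx x powr \<beta>
          = gap x powr (loomis_whitney_exp / 2 * \<alpha> + (- 2) * \<beta>) * \<bar>u x\<bar> powr (\<gamma> * (n * loomis_whitney_exp) * \<alpha> + 2 * \<beta>)"
        by (simp only: powr_add mult_ac)
      then show ?thesis unfolding e1 e2 using gap by (simp add: Up_def)
    next
      case False
      then have "u x = 0" using u0 by auto
      then show ?thesis by (simp add: Up_def Hx_def)
    qed
    then have "ennreal A = (\<integral>\<^sup>+x. ennreal (wdens x powr \<alpha> * Hx x powr \<beta>) \<partial>lborel)"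
      by (simp add: nnA[symmetric])
    also have "\<dots> \<le> ennreal (B powr \<alpha> * E powr \<beta>)"
      by (rule nn_integral_Hoelder2) (use \<alpha>\<beta> nnh nnH B0 E0 wdens_nonneg in \<open>auto simp: Hx_def\<close>)
    finally show ?thesis .
  qed
  then have main: "A \<le> B powr \<alpha> * E powr \<beta>" by (simp add: ennreal_le_iff)
  define C0 where "C0 = 2 * (6 * (1 + \<gamma>)) powr e"
  have C0: "0 < C0" using \<gamma>1 by (simp add: C0_def)
  have const: "sobolev_const CARD('n) = C0 powr (4 * (n - 1) / (2 * n + 1))"
    by (simp add: sobolev_const_def Let_def C0_def \<gamma>_def e flip: n_def)
  have "A powr (2 / p) \<le> sobolev_const CARD('n) * E"
  proof (cases "A = 0")
    case True
    then show ?thesis using E0 by (simp add: const)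
  next
    case False
    then have A: "0 < A" using A0 by simp
    have "E \<noteq> 0"
    proof
      assume "E = 0"
      then have "A \<le> 0" using main \<alpha>\<beta> by simp
      with A show False by simp
    qed
    then have E: "0 < E" using E0 by simp
    have "1 / 2 * e * \<alpha> = 2 * n * (loomis_whitney_exp * (n - 1)) * \<beta>" unfolding \<alpha>_eq e_def by (simp add: algebra_simps)
    also have "\<dots> = 2 * n / (4 * n - 3)" unfolding cn by (simp add: \<beta>_def)
    finally have ea: "1 / 2 * e * \<alpha> = 2 * n / (4 * n - 3)" .
    have "B powr \<alpha> * E powr \<beta> = C0 powr \<alpha> * (A powr (1 / 2 * e * \<alpha>) * E powr (1 / 2 * e * \<alpha>)) * E powr \<beta>"
      unfolding B_def S_def C0_def[symmetric] by (simp only: powr_mult powr_powr mult.assoc)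
    also have "\<dots> = C0 powr \<alpha> * A powr (2 * n / (4 * n - 3)) * E powr (2 * n / (4 * n - 3) + \<beta>)"
      unfolding ea by (simp only: powr_add mult.assoc)
    also have "2 * n / (4 * n - 3) + \<beta> = (2 * n + 1) / (4 * n - 3)" by (simp add: \<beta>_def add_divide_distrib)
    finally have "A \<le> C0 powr \<alpha> * A powr (2 * n / (4 * n - 3)) * E powr ((2 * n + 1) / (4 * n - 3))"
      using main by simp
    then have "A powr 1 / A powr (2 * n / (4 * n - 3)) \<le> C0 powr \<alpha> * E powr ((2 * n + 1) / (4 * n - 3))"
      using A by (simp add: divide_le_eq mult_ac)
    also have "A powr 1 / A powr (2 * n / (4 * n - 3)) = A powr ((2 * n - 3) / (4 * n - 3))"
    proof -
      have "1 - 2 * n / (4 * n - 3) = (2 * n - 3) / (4 * n - 3)" using n by (simp add: field_simps)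
      then show ?thesis by (simp only: powr_diff[symmetric])
    qed
    finally have "(A powr ((2 * n - 3) / (4 * n - 3))) powr ((4 * n - 3) / (2 * n + 1))
        \<le> (C0 powr \<alpha> * E powr ((2 * n + 1) / (4 * n - 3))) powr ((4 * n - 3) / (2 * n + 1))"
      using n by (intro powr_mono2) auto
    also have "\<dots> = C0 powr (\<alpha> * ((4 * n - 3) / (2 * n + 1))) * E powr ((2 * n + 1) / (4 * n - 3) * ((4 * n - 3) / (2 * n + 1)))"
      by (simp only: powr_mult powr_powr)
    also have "(2 * n + 1) / (4 * n - 3) * ((4 * n - 3) / (2 * n + 1)) = 1" using n by simp
    also have "\<alpha> * ((4 * n - 3) / (2 * n + 1)) = 4 * (n - 1) / (2 * n + 1)" using n by (simp add: \<alpha>_def)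
    also have "(A powr ((2 * n - 3) / (4 * n - 3))) powr ((4 * n - 3) / (2 * n + 1)) = A powr (2 / p)"
    proof -
      have "(2 * n - 3) / (4 * n - 3) * ((4 * n - 3) / (2 * n + 1)) = (2 * n - 3) / (2 * n + 1)"
        using n by simp
      also have "\<dots> = 2 / (2 * ((2 * n + 1) / (2 * n - 3)))" by (simp del: times_divide_eq_right)
      also have "2 * ((2 * n + 1) / (2 * n - 3)) = p" by (simp add: p)
      finally have "(2 * n - 3) / (4 * n - 3) * ((4 * n - 3) / (2 * n + 1)) = 2 / p" .
      then show ?thesis by (simp only: powr_powr)
    qed
    finally show ?thesis using E by (simp add: const)
  qed
  then show "(LINT x|lborel. \<bar>u x\<bar> powr p) powr (2 / p) \<le> sobolev_const CARD('n) * (LINT x|lborel. energy_density x)"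
    by (simp add: A_def E_def Up_def)
qed

end

section \<open>Passage to the Sobolev space\<close>

lemma has_weak_grad_weak_grad: "has_weak_grad \<Omega> u g \<Longrightarrow> has_weak_grad \<Omega> u (weak_grad \<Omega> u)"
  unfolding weak_grad_def by (rule someI[of "has_weak_grad \<Omega> u"])

text \<open>The ball is exhausted by compact concentric balls.\<close>
lemma locally_integrable_measurable:
  fixes f :: "real ^ 'n \<Rightarrow> 'b::euclidean_space"
  assumes "locally_integrable (ball 0 1) f"
  shows "f \<in> borel_measurable (lebesgue_on (ball 0 1))"
proof (rule borel_measurable_LIMSEQ_metric)
  define B where "B n = cball (0::real^'n) (1 - 1 / real (Suc n))" for n
  have "B n \<subseteq> ball 0 1" for n
  proof
    fix x assume "x \<in> B n"
    moreover have "0 < 1 / real (Suc n)" by simp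
    ultimately have "norm x < 1" unfolding B_def mem_cball_0 by linarith
    then show "x \<in> ball 0 1" by simp
  qed
  moreover have "compact (B n)" for n by (simp add: B_def)
  ultimately have "f absolutely_integrable_on B n" for n
    using assms by (simp add: locally_integrable_def)
  then have "integrable lebesgue (\<lambda>x. indicator (B n) x *\<^sub>R f x)" for n by (simp add: set_integrable_def)
  then have "(\<lambda>x. indicator (B n) x *\<^sub>R f x) \<in> borel_measurable lebesgue" for n by (rule borel_measurable_integrable)
  then show "(\<lambda>x. indicator (B n) x *\<^sub>R f x) \<in> borel_measurable (lebesgue_on (ball 0 1))" for n
    by (rule measurable_restrict_space1)
  fix x :: "real ^ 'n" assume "x \<in> space (lebesgue_on (ball 0 1))"
  then have x: "norm x < 1" by simp
  obtain n0 where n0: "inverse (real (Suc n0)) < 1 - norm x" using reals_Archimedean[of "1 - norm x"] x by auto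
  have "x \<in> B n" if "n \<ge> n0" for n
  proof -
    have "1 / real (Suc n) \<le> inverse (real (Suc n0))" using that by (simp add: field_simps)
    then show ?thesis using n0 by (simp add: B_def)
  qed
  then have "eventually (\<lambda>n. indicator (B n) x *\<^sub>R f x = f x) sequentially"
    by (auto simp: eventually_sequentially indicator_def)
  then show "(\<lambda>n. indicator (B n) x *\<^sub>R f x) \<longlonglongrightarrow> f x" by (rule tendsto_eventually)
qed

lemma ang_form_parallelogram:
  "ang_form i j x (a + b) + ang_form i j x (a - b) = 2 * ang_form i j x a + 2 * ang_form i j x b"
proof -
  have "(norm (a + b))\<^sup>2 + (norm (a - b))\<^sup>2 = 2 * (norm a)\<^sup>2 + 2 * (norm b)\<^sup>2"
    by (simp add: power2_norm_eq_inner inner_add_left inner_add_right inner_diff_left inner_diff_right)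
  moreover have "(x $ i * (a + b) $ j - x $ j * (a + b) $ i)\<^sup>2 + (x $ i * (a - b) $ j - x $ j * (a - b) $ i)\<^sup>2
     = 2 * (x $ i * a $ j - x $ j * a $ i)\<^sup>2 + 2 * (x $ i * b $ j - x $ j * b $ i)\<^sup>2"
    by (simp add: power2_eq_square algebra_simps)
  ultimately show ?thesis by (simp add: ang_form_def algebra_simps)
qed

text \<open>The parallelogram law, and the form is nonnegative at a - b.\<close>
lemma ang_form_add_le:
  assumes "i \<noteq> j" "(x $ i)\<^sup>2 + (x $ j)\<^sup>2 \<le> 1"
  shows "ang_form i j x (a + b) \<le> 2 * ang_form i j x a + 2 * (norm b)\<^sup>2"
  using ang_form_parallelogram[of i j x a b] ang_form_nonneg[OF assms, of "a - b"] ang_form_le[of i j x b] by linarith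

lemma ball_coord_le_1:
  fixes x :: "real ^ 'n"
  assumes "i \<noteq> j" "x \<in> ball 0 1"
  shows "(x $ i)\<^sup>2 + (x $ j)\<^sup>2 \<le> 1"
proof -
  have "(norm x)\<^sup>2 \<le> 1" using assms(2) by (simp add: power_le_one)
  moreover have "(x $ i)\<^sup>2 + (x $ j)\<^sup>2 \<le> (norm x)\<^sup>2"
    using norm_sq_split[OF assms(1), of x] by (simp add: sum_nonneg)
  ultimately show ?thesis by simp
qed

lemma energy_eq_ang_form:
  "energy i j u = (LINT x|lebesgue_on unit_ball. ang_form i j x (weak_grad unit_ball u x))"
  by (simp add: energy_def weak_angular_deriv_def ang_form_def)

lemma ang_form_measurable:
  fixes G :: "real ^ 'n \<Rightarrow> real ^ 'n"
  assumes "G \<in> borel_measurable (lebesgue_on S)"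
  shows "(\<lambda>x. ang_form i j x (G x)) \<in> borel_measurable (lebesgue_on S)"
proof -
  have "continuous_on UNIV (\<lambda>p. ang_form i j (fst p) (snd p) :: real)"
    unfolding ang_form_def by (intro continuous_intros)
  then have "(\<lambda>p. ang_form i j (fst p) (snd p)) \<in> borel_measurable (borel \<Otimes>\<^sub>M borel)"
    by (subst borel_prod) (rule borel_measurable_continuous_onI)
  moreover have "(\<lambda>x. x) \<in> borel_measurable (lebesgue_on S)"
    by (intro measurable_restrict_space1 measurable_completion) simp
  ultimately have "(\<lambda>x. (\<lambda>p. ang_form i j (fst p) (snd p)) (x, G x)) \<in> borel_measurable (lebesgue_on S)"
    by (intro measurable_compose[OF measurable_Pair[OF _ assms]])
  then show ?thesis by simp
qed

lemma weak_grad_measurable: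
  fixes u :: "real ^ 'n \<Rightarrow> real"
  assumes "has_weak_grad unit_ball u g"
  shows "u \<in> borel_measurable (lebesgue_on unit_ball)" "g \<in> borel_measurable (lebesgue_on unit_ball)"
  using assms by (auto simp: has_weak_grad_def intro: locally_integrable_measurable)

lemma lebesgue_on_eq_lborel_of_support:
  fixes f :: "'a::euclidean_space \<Rightarrow> 'b::euclidean_space"
  assumes "\<Omega> \<in> sets lebesgue" "f \<in> borel_measurable borel" "K \<subseteq> \<Omega>" "\<And>x. x \<notin> K \<Longrightarrow> f x = 0"
  shows "integrable (lebesgue_on \<Omega>) f \<longleftrightarrow> integrable lborel f" "(LINT x|lebesgue_on \<Omega>. f x) = (LINT x|lborel. f x)"
proof -
  have z: "f x = 0" if "x \<notin> \<Omega>" for x using assms(3,4) that by blast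
  show "integrable (lebesgue_on \<Omega>) f \<longleftrightarrow> integrable lborel f" "(LINT x|lebesgue_on \<Omega>. f x) = (LINT x|lborel. f x)"
    by (rule lebesgue_on_eq_lborel[OF assms(1,2) z]; assumption)+
qed

lemma test_function_energy:
  fixes \<phi> :: "real ^ 'n \<Rightarrow> real"
  assumes \<phi>: "\<phi> \<in> test_functions unit_ball" and ij: "i \<noteq> j"
  shows "energy i j \<phi> = (LINT x|lborel. ang_form i j x (grad \<phi> x))"
    and "integrable (lebesgue_on unit_ball) (\<lambda>x. ang_form i j x (grad \<phi> x))"
    and "energy i j \<phi> = (LINT x|lebesgue_on unit_ball. ang_form i j x (grad \<phi> x))"
proof -
  obtain K where K: "compact K" "K \<subseteq> unit_ball" "\<And>x. x \<notin> K \<Longrightarrow> \<phi> x = 0" "\<And>x. x \<notin> K \<Longrightarrow> grad \<phi> x = 0"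
    using test_function_support[OF \<phi>] by blast
  let ?q = "\<lambda>x. ang_form i j x (grad \<phi> x)"
  have c: "continuous_on UNIV ?q"
    unfolding ang_form_def by (intro continuous_intros test_function_smooth[OF \<phi>])
  have q0: "?q x = 0" if "x \<notin> K" for x using K(4)[OF that] by (simp add: ang_form_def)
  have w: "has_weak_grad unit_ball \<phi> (grad \<phi>)" by (rule has_weak_grad_test_function[OF \<phi>]) simp
  have "AE x in lebesgue_on unit_ball. weak_grad unit_ball \<phi> x = grad \<phi> x"
    by (rule weak_grad_AE_eq[OF open_ball w])
  then show e: "energy i j \<phi> = (LINT x|lebesgue_on unit_ball. ?q x)"
    unfolding energy_eq_ang_form
    by (intro integral_cong_AE ang_form_measurable weak_grad_measurable[OF w]
        weak_grad_measurable[OF has_weak_grad_weak_grad[OF w]]) auto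
  have eq: "integrable (lebesgue_on unit_ball) ?q \<longleftrightarrow> integrable lborel ?q"
     "(LINT x|lebesgue_on unit_ball. ?q x) = (LINT x|lborel. ?q x)"
    by (rule lebesgue_on_eq_lborel_of_support[OF _ borel_measurable_continuous_onI[OF c] K(2) q0]; simp)+
  show "energy i j \<phi> = (LINT x|lborel. ?q x)" unfolding e eq ..
  show "integrable (lebesgue_on unit_ball) ?q"
    unfolding eq by (rule integrable_lborel_of_compact_support[OF K(1) c q0])
qed

lemma test_function_Sobolev:
  fixes \<phi> :: "real ^ 'n \<Rightarrow> real"
  assumes \<phi>: "\<phi> \<in> test_functions unit_ball" and ij: "i \<noteq> j"
  defines "p \<equiv> crit_exp CARD('n)"
  shows "integrable (lebesgue_on unit_ball) (\<lambda>x. \<bar>\<phi> x\<bar> powr p)"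
    and "(LINT x|lebesgue_on unit_ball. \<bar>\<phi> x\<bar> powr p) powr (2 / p) \<le> sobolev_const CARD('n) * energy i j \<phi>"
proof -
  obtain K where K: "compact K" "K \<subseteq> unit_ball" "\<And>x. x \<notin> K \<Longrightarrow> \<phi> x = 0" "\<And>x. x \<notin> K \<Longrightarrow> grad \<phi> x = 0"
    using test_function_support[OF \<phi>] by blast
  interpret C1_in_ball \<phi> "grad \<phi>" K i j
    by unfold_locales (fact ij K test_function_smooth[OF \<phi>] has_derivative_grad[OF test_function_smooth(1)[OF \<phi>]])+
  have m: "(\<lambda>x. \<bar>\<phi> x\<bar> powr p) \<in> borel_measurable borel"
    using borel_measurable_continuous_onI[OF contu] by (rule measurable_abs_powr)
  have eq: "integrable (lebesgue_on unit_ball) (\<lambda>x. \<bar>\<phi> x\<bar> powr p) \<longleftrightarrow> integrable lborel (\<lambda>x. \<bar>\<phi> x\<bar> powr p)"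
     "(LINT x|lebesgue_on unit_ball. \<bar>\<phi> x\<bar> powr p) = (LINT x|lborel. \<bar>\<phi> x\<bar> powr p)"
    by (rule lebesgue_on_eq_lborel_of_support[OF _ m K(2)]; simp add: u0)+
  show "integrable (lebesgue_on unit_ball) (\<lambda>x. \<bar>\<phi> x\<bar> powr p)"
    unfolding eq(1) using critical_Sobolev(1) by (simp add: p_def)
  show "(LINT x|lebesgue_on unit_ball. \<bar>\<phi> x\<bar> powr p) powr (2 / p) \<le> sobolev_const CARD('n) * energy i j \<phi>"
    unfolding eq test_function_energy(1)[OF \<phi> ij] using critical_Sobolev(2) by (simp add: p_def energy_density_def)
qed

lemma integral_le_of_sqrt_add_tendsto_0:
  assumes "(\<lambda>k. sqrt (a k + b k)) \<longlonglongrightarrow> 0" "\<And>k. 0 \<le> a k" "\<And>k::nat. 0 \<le> (b k :: real)"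
  shows "a \<longlonglongrightarrow> 0" "b \<longlonglongrightarrow> 0"
proof -
  have "(\<lambda>k. (sqrt (a k + b k))\<^sup>2) \<longlonglongrightarrow> 0\<^sup>2" by (intro tendsto_power assms)
  then have s: "(\<lambda>k. a k + b k) \<longlonglongrightarrow> 0" using assms(2,3) by simp
  show "a \<longlonglongrightarrow> 0" by (rule tendsto_sandwich[OF _ _ tendsto_const s]) (use assms in auto)
  show "b \<longlonglongrightarrow> 0" by (rule tendsto_sandwich[OF _ _ tendsto_const s]) (use assms in auto)
qed

lemma ang_form_weak_grad_integrable:
  fixes u :: "real ^ 'n \<Rightarrow> real"
  assumes u: "u \<in> H1 unit_ball" and ij: "i \<noteq> j"
  shows "integrable (lebesgue_on unit_ball) (\<lambda>x. ang_form i j x (weak_grad unit_ball u x))"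
proof (rule Bochner_Integration.integrable_bound)
  obtain g where g: "has_weak_grad unit_ball u g" using u by (auto simp: H1_def)
  show "integrable (lebesgue_on unit_ball) (\<lambda>x. (norm (weak_grad unit_ball u x))\<^sup>2)" using u by (simp add: H1_def)
  show "(\<lambda>x. ang_form i j x (weak_grad unit_ball u x)) \<in> borel_measurable (lebesgue_on unit_ball)"
    by (intro ang_form_measurable weak_grad_measurable[OF has_weak_grad_weak_grad[OF g]])
  show "AE x in lebesgue_on unit_ball. norm (ang_form i j x (weak_grad unit_ball u x)) \<le> norm ((norm (weak_grad unit_ball u x))\<^sup>2)"
    using ang_form_nonneg[OF ij ball_coord_le_1[OF ij]] ang_form_le by (intro AE_I2) simp
qed

lemma energy_nonneg:
  assumes "i \<noteq> j"
  shows "0 \<le> energy i j u"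
  unfolding energy_eq_ang_form
  by (rule integral_nonneg_AE, rule AE_I2) (use ang_form_nonneg[OF assms ball_coord_le_1[OF assms]] in simp)

text \<open>The constant sequence approximates.\<close>
lemma test_functions_subset_H10: "test_functions unit_ball \<subseteq> H10 unit_ball"
proof
  fix \<phi> :: "real ^ 'n \<Rightarrow> real" assume \<phi>: "\<phi> \<in> test_functions unit_ball"
  obtain K where K: "compact K" "K \<subseteq> unit_ball" "\<And>x. x \<notin> K \<Longrightarrow> \<phi> x = 0" "\<And>x. x \<notin> K \<Longrightarrow> grad \<phi> x = 0"
    using test_function_support[OF \<phi>] by blast
  note S = test_function_smooth[OF \<phi>]
  have w: "has_weak_grad unit_ball \<phi> (grad \<phi>)" by (rule has_weak_grad_test_function[OF \<phi>]) simp
  have int: "integrable (lebesgue_on unit_ball) f" if "continuous_on UNIV f" "\<And>x. x \<notin> K \<Longrightarrow> f x = 0" for f :: "real ^ 'n \<Rightarrow> real"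
    using integrable_lborel_of_compact_support[OF K(1) that]
      lebesgue_on_eq_lborel_of_support(1)[OF _ borel_measurable_continuous_onI[OF that(1)] K(2) that(2)] by simp
  have "integrable (lebesgue_on unit_ball) (\<lambda>x. (norm (grad \<phi> x))\<^sup>2)"
    by (rule int) (auto intro!: continuous_intros S simp: K(4))
  moreover have "AE x in lebesgue_on unit_ball. weak_grad unit_ball \<phi> x = grad \<phi> x"
    by (rule weak_grad_AE_eq[OF open_ball w])
  then have ae: "AE x in lebesgue_on unit_ball. (norm (grad \<phi> x))\<^sup>2 = (norm (weak_grad unit_ball \<phi> x))\<^sup>2" by eventually_elim simp
  have [measurable]: "grad \<phi> \<in> borel_measurable (lebesgue_on unit_ball)"
    "weak_grad unit_ball \<phi> \<in> borel_measurable (lebesgue_on unit_ball)"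
    by (rule weak_grad_measurable(2)[OF w]) (rule weak_grad_measurable(2)[OF has_weak_grad_weak_grad[OF w]])
  have "(\<lambda>x. (norm (weak_grad unit_ball \<phi> x))\<^sup>2) \<in> borel_measurable (lebesgue_on unit_ball)" by measurable
  ultimately have "integrable (lebesgue_on unit_ball) (\<lambda>x. (norm (weak_grad unit_ball \<phi> x))\<^sup>2)"
    using ae by (rule integrable_cong_AE_imp)
  moreover have "integrable (lebesgue_on unit_ball) (\<lambda>x. (\<phi> x)\<^sup>2)"
    by (rule int) (auto intro!: continuous_intros S simp: K(3))
  ultimately have H1: "\<phi> \<in> H1 unit_ball" using w by (auto simp: H1_def)
  have "has_weak_grad unit_ball (\<lambda>x. \<phi> x - \<phi> x) (\<lambda>x. grad \<phi> x - grad \<phi> x)"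
    by (rule has_weak_grad_diff[OF _ w w]) simp
  then have "AE x in lebesgue_on unit_ball. weak_grad unit_ball (\<lambda>x. \<phi> x - \<phi> x) x = grad \<phi> x - grad \<phi> x"
    by (rule weak_grad_AE_eq[OF open_ball])
  then have "AE x in lebesgue_on unit_ball. (norm (weak_grad unit_ball (\<lambda>x. \<phi> x - \<phi> x) x))\<^sup>2 = 0" by eventually_elim simp
  then have "(LINT x|lebesgue_on unit_ball. (norm (weak_grad unit_ball (\<lambda>x. \<phi> x - \<phi> x) x))\<^sup>2) = 0"
    by (rule integral_eq_zero_AE)
  then have "H1_norm unit_ball (\<lambda>x. \<phi> x - \<phi> x) = 0" by (simp add: H1_norm_def)
  then show "\<phi> \<in> H10 unit_ball" using H1 \<phi> unfolding H10_def by (auto intro!: exI[of _ "\<lambda>_. \<phi>"])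
qed

text \<open>The factor 2 is harmless for the existence of a constant and spares the convergence of the energies.\<close>
lemma energy_approx:
  fixes u \<phi> :: "real ^ 'n \<Rightarrow> real"
  assumes u: "u \<in> H1 unit_ball" and \<phi>: "\<phi> \<in> test_functions unit_ball" and ij: "i \<noteq> j"
  shows "energy i j \<phi> \<le> 2 * energy i j u + 2 * (LINT x|lebesgue_on unit_ball. (norm (weak_grad unit_ball (\<lambda>x. u x - \<phi> x) x))\<^sup>2)"
proof -
  let ?L = "lebesgue_on (unit_ball :: (real ^ 'n) set)"
  let ?G = "weak_grad unit_ball u" and ?D = "weak_grad unit_ball (\<lambda>x. u x - \<phi> x)"
  obtain g where "has_weak_grad unit_ball u g" using u by (auto simp: H1_def)
  then have G: "has_weak_grad unit_ball u ?G" by (rule has_weak_grad_weak_grad)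
  have w: "has_weak_grad unit_ball \<phi> (grad \<phi>)" by (rule has_weak_grad_test_function[OF \<phi>]) simp
  have d: "has_weak_grad unit_ball (\<lambda>x. u x - \<phi> x) (\<lambda>x. ?G x - grad \<phi> x)"
    by (rule has_weak_grad_diff[OF _ G w]) simp
  have D: "AE x in ?L. ?D x = ?G x - grad \<phi> x" by (rule weak_grad_AE_eq[OF open_ball d])
  have [measurable]: "?G \<in> borel_measurable ?L" "?D \<in> borel_measurable ?L" "grad \<phi> \<in> borel_measurable ?L"
    by (rule weak_grad_measurable(2)[OF G] weak_grad_measurable(2)[OF has_weak_grad_weak_grad[OF d]] weak_grad_measurable(2)[OF w])+
  have iD: "integrable ?L (\<lambda>x. (norm (?D x))\<^sup>2)"
  proof (rule Bochner_Integration.integrable_bound)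
    have "\<phi> \<in> H1 unit_ball" using test_functions_subset_H10 \<phi> by (auto simp: H10_def)
    then show "integrable ?L (\<lambda>x. 2 * (norm (?G x))\<^sup>2 + 2 * (norm (weak_grad unit_ball \<phi> x))\<^sup>2)" using u by (auto simp: H1_def)
    have "AE x in ?L. weak_grad unit_ball \<phi> x = grad \<phi> x" by (rule weak_grad_AE_eq[OF open_ball w])
    then show "AE x in ?L. norm ((norm (?D x))\<^sup>2) \<le> norm (2 * (norm (?G x))\<^sup>2 + 2 * (norm (weak_grad unit_ball \<phi> x))\<^sup>2)"
      using D
    proof eventually_elim
      case (elim x)
      have "(norm (?G x + grad \<phi> x))\<^sup>2 + (norm (?G x - grad \<phi> x))\<^sup>2 = 2 * (norm (?G x))\<^sup>2 + 2 * (norm (grad \<phi> x))\<^sup>2"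
        by (simp add: power2_norm_eq_inner inner_add_left inner_add_right inner_diff_left inner_diff_right)
      moreover have "0 \<le> (norm (?G x + grad \<phi> x))\<^sup>2" by simp
      ultimately have "(norm (?G x - grad \<phi> x))\<^sup>2 \<le> 2 * (norm (?G x))\<^sup>2 + 2 * (norm (grad \<phi> x))\<^sup>2" by linarith
      then show ?case using elim by simp
    qed
  qed measurable
  have "energy i j \<phi> = (LINT x|?L. ang_form i j x (grad \<phi> x))" by (rule test_function_energy(3)[OF \<phi> ij])
  also have "\<dots> \<le> (LINT x|?L. 2 * ang_form i j x (?G x) + 2 * (norm (?D x))\<^sup>2)"
  proof (rule integral_mono_AE)
    show "integrable ?L (\<lambda>x. ang_form i j x (grad \<phi> x))" by (rule test_function_energy(2)[OF \<phi> ij])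
    show "integrable ?L (\<lambda>x. 2 * ang_form i j x (?G x) + 2 * (norm (?D x))\<^sup>2)"
      using iD ang_form_weak_grad_integrable[OF u ij] by simp
    have "AE x in ?L. x \<in> unit_ball" by (rule AE_I2) simp
    then show "AE x in ?L. ang_form i j x (grad \<phi> x) \<le> 2 * ang_form i j x (?G x) + 2 * (norm (?D x))\<^sup>2"
      using D
    proof eventually_elim
      case (elim x)
      then show ?case using ang_form_add_le[OF ij ball_coord_le_1[OF ij], of x "?G x" "- ?D x"]
        by (simp add: norm_minus_commute)
    qed
  qed
  also have "\<dots> = 2 * energy i j u + 2 * (LINT x|?L. (norm (?D x))\<^sup>2)"
    using iD ang_form_weak_grad_integrable[OF u ij] by (simp add: energy_eq_ang_form)
  finally show ?thesis .
qed

text \<open>Fatou's lemma along a subsequence of the approximating test functions that converges almost everywhere.\<close>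
lemma H10_Sobolev:
  fixes u :: "real ^ 'n \<Rightarrow> real"
  assumes u: "u \<in> H10 unit_ball" and ij: "i \<noteq> j"
  defines "p \<equiv> crit_exp CARD('n)"
  shows "integrable (lebesgue_on unit_ball) (\<lambda>x. \<bar>u x\<bar> powr p)"
    and "(LINT x|lebesgue_on unit_ball. \<bar>u x\<bar> powr p) powr (2 / p) \<le> 2 * sobolev_const CARD('n) * energy i j u"
proof -
  let ?L = "lebesgue_on (unit_ball :: (real ^ 'n) set)"
  define C where "C = sobolev_const CARD('n)"
  have N: "2 \<le> CARD('n)" using two_le_CARD[OF ij] by simp
  then have C: "0 < C" by (simp add: C_def sobolev_const_pos)
  have p: "0 < p" using N by (simp add: p_def crit_exp_def)
  obtain \<phi> where \<phi>: "\<And>k::nat. \<phi> k \<in> test_functions unit_ball" and lim: "(\<lambda>k. H1_norm unit_ball (\<lambda>x. u x - \<phi> k x)) \<longlonglongrightarrow> 0"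
    using u by (auto simp: H10_def)
  have u1: "u \<in> H1 unit_ball" using u by (simp add: H10_def)
  then obtain g where g: "has_weak_grad unit_ball u g" by (auto simp: H1_def)
  have um[measurable]: "u \<in> borel_measurable ?L" by (rule weak_grad_measurable(1)[OF g])
  have \<phi>m[measurable]: "\<phi> k \<in> borel_measurable ?L" for k
    by (rule weak_grad_measurable(1)[OF has_weak_grad_test_function[OF \<phi>]]) simp
  define a where "a k = (LINT x|?L. (u x - \<phi> k x)\<^sup>2)" for k
  define \<delta> where "\<delta> k = (LINT x|?L. (norm (weak_grad unit_ball (\<lambda>x. u x - \<phi> k x) x))\<^sup>2)" for k
  have "(\<lambda>k. sqrt (a k + \<delta> k)) \<longlonglongrightarrow> 0" using lim by (simp add: H1_norm_def a_def \<delta>_def)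
  then have a0: "a \<longlonglongrightarrow> 0" and \<delta>0: "\<delta> \<longlonglongrightarrow> 0"
    by (rule integral_le_of_sqrt_add_tendsto_0; simp add: a_def \<delta>_def)+
  have int: "integrable ?L (\<lambda>x. (u x - \<phi> k x)\<^sup>2)" for k
  proof (rule Bochner_Integration.integrable_bound)
    have "\<phi> k \<in> H1 unit_ball" using test_functions_subset_H10 \<phi>[of k] by (auto simp: H10_def)
    then show "integrable ?L (\<lambda>x. 2 * (u x)\<^sup>2 + 2 * (\<phi> k x)\<^sup>2)" using u1 by (auto simp: H1_def)
    show "AE x in ?L. norm ((u x - \<phi> k x)\<^sup>2) \<le> norm (2 * (u x)\<^sup>2 + 2 * (\<phi> k x)\<^sup>2)"
    proof (rule AE_I2)
      fix x
      have "0 \<le> (u x + \<phi> k x)\<^sup>2" by simp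
      then show "norm ((u x - \<phi> k x)\<^sup>2) \<le> norm (2 * (u x)\<^sup>2 + 2 * (\<phi> k x)\<^sup>2)"
        unfolding real_norm_def abs_power2 by (simp add: power2_sum power2_diff)
    qed
  qed measurable
  obtain r where r: "strict_mono r" "AE x in ?L. (\<lambda>n. (u x - \<phi> (r n) x)\<^sup>2) \<longlonglongrightarrow> 0"
    using tendsto_L1_AE_subseq[of ?L "\<lambda>k x. (u x - \<phi> k x)\<^sup>2"] int a0 by (auto simp: a_def[abs_def])
  define X where "X k = C * (2 * energy i j u + 2 * \<delta> k)" for k
  have X0: "0 \<le> X k" for k using C energy_nonneg[OF ij] by (simp add: X_def \<delta>_def)
  have bound: "(\<integral>\<^sup>+x. ennreal (\<bar>\<phi> k x\<bar> powr p) \<partial>?L) \<le> ennreal (X k powr (p / 2))" for k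
  proof -
    define I where "I = (LINT x|?L. \<bar>\<phi> k x\<bar> powr p)"
    have I0: "0 \<le> I" unfolding I_def by (rule integral_nonneg_AE) simp
    have "I powr (2 / p) \<le> C * energy i j (\<phi> k)"
      unfolding I_def C_def p_def by (rule test_function_Sobolev(2)[OF \<phi> ij])
    also have "\<dots> \<le> X k" unfolding X_def \<delta>_def using C by (intro mult_left_mono energy_approx u1 \<phi> ij) simp
    finally have "(I powr (2 / p)) powr (p / 2) \<le> X k powr (p / 2)" using p by (intro powr_mono2) auto
    then have "I \<le> X k powr (p / 2)" using p I0 by (simp add: powr_powr)
    moreover have "(\<integral>\<^sup>+x. ennreal (\<bar>\<phi> k x\<bar> powr p) \<partial>?L) = ennreal I"
      unfolding I_def using test_function_Sobolev(1)[OF \<phi> ij] by (intro nn_integral_eq_integral) (auto simp: p_def)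
    ultimately show ?thesis by (simp add: ennreal_leI)
  qed
  have "(\<integral>\<^sup>+x. ennreal (\<bar>u x\<bar> powr p) \<partial>?L) \<le> (\<integral>\<^sup>+x. liminf (\<lambda>n. ennreal (\<bar>\<phi> (r n) x\<bar> powr p)) \<partial>?L)"
  proof (rule nn_integral_mono_AE)
    show "AE x in ?L. ennreal (\<bar>u x\<bar> powr p) \<le> liminf (\<lambda>n. ennreal (\<bar>\<phi> (r n) x\<bar> powr p))"
      using r(2)
    proof eventually_elim
      case (elim x)
      have "(\<lambda>n. sqrt ((u x - \<phi> (r n) x)\<^sup>2)) \<longlonglongrightarrow> sqrt 0" by (intro tendsto_real_sqrt elim)
      then have "(\<lambda>n. u x - \<phi> (r n) x) \<longlonglongrightarrow> 0" by (simp add: tendsto_rabs_zero_iff)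
      from tendsto_diff[OF tendsto_const[of "u x"] this] have "(\<lambda>n. \<phi> (r n) x) \<longlonglongrightarrow> u x" by simp
      then have "(\<lambda>n. \<bar>\<phi> (r n) x\<bar> powr p) \<longlonglongrightarrow> \<bar>u x\<bar> powr p"
        using p by (intro tendsto_powr2 tendsto_intros) auto
      then have "(\<lambda>n. ennreal (\<bar>\<phi> (r n) x\<bar> powr p)) \<longlonglongrightarrow> ennreal (\<bar>u x\<bar> powr p)" by (rule tendsto_ennrealI)
      then have "liminf (\<lambda>n. ennreal (\<bar>\<phi> (r n) x\<bar> powr p)) = ennreal (\<bar>u x\<bar> powr p)"
        by (intro lim_imp_Liminf) simp_all
      then show ?case by simp
    qed
  qed
  also have "\<dots> \<le> liminf (\<lambda>n. \<integral>\<^sup>+x. ennreal (\<bar>\<phi> (r n) x\<bar> powr p) \<partial>?L)"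
    by (rule nn_integral_liminf) measurable
  also have "\<dots> \<le> liminf (\<lambda>n. ennreal (X (r n) powr (p / 2)))"
    by (intro Liminf_mono always_eventually allI bound)
  also have "\<dots> = ennreal ((C * (2 * energy i j u + 2 * 0)) powr (p / 2))"
  proof (rule lim_imp_Liminf)
    have "(\<lambda>n. \<delta> (r n)) \<longlonglongrightarrow> 0" using LIMSEQ_subseq_LIMSEQ[OF \<delta>0 r(1)] by (simp add: comp_def)
    then have "(\<lambda>n. X (r n) powr (p / 2)) \<longlonglongrightarrow> (C * (2 * energy i j u + 2 * 0)) powr (p / 2)"
      unfolding X_def using p X0 by (intro tendsto_powr2 tendsto_intros) (auto simp: X_def)
    then show "(\<lambda>n. ennreal (X (r n) powr (p / 2))) \<longlonglongrightarrow> ennreal ((C * (2 * energy i j u + 2 * 0)) powr (p / 2))"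
      by (rule tendsto_ennrealI)
  qed simp
  finally have fin: "(\<integral>\<^sup>+x. ennreal (\<bar>u x\<bar> powr p) \<partial>?L) \<le> ennreal ((2 * C * energy i j u) powr (p / 2))" by (simp add: mult_ac)
  show i: "integrable ?L (\<lambda>x. \<bar>u x\<bar> powr p)"
    by (rule integrableI_bounded) (use fin in \<open>auto intro: le_less_trans\<close>)
  define I where "I = (LINT x|?L. \<bar>u x\<bar> powr p)"
  have "ennreal I = (\<integral>\<^sup>+x. ennreal (\<bar>u x\<bar> powr p) \<partial>?L)"
    unfolding I_def by (rule nn_integral_eq_integral[OF i, symmetric]) simp
  then have "ennreal I \<le> ennreal ((2 * C * energy i j u) powr (p / 2))" using fin by simp
  then have "I \<le> (2 * C * energy i j u) powr (p / 2)" by (simp add: ennreal_le_iff)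
  moreover have "0 \<le> I" unfolding I_def by (rule integral_nonneg_AE) simp
  ultimately have "I powr (2 / p) \<le> ((2 * C * energy i j u) powr (p / 2)) powr (2 / p)"
    using p by (intro powr_mono2) auto
  also have "\<dots> = 2 * C * energy i j u" using p C energy_nonneg[OF ij, of u] by (simp add: powr_powr)
  finally show "(LINT x|?L. \<bar>u x\<bar> powr p) powr (2 / p) \<le> 2 * sobolev_const CARD('n) * energy i j u"
    by (simp add: I_def C_def)
qed

section \<open>Concentrating test functions\<close>

text \<open>Outside the open box, including its boundary, the function attains its minimum 0.\<close>
lemma grad_box_bump_eq_0:
  assumes m: "\<And>k. 0 < m $ k" and ab: "\<And>k. a $ k \<le> b $ k" and x: "x \<notin> box a b"
  shows "grad (box_bump m a b) x = 0"
proof -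
  have diff: "box_bump m a b differentiable (at x)" for x using Ck_box_bump[of "Suc 0" m a b] by simp
  have "grad (box_bump m a b) x $ k = 0" for k
  proof -
    have d: "((\<lambda>s. box_bump m a b (x + s *\<^sub>R axis k 1)) has_real_derivative grad (box_bump m a b) x $ k) (at 0)"
      using has_derivative_grad_line[of "box_bump m a b" x 0 "axis k 1"] diff by (simp add: inner_axis)
    show ?thesis
      by (rule DERIV_local_min[OF d zero_less_one])
         (simp add: box_bump_eq_0[OF m ab x] box_bump_nonneg)
  qed
  then show ?thesis by (simp add: vec_eq_iff)
qed

lemma content_cbox_center:
  fixes z w :: "real ^ 'n"
  assumes "\<And>k. 0 \<le> w $ k"
  shows "measure lborel (cbox (z - w) (z + w)) = 2 ^ CARD('n) * (\<Prod>k\<in>UNIV. w $ k)"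
proof -
  have "z \<in> cbox (z - w) (z + w)" using assms by (simp add: mem_box_cart)
  then have "measure lborel (cbox (z - w) (z + w)) = (\<Prod>k\<in>UNIV. (z + w) $ k - (z - w) $ k)"
    by (intro content_cbox_cart) auto
  also have "\<dots> = (\<Prod>k\<in>UNIV. 2 * w $ k)" by (intro prod.cong) auto
  finally show ?thesis by (simp add: prod.distrib)
qed

lemma flat_0_ge: "exp (- (4 / 3)) \<le> flat 0 y" if "3 / 4 \<le> y"
proof -
  have "inverse y \<le> 4 / 3" using that le_imp_inverse_le[of "3/4" y] by simp
  then show ?thesis using that by (simp add: flat_def)
qed

text \<open>With x = (1 - 3 s^2) e_i + (terms of size s^2, and s^3 in direction j) the function lives where 1 - r^2 is of order s^2.
The widths balance the parts of the energy: the derivative in direction i is of order s^(-2), and that in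
direction j is of order s^(-3) but enters with the factor 1 - x_i^2 of order s^2 in the square.\<close>
lemma concentrating_test_function:
  fixes i j :: "'n::finite" and s :: real
  defines "N \<equiv> CARD('n)"
  assumes ij: "i \<noteq> j" and s: "0 < s" "s\<^sup>2 * (real N + 4) \<le> 1"
  obtains \<phi> :: "real ^ 'n \<Rightarrow> real" where "\<phi> \<in> test_functions unit_ball"
    "energy i j \<phi> \<le> 64 * (real N + 11) * 2 ^ N * (s ^ (2 * N + 1) / s ^ 4)"
    "\<And>p. 0 < p \<Longrightarrow> integrable (lebesgue_on unit_ball) (\<lambda>x. \<bar>\<phi> x\<bar> powr p)"
    "\<And>p. 0 < p \<Longrightarrow> (exp (- (4 / 3)) ^ N) powr p * s ^ (2 * N + 1) \<le> (LINT x|lebesgue_on unit_ball. \<bar>\<phi> x\<bar> powr p)"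
proof -
  have N: "2 \<le> N" using two_le_CARD[OF ij] by (simp add: N_def)
  define z :: "real ^ 'n" where "z = (\<chi> k. if k = i then 1 - 3 * s\<^sup>2 else 0)"
  define w :: "real ^ 'n" where "w = (\<chi> k. if k = j then s ^ 3 else s\<^sup>2)"
  define m :: "real ^ 'n" where "m = (\<chi> k. 1 / (w $ k)\<^sup>2)"
  define \<phi> where "\<phi> = box_bump m (z - w) (z + w)"
  have w0: "0 < w $ k" for k using s by (simp add: w_def)
  have m0: "0 < m $ k" for k using w0[of k] by (simp add: m_def)
  have ab: "(z - w) $ k \<le> (z + w) $ k" for k using w0[of k] by simp
  have s6: "s\<^sup>2 \<le> 1 / 6"
  proof -
    have "s\<^sup>2 * 6 \<le> s\<^sup>2 * (real N + 4)" using N by (intro mult_left_mono) auto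
    then show ?thesis using s(2) by simp
  qed
  have s1: "s \<le> 1" using s6 by (intro power2_le_imp_le[of s 1]) auto
  have s3: "s ^ 3 \<le> s\<^sup>2" using s s1 by (intro power_decreasing) auto
  have ws: "w $ k \<le> s\<^sup>2" for k using s3 by (simp add: w_def)
  have prodw: "(\<Prod>k\<in>UNIV. w $ k) = s ^ (2 * N + 1)"
  proof -
    have "(\<Prod>k\<in>UNIV. w $ k) = w $ j * (\<Prod>k\<in>UNIV - {j}. w $ k)" by (rule prod.remove) auto
    also have "(\<Prod>k\<in>UNIV - {j}. w $ k) = (\<Prod>k\<in>UNIV - {j}. s\<^sup>2)" by (intro prod.cong) (auto simp: w_def)
    also have "\<dots> = s ^ (2 * (N - 1))" by (simp add: N_def power_mult)
    also have "w $ j * s ^ (2 * (N - 1)) = s ^ (3 + 2 * (N - 1))" by (simp add: w_def power_add)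
    also have "3 + 2 * (N - 1) = 2 * N + 1" using N by simp
    finally show ?thesis .
  qed
  have coord: "\<bar>x $ k - z $ k\<bar> \<le> w $ k" if "x \<in> cbox (z - w) (z + w)" for x k
    using that[unfolded mem_box_cart, rule_format, of k] by (simp add: abs_le_iff)
  have xi: "1 - 4 * s\<^sup>2 \<le> x $ i" "x $ i \<le> 1 - 2 * s\<^sup>2" if "x \<in> cbox (z - w) (z + w)" for x
    using coord[OF that, of i] ij by (auto simp: z_def w_def abs_le_iff)
  have xj: "\<bar>x $ j\<bar> \<le> s ^ 3" if "x \<in> cbox (z - w) (z + w)" for x
    using coord[OF that, of j] ij by (simp add: z_def w_def)
  have sub: "cbox (z - w) (z + w) \<subseteq> (unit_ball :: (real ^ 'n) set)"
  proof
    fix x assume x: "x \<in> cbox (z - w) (z + w)"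
    have "(norm x)\<^sup>2 = (\<Sum>k\<in>UNIV. (x $ k)\<^sup>2)" by (simp add: norm_vec_def L2_set_def sum_nonneg)
    also have "\<dots> = (x $ i)\<^sup>2 + (\<Sum>k\<in>UNIV - {i}. (x $ k)\<^sup>2)" by (rule sum.remove) auto
    also have "(\<Sum>k\<in>UNIV - {i}. (x $ k)\<^sup>2) \<le> (\<Sum>k\<in>UNIV - {i}. (s\<^sup>2)\<^sup>2)"
    proof (rule sum_mono)
      fix k assume "k \<in> UNIV - {i}"
      then have "\<bar>x $ k\<bar> \<le> \<bar>s\<^sup>2\<bar>" using order_trans[OF coord[OF x, of k] ws] by (simp add: z_def)
      then show "(x $ k)\<^sup>2 \<le> (s\<^sup>2)\<^sup>2" by (simp only: abs_le_square_iff)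
    qed
    also have "\<dots> \<le> real N * (s\<^sup>2)\<^sup>2" by (simp add: N_def mult_right_mono)
    also have "(x $ i)\<^sup>2 \<le> (1 - 2 * s\<^sup>2)\<^sup>2" using xi[OF x] s6 by (intro power_mono) auto
    finally have "(norm x)\<^sup>2 \<le> (1 - 2 * s\<^sup>2)\<^sup>2 + real N * (s\<^sup>2)\<^sup>2" by simp
    also have "\<dots> = 1 - 4 * s\<^sup>2 + s\<^sup>2 * (s\<^sup>2 * (real N + 4))" by (simp add: power2_eq_square algebra_simps)
    also have "\<dots> \<le> 1 - 4 * s\<^sup>2 + s\<^sup>2 * 1" using s(2) by (intro add_left_mono mult_left_mono) auto
    also have "\<dots> < 1" using s(1) by simp
    finally have "(norm x)\<^sup>2 < 1\<^sup>2" by simp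
    then have "norm x < 1" by (rule power2_less_imp_less) simp
    then show "x \<in> unit_ball" by simp
  qed
  have \<phi>t: "\<phi> \<in> test_functions unit_ball"
    unfolding \<phi>_def by (rule box_bump_in_test_functions[OF m0 ab sub])
  note S = test_function_smooth[OF \<phi>t]
  have \<phi>0: "\<phi> x = 0" "grad \<phi> x = 0" if "x \<notin> box (z - w) (z + w)" for x
    unfolding \<phi>_def by (rule box_bump_eq_0[OF m0 ab that] grad_box_bump_eq_0[OF m0 ab that])+
  have \<phi>K: "\<phi> x = 0" "grad \<phi> x = 0" if "x \<notin> cbox (z - w) (z + w)" for x
    using \<phi>0[of x] box_subset_cbox[of "z - w" "z + w"] that by blast+
  let ?q = "\<lambda>x. ang_form i j x (grad \<phi> x)"
  have D: "\<bar>grad \<phi> x $ k\<bar> \<le> 8 / w $ k" if "x \<in> box (z - w) (z + w)" for x k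
  proof -
    have "\<bar>grad \<phi> x $ k\<bar> \<le> 4 * (m $ k * ((z + w) $ k - (z - w) $ k))"
      unfolding \<phi>_def by (rule abs_grad_box_bump_le[OF m0 that])
    also have "\<dots> = 8 / w $ k" using w0[of k] by (simp add: m_def power2_eq_square)
    finally show ?thesis .
  qed
  have qb: "?q x \<le> 64 * (real N + 11) / s ^ 4" if x: "x \<in> box (z - w) (z + w)" for x
  proof -
    have xc: "x \<in> cbox (z - w) (z + w)" using x box_subset_cbox by blast
    define \<xi> where "\<xi> = grad \<phi> x"
    have sq: "(\<xi> $ k)\<^sup>2 \<le> 64 / s ^ 4" if "k \<noteq> j" for k
    proof -
      have "\<bar>\<xi> $ k\<bar>\<^sup>2 \<le> (8 / s\<^sup>2)\<^sup>2" using D[OF x, of k] that by (intro power_mono) (auto simp: \<xi>_def w_def)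
      then show ?thesis by (simp add: power_divide)
    qed
    have sqj: "(\<xi> $ j)\<^sup>2 \<le> 64 / s ^ 6"
    proof -
      have "\<bar>\<xi> $ j\<bar>\<^sup>2 \<le> (8 / s ^ 3)\<^sup>2" using D[OF x, of j] by (intro power_mono) (auto simp: \<xi>_def w_def)
      then show ?thesis by (simp add: power_divide)
    qed
    have r1: "\<bar>x $ i\<bar> \<le> 1" using xi[OF xc] s6 by auto
    have "(1 - 4 * s\<^sup>2)\<^sup>2 \<le> (x $ i)\<^sup>2" using xi(1)[OF xc] s6 by (intro power_mono) auto
    moreover have "1 - 8 * s\<^sup>2 \<le> (1 - 4 * s\<^sup>2)\<^sup>2" by (simp add: power2_diff)
    ultimately have r2: "1 - (x $ i)\<^sup>2 \<le> 8 * s\<^sup>2" by simp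
    have "(1 - (x $ i)\<^sup>2) * (\<xi> $ j)\<^sup>2 \<le> 8 * s\<^sup>2 * (64 / s ^ 6)"
      using r2 sqj by (intro mult_mono) auto
    also have "\<dots> = 8 * (64 / s ^ 4)" using s(1) by (simp add: field_simps flip: power_add)
    finally have t2: "(1 - (x $ i)\<^sup>2) * (\<xi> $ j)\<^sup>2 \<le> 8 * (64 / s ^ 4)" .
    have "\<bar>x $ i * x $ j * (\<xi> $ i * \<xi> $ j)\<bar> = \<bar>x $ i\<bar> * \<bar>x $ j\<bar> * (\<bar>\<xi> $ i\<bar> * \<bar>\<xi> $ j\<bar>)" by (simp add: abs_mult)
    also have "\<dots> \<le> 1 * s ^ 3 * (8 / s\<^sup>2 * (8 / s ^ 3))"
      using r1 xj[OF xc] D[OF x, of i] D[OF x, of j] ij s(1) by (intro mult_mono) (auto simp: \<xi>_def w_def)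
    also have "\<dots> = s\<^sup>2 * (64 / s ^ 4)" using s(1) by (simp add: field_simps flip: power_add)
    also have "\<dots> \<le> 1 * (64 / s ^ 4)" using s6 by (intro mult_right_mono) auto
    finally have t3: "x $ i * x $ j * (\<xi> $ i * \<xi> $ j) \<le> 64 / s ^ 4" by simp
    have t4: "(\<Sum>k\<in>UNIV - {i, j}. (\<xi> $ k)\<^sup>2) \<le> real N * (64 / s ^ 4)"
    proof -
      have "(\<Sum>k\<in>UNIV - {i, j}. (\<xi> $ k)\<^sup>2) \<le> (\<Sum>k\<in>UNIV - {i, j}. 64 / s ^ 4)" by (intro sum_mono sq) auto
      also have "\<dots> = real (card (UNIV - {i, j})) * (64 / s ^ 4)" by simp
      also have "\<dots> \<le> real N * (64 / s ^ 4)"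
        unfolding N_def by (intro mult_right_mono of_nat_mono card_mono) auto
      finally show ?thesis .
    qed
    have "?q x = (\<xi> $ i)\<^sup>2 - (x $ j)\<^sup>2 * (\<xi> $ i)\<^sup>2 + (1 - (x $ i)\<^sup>2) * (\<xi> $ j)\<^sup>2 + 2 * (x $ i * x $ j * (\<xi> $ i * \<xi> $ j)) + (\<Sum>k\<in>UNIV - {i, j}. (\<xi> $ k)\<^sup>2)"
      unfolding \<xi>_def[symmetric] ang_form_eq[OF ij] by (simp add: power2_eq_square algebra_simps)
    also have "\<dots> \<le> 64 / s ^ 4 + 8 * (64 / s ^ 4) + 2 * (64 / s ^ 4) + real N * (64 / s ^ 4)"
      using sq[OF ij] t2 t3 t4 mult_nonneg_nonneg[OF zero_le_power2[of "x $ j"] zero_le_power2[of "\<xi> $ i"]] by linarith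
    also have "\<dots> = 64 * (real N + 11) / s ^ 4" by (simp add: algebra_simps add_divide_distrib)
    finally show ?thesis .
  qed
  have ic: "integrable lborel (\<lambda>x. c * indicator (cbox a b) x)" for c :: real and a b :: "real ^ 'n"
    by (intro integrable_mult_right integrable_real_indicator) (simp_all add: emeasure_lborel_cbox_finite[unfolded infinity_ennreal_def])
  show ?thesis
  proof (rule that[OF \<phi>t])
    have cq: "continuous_on UNIV ?q" unfolding ang_form_def by (intro continuous_intros S)
    have "energy i j \<phi> = (LINT x|lborel. ?q x)" by (rule test_function_energy(1)[OF \<phi>t ij])
    also have "\<dots> \<le> (LINT x|lborel. 64 * (real N + 11) / s ^ 4 * indicator (cbox (z - w) (z + w)) x)"
    proof (rule integral_mono)
      show "integrable lborel ?q"
        by (rule integrable_lborel_of_compact_support[OF compact_cbox[of "z - w" "z + w"] cq])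
           (simp add: \<phi>K ang_form_def)
      show "?q x \<le> 64 * (real N + 11) / s ^ 4 * indicator (cbox (z - w) (z + w)) x" for x
      proof (cases "x \<in> box (z - w) (z + w)")
        case True
        then show ?thesis using qb[OF True] box_subset_cbox[of "z - w" "z + w"] by (auto simp: indicator_def)
      next
        case False
        then show ?thesis using s by (simp add: \<phi>0 ang_form_def indicator_def)
      qed
    qed (rule ic)
    also have "\<dots> = 64 * (real N + 11) / s ^ 4 * (2 ^ N * s ^ (2 * N + 1))"
      using content_cbox_center[of w z] w0 by (simp add: less_imp_le prodw N_def)
    also have "\<dots> = 64 * (real N + 11) * 2 ^ N * (s ^ (2 * N + 1) / s ^ 4)" by simp
    finally show "energy i j \<phi> \<le> 64 * (real N + 11) * 2 ^ N * (s ^ (2 * N + 1) / s ^ 4)" .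
    fix p :: real assume p: "0 < p"
    have c: "continuous_on UNIV (\<lambda>x. \<bar>\<phi> x\<bar> powr p)"
      using continuous_on_compose2[OF continuous_on_abs_powr[OF p, of UNIV] S(2)] by simp
    have z0: "\<bar>\<phi> x\<bar> powr p = 0" if "x \<notin> cbox (z - w) (z + w)" for x using \<phi>K[OF that] by simp
    have i: "integrable lborel (\<lambda>x. \<bar>\<phi> x\<bar> powr p)"
      by (rule integrable_lborel_of_compact_support[OF compact_cbox c z0])
    have eq: "integrable (lebesgue_on unit_ball) (\<lambda>x. \<bar>\<phi> x\<bar> powr p) \<longleftrightarrow> integrable lborel (\<lambda>x. \<bar>\<phi> x\<bar> powr p)"
      "(LINT x|lebesgue_on unit_ball. \<bar>\<phi> x\<bar> powr p) = (LINT x|lborel. \<bar>\<phi> x\<bar> powr p)"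
      by (rule lebesgue_on_eq_lborel_of_support[OF _ borel_measurable_continuous_onI[OF c] sub z0]; simp)+
    show "integrable (lebesgue_on unit_ball) (\<lambda>x. \<bar>\<phi> x\<bar> powr p)" unfolding eq by (rule i)
    \<comment> \<open>On the box of half the size every factor of the bump is at least exp(-4/3).\<close>
    define v where "v = (1 / 2) *\<^sub>R w"
    have v0: "0 \<le> v $ k" for k using w0[of k] by (simp add: v_def)
    have lb: "exp (- (4 / 3)) ^ N \<le> \<phi> x" if x: "x \<in> cbox (z - v) (z + v)" for x
    proof -
      have "exp (- (4 / 3)) \<le> flat 0 (m $ k * ((x $ k - (z - w) $ k) * ((z + w) $ k - x $ k)))" for k
      proof (rule flat_0_ge)
        define y where "y = (x $ k - z $ k) / w $ k"
        have "z $ k - w $ k / 2 \<le> x $ k" "x $ k \<le> z $ k + w $ k / 2"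
          using x[unfolded mem_box_cart, rule_format, of k] by (simp_all add: v_def)
        then have "\<bar>x $ k - z $ k\<bar> \<le> w $ k / 2" unfolding abs_le_iff by linarith
        then have "\<bar>y\<bar> \<le> 1 / 2" using w0[of k] by (simp add: y_def abs_divide field_simps)
        then have "\<bar>y\<bar>\<^sup>2 \<le> (1 / 2)\<^sup>2" by (intro power_mono) auto
        then have "y\<^sup>2 \<le> 1 / 4" by (simp add: power_divide)
        moreover have "m $ k * ((x $ k - (z - w) $ k) * ((z + w) $ k - x $ k)) = 1 - y\<^sup>2"
        proof -
          have xk: "x $ k = z $ k + y * w $ k" using w0[of k] by (simp add: y_def)
          have "(x $ k - (z - w) $ k) * ((z + w) $ k - x $ k) = (w $ k)\<^sup>2 * (1 - y\<^sup>2)"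
            unfolding xk by (simp add: power2_eq_square algebra_simps)
          then show ?thesis using w0[of k] by (simp add: m_def)
        qed
        ultimately show "3 / 4 \<le> m $ k * ((x $ k - (z - w) $ k) * ((z + w) $ k - x $ k))" by simp
      qed
      then have "(\<Prod>k\<in>(UNIV::'n set). exp (- (4 / 3))) \<le> \<phi> x"
        unfolding \<phi>_def box_bump_def by (intro prod_mono) auto
      then show ?thesis by (simp add: N_def)
    qed
    have "(exp (- (4 / 3)) ^ N) powr p * s ^ (2 * N + 1)
       = (LINT x|lborel. (exp (- (4 / 3)) ^ N) powr p * indicator (cbox (z - v) (z + v)) x)"
    proof -
      have "measure lborel (cbox (z - v) (z + v)) = 2 ^ N * (\<Prod>k\<in>UNIV. v $ k)"
        using content_cbox_center[of v z] v0 by (simp add: N_def)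
      also have "\<dots> = (\<Prod>k\<in>UNIV. 2 * v $ k)" by (simp add: prod.distrib N_def)
      also have "\<dots> = s ^ (2 * N + 1)" by (simp add: v_def prodw)
      finally show ?thesis by simp
    qed
    also have "\<dots> \<le> (LINT x|lborel. \<bar>\<phi> x\<bar> powr p)"
    proof (rule integral_mono)
      show "(exp (- (4 / 3)) ^ N) powr p * indicator (cbox (z - v) (z + v)) x \<le> \<bar>\<phi> x\<bar> powr p" for x
        using lb[of x] p by (cases "x \<in> cbox (z - v) (z + v)") (auto intro!: powr_mono2)
    qed (rule ic, rule i)
    finally show "(exp (- (4 / 3)) ^ N) powr p * s ^ (2 * N + 1) \<le> (LINT x|lebesgue_on unit_ball. \<bar>\<phi> x\<bar> powr p)"
      unfolding eq .
  qed
qed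

text \<open>After division by the common power of s, the inequality would bound a positive constant by s^e with
e = (2N - 3) - (4N + 2)/p > 0, which fails for small s.\<close>
lemma supercritical_fails:
  fixes i j :: "'n::finite"
  assumes ij: "i \<noteq> j" and p: "crit_exp CARD('n) < p"
  shows "\<exists>\<phi> \<in> test_functions (unit_ball :: (real ^ 'n) set). \<not> Lp_norm_sq p \<phi> \<le> ereal (C * energy i j \<phi>)"
proof -
  define N where "N = CARD('n)"
  have N: "2 \<le> N" using two_le_CARD[OF ij] by (simp add: N_def)
  define n where "n = real N"
  have n: "2 \<le> n" using N by (simp add: n_def)
  have cp: "(4 * n + 2) / (2 * n - 3) < p" using p by (simp add: crit_exp_def n_def N_def)
  have p0: "0 < p" using cp n by (smt (verit) divide_pos_pos)
  define e where "e = (2 * n - 3) - (2 * n + 1) * (2 / p)"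
  have e: "0 < e"
  proof -
    have "4 * n + 2 < p * (2 * n - 3)" using cp n by (simp add: divide_less_eq)
    then have "(2 * n + 1) * (2 / p) < 2 * n - 3" using p0 by (simp add: divide_less_eq mult.commute)
    then show ?thesis by (simp add: e_def)
  qed
  define \<kappa> :: real where "\<kappa> = exp (- (4 / 3)) ^ N"
  have \<kappa>: "0 < \<kappa>" by (simp add: \<kappa>_def)
  define B where "B = (\<bar>C\<bar> + 1) * (64 * (n + 11) * 2 ^ N)"
  have B: "0 < B" using n by (simp add: B_def)
  \<comment> \<open>The first bound keeps the bump inside the ball, the second makes B s^e smaller than \<kappa>^2.\<close>
  define s where "s = min (1 / sqrt (n + 4)) ((\<kappa>\<^sup>2 / (2 * B)) powr (1 / e))"
  have s0: "0 < s" using n \<kappa> B by (simp add: s_def)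
  have "s\<^sup>2 \<le> (1 / sqrt (n + 4))\<^sup>2" using s0 by (intro power_mono) (auto simp: s_def)
  then have s1: "s\<^sup>2 * (real N + 4) \<le> 1" using n by (simp add: power_divide n_def pos_le_divide_eq)
  have "s powr e \<le> ((\<kappa>\<^sup>2 / (2 * B)) powr (1 / e)) powr e" using s0 e by (intro powr_mono2) (auto simp: s_def)
  also have "\<dots> = \<kappa>\<^sup>2 / (2 * B)" using e B \<kappa> by (simp add: powr_powr)
  also have "\<dots> < \<kappa>\<^sup>2 / B" using \<kappa> B by (simp add: field_simps)
  finally have se: "B * s powr e < \<kappa>\<^sup>2" using B by (simp add: pos_less_divide_eq mult.commute)
  obtain \<phi> :: "real ^ 'n \<Rightarrow> real" where \<phi>: "\<phi> \<in> test_functions unit_ball"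
    and En: "energy i j \<phi> \<le> 64 * (real N + 11) * 2 ^ N * (s ^ (2 * N + 1) / s ^ 4)"
    and int: "\<And>p. 0 < p \<Longrightarrow> integrable (lebesgue_on unit_ball) (\<lambda>x. \<bar>\<phi> x\<bar> powr p)"
    and lb: "\<And>p. 0 < p \<Longrightarrow> (exp (- (4 / 3)) ^ N) powr p * s ^ (2 * N + 1) \<le> (LINT x|lebesgue_on unit_ball. \<bar>\<phi> x\<bar> powr p)"
    using concentrating_test_function[OF ij s0, folded N_def, OF s1] by blast
  have pw: "s ^ (2 * N + 1) = s powr (2 * n + 1)"
    using powr_realpow[OF s0, of "2 * N + 1"] by (simp add: n_def add.commute)
  have "C * energy i j \<phi> \<le> (\<bar>C\<bar> + 1) * (64 * (n + 11) * 2 ^ N * (s ^ (2 * N + 1) / s ^ 4))"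
    using En energy_nonneg[OF ij, of \<phi>] unfolding n_def by (intro mult_mono) auto
  also have "s ^ (2 * N + 1) / s ^ 4 = s powr (2 * n + 1 - 4)"
  proof -
    have "s ^ 4 = s powr 4" using powr_realpow[OF s0, of 4] by simp
    then show ?thesis by (simp only: pw powr_diff)
  qed
  also have "2 * n + 1 - 4 = e + (2 * n + 1) * (2 / p)" by (simp add: e_def)
  also have "(\<bar>C\<bar> + 1) * (64 * (n + 11) * 2 ^ N * s powr (e + (2 * n + 1) * (2 / p))) = B * s powr e * s powr ((2 * n + 1) * (2 / p))"
    by (simp only: B_def powr_add mult.assoc)
  also have "\<dots> < \<kappa>\<^sup>2 * s powr ((2 * n + 1) * (2 / p))"
    using se s0 by (intro mult_strict_right_mono) auto
  also have "\<dots> = (\<kappa> powr p * s ^ (2 * N + 1)) powr (2 / p)"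
  proof -
    have "(\<kappa> powr p) powr (2 / p) = \<kappa>\<^sup>2" using p0 \<kappa> by (simp add: powr_powr)
    then show ?thesis by (simp only: pw powr_mult powr_powr)
  qed
  also have "\<dots> \<le> (LINT x|lebesgue_on unit_ball. \<bar>\<phi> x\<bar> powr p) powr (2 / p)"
    using lb[OF p0] p0 s0 by (intro powr_mono2) (auto simp: \<kappa>_def)
  finally have "ereal (C * energy i j \<phi>) < Lp_norm_sq p \<phi>"
    using int[OF p0] by (simp add: Lp_norm_sq_def)
  then show ?thesis using \<phi> by (intro bexI[of _ \<phi>]) auto
qed

section \<open>The best constant\<close>

lemma Lp_norm_sq_pos:
  fixes u :: "real ^ 'n \<Rightarrow> real"
  assumes "integrable (lebesgue_on unit_ball) (\<lambda>x. \<bar>u x\<bar> powr p)" "\<not> (AE x in lebesgue_on unit_ball. u x = 0)"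
  shows "0 < (LINT x|lebesgue_on unit_ball. \<bar>u x\<bar> powr p) powr (2 / p)"
proof -
  have "(LINT x|lebesgue_on unit_ball. \<bar>u x\<bar> powr p) \<noteq> 0"
  proof
    assume "(LINT x|lebesgue_on unit_ball. \<bar>u x\<bar> powr p) = 0"
    then have "AE x in lebesgue_on unit_ball. \<bar>u x\<bar> powr p = 0"
      using integral_nonneg_eq_0_iff_AE[OF assms(1)] by simp
    then have "AE x in lebesgue_on unit_ball. u x = 0" by eventually_elim simp
    with assms(2) show False by contradiction
  qed
  then show ?thesis by simp
qed

theorem corollary1p2:
  fixes i j :: "'n :: finite"
  assumes "CARD('n) \<ge> 2" and "i \<noteq> j"
  shows "0 < C_1_0 i j (crit_exp CARD('n)) \<and> C_1_0 i j (crit_exp CARD('n)) < \<infinity> \<and>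
    (\<forall>u \<in> H10 (unit_ball :: (real ^ 'n) set).
       Lp_norm_sq (crit_exp CARD('n)) u
         \<le> 1 / C_1_0 i j (crit_exp CARD('n)) * ereal (energy i j u)) \<and>
    (\<forall>p > crit_exp CARD('n). \<not> (\<exists>C :: real. \<forall>u \<in> H10 (unit_ball :: (real ^ 'n) set).
       Lp_norm_sq p u \<le> ereal (C * energy i j u)))"
proof -
  define p where "p = crit_exp CARD('n)"
  define K where "K = 2 * sobolev_const CARD('n)"
  have K: "0 < K" using sobolev_const_pos[OF assms(1)] by (simp add: K_def)
  define L where "L u = (LINT x|lebesgue_on unit_ball. \<bar>u x\<bar> powr p) powr (2 / p)" for u :: "real ^ 'n \<Rightarrow> real"
  let ?S = "{u \<in> H10 (unit_ball :: (real ^ 'n) set). \<not> (AE x in lebesgue_on unit_ball. u x = 0)}"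
  have int: "integrable (lebesgue_on unit_ball) (\<lambda>x. \<bar>u x\<bar> powr p)" if "u \<in> H10 unit_ball" for u :: "real ^ 'n \<Rightarrow> real"
    using H10_Sobolev(1)[OF that assms(2)] by (simp add: p_def)
  have LE: "L u \<le> K * energy i j u" if "u \<in> H10 unit_ball" for u
    using H10_Sobolev(2)[OF that assms(2)] by (simp add: L_def p_def K_def)
  have Lp: "Lp_norm_sq p u = ereal (L u)" if "u \<in> H10 unit_ball" for u
    using int[OF that] by (simp add: Lp_norm_sq_def L_def)
  have Lpos: "0 < L u" if "u \<in> ?S" for u
    unfolding L_def using that int[of u] by (intro Lp_norm_sq_pos) auto
  have quot: "ereal (energy i j u) / Lp_norm_sq p u = ereal (energy i j u / L u)" if "u \<in> ?S" for u
    using that Lpos[OF that] by (simp add: Lp)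
  define c where "c = C_1_0 i j p"
  have cle: "c \<le> ereal (energy i j u / L u)" if "u \<in> ?S" for u
    unfolding c_def C_1_0_def using INF_lower[OF that, of "\<lambda>u. ereal (energy i j u) / Lp_norm_sq p u"] quot[OF that] by simp
  have "ereal (1 / K) \<le> c"
    unfolding c_def C_1_0_def
  proof (rule INF_greatest)
    fix u assume u: "u \<in> ?S"
    then have "1 / K \<le> energy i j u / L u" using LE[of u] Lpos[OF u] K by (simp add: field_simps)
    then show "ereal (1 / K) \<le> ereal (energy i j u) / Lp_norm_sq p u" using quot[OF u] by simp
  qed
  then have cpos: "0 < c" using K by (intro less_le_trans[of 0 "ereal (1 / K)" c]) auto
  obtain \<phi> :: "real ^ 'n \<Rightarrow> real" where \<phi>: "\<phi> \<in> test_functions unit_ball"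
    "\<not> Lp_norm_sq (p + 1) \<phi> \<le> ereal (0 * energy i j \<phi>)"
    using supercritical_fails[OF assms(2), of "p + 1" 0] by (auto simp: p_def)
  have "\<phi> \<in> ?S"
  proof -
    have "\<not> (AE x in lebesgue_on unit_ball. \<phi> x = 0)"
    proof
      assume z: "AE x in lebesgue_on unit_ball. \<phi> x = 0"
      then have "AE x in lebesgue_on unit_ball. \<bar>\<phi> x\<bar> powr (p + 1) = 0" by eventually_elim simp
      then have "(LINT x|lebesgue_on unit_ball. \<bar>\<phi> x\<bar> powr (p + 1)) = 0" by (rule integral_eq_zero_AE)
      moreover have "integrable (lebesgue_on unit_ball) (\<lambda>x. \<bar>\<phi> x\<bar> powr (p + 1))"
      proof -
        have "\<phi> \<in> borel_measurable (lebesgue_on unit_ball)"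
          by (rule weak_grad_measurable(1)[OF has_weak_grad_test_function[OF \<phi>(1)]]) simp
        then have m: "(\<lambda>x. \<bar>\<phi> x\<bar> powr (p + 1)) \<in> borel_measurable (lebesgue_on unit_ball)" by (rule measurable_abs_powr)
        have "integrable (lebesgue_on unit_ball) (\<lambda>x::real^'n. 0::real)" by simp
        then show ?thesis
          by (rule integrable_cong_AE_imp[OF _ m]) (use z in \<open>eventually_elim, simp\<close>)
      qed
      ultimately show False using \<phi>(2) by (simp add: Lp_norm_sq_def)
    qed
    then show ?thesis using \<phi>(1) test_functions_subset_H10 by auto
  qed
  then have "c \<le> ereal (energy i j \<phi> / L \<phi>)" by (rule cle)
  then have cfin: "c < \<infinity>" by auto
  obtain k where k: "c = ereal k" "0 < k" using cpos cfin by (cases c) auto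
  have ineq: "Lp_norm_sq p u \<le> 1 / c * ereal (energy i j u)" if u: "u \<in> H10 unit_ball" for u :: "real ^ 'n \<Rightarrow> real"
  proof (cases "u \<in> ?S")
    case True
    then have "k \<le> energy i j u / L u" using cle[OF True] k by simp
    then have "L u \<le> 1 / k * energy i j u" using Lpos[OF True] k(2) by (simp add: field_simps)
    then show ?thesis using k by (simp add: Lp[OF u])
  next
    case False
    then have "AE x in lebesgue_on unit_ball. u x = 0" using u by simp
    then have "AE x in lebesgue_on unit_ball. \<bar>u x\<bar> powr p = 0" by eventually_elim simp
    then have "(LINT x|lebesgue_on unit_ball. \<bar>u x\<bar> powr p) = 0" by (rule integral_eq_zero_AE)
    then have "L u = 0" by (simp add: L_def)
    then show ?thesis using k energy_nonneg[OF assms(2), of u] by (simp add: Lp[OF u])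
  qed
  have opt: "\<not> (\<exists>C :: real. \<forall>u \<in> H10 (unit_ball :: (real ^ 'n) set). Lp_norm_sq p' u \<le> ereal (C * energy i j u))"
    if "p < p'" for p'
    using supercritical_fails[OF assms(2), of p'] that test_functions_subset_H10 unfolding p_def by blast
  show ?thesis using cpos cfin ineq opt unfolding c_def p_def by blast
qed

end
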